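(* Let $n\ge 3$. Let $U\subset\mathcal{S}^{n\times n}$ be an open set satisfying $$O^{-1}UO=U\quad\text{for all }O\in O(n)$$ and $$U\cap\{M+tN : 0<t<\infty\}\ \text{ is convex for all } M\in\mathcal{S}^{n\times n},\ N\in\mathcal{S}^{n\times n}_+ .$$ Let $F\in C^1(U)$ be a real-valued function satisfying $$F(O^{-1}MO)=F(M)\quad\text{for all }M\in U,\ O\in O(n),$$ and such that the matrix $(F_{ij}(M))$ is positive definite for all $M\in U$, where $F_{ij}(M)=\frac{\partial F}{\partial M_{ij}}(M)$. Assume that $u\in C^2(\mathbb{R}^n)$ is a positive function satisfying $$F(A^u)=1,\quad A^u\in U,\quad\text{on }\mathbb{R}^n,$$ and $$\Delta u\le 0\quad\text{on }\mathbb{R}^n.$$ Then there exist $\bar x\in\mathbb{R}^n$ and constants $a>0$ and $b\ge 0$ satisfying $2b^2a^{-2}I\in U$ and $F(2b^2a^{-2}I)=1$ such that $$u(x)=\left(\frac{a}{1+b^2|x-\bar x|^2}\right)^{\frac{n-2}{2}}\quad\text{for all }x\in\mathbb{R}^n.$$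
   Context: $\mathcal{S}^{n\times n}$ denotes the set of $n\times n$ real symmetric matrices, $\mathcal{S}^{n\times n}_+\subset\mathcal{S}^{n\times n}$ the subset of positive definite matrices, $O(n)$ the set of $n\times n$ real orthogonal matrices, and $I$ the $n\times n$ identity matrix. For a positive $C^2$ function $u$ on an open subset of $\mathbb{R}^n$, $$A^u:=-\frac{2}{n-2}u^{-\frac{n+2}{n-2}}\nabla^2u+\frac{2n}{(n-2)^2}u^{-\frac{2n}{n-2}}\nabla u\otimes\nabla u-\frac{2}{(n-2)^2}u^{-\frac{2n}{n-2}}|\nabla u|^2I,$$ a symmetric-matrix-valued function on the domain of $u$. *)

theory Defs
  imports "HOL-Analysis.Analysis"
begin

section \<open>Symmetric matrices\<close>

definition sym_matrices :: "(real ^ 'n ^ 'n) set" where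
  "sym_matrices = {M. transpose M = M}"

definition pos_def :: "real ^ 'n ^ 'n \<Rightarrow> bool" where
  "pos_def M \<longleftrightarrow> M \<in> sym_matrices \<and> (\<forall>x. x \<noteq> 0 \<longrightarrow> x \<bullet> (M *v x) > 0)"

definition outer_prod :: "real ^ 'n \<Rightarrow> real ^ 'n \<Rightarrow> real ^ 'n ^ 'n" where
  "outer_prod v w = (\<chi> i j. v $ i * w $ j)"


section \<open>Partial derivatives of a function of a symmetric matrix\<close>

text \<open>
  The function is only given on symmetric matrices, so \<open>F\<^sub>i\<^sub>j\<close> is taken in the
  symmetric direction \<open>(e\<^sub>i e\<^sub>j\<^sup>T + e\<^sub>j e\<^sub>i\<^sup>T) / 2\<close>.  This is the usual convention, in
  which the matrix \<open>(F\<^sub>i\<^sub>j)\<close> is symmetric and represents the derivative by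
  \<open>DF(M)(N) = \<Sum>\<^sub>i\<^sub>j F\<^sub>i\<^sub>j(M) N\<^sub>i\<^sub>j\<close>; see \<open>has_derivative_sym_grad\<close> below.
\<close>

definition sym_unit :: "'n \<Rightarrow> 'n \<Rightarrow> real ^ 'n ^ 'n" where
  "sym_unit i j =
    (1 / 2) *\<^sub>R (outer_prod (axis i 1) (axis j 1) + outer_prod (axis j 1) (axis i 1))"

definition sym_grad :: "(real ^ 'n ^ 'n \<Rightarrow> real) \<Rightarrow> real ^ 'n ^ 'n \<Rightarrow> real ^ 'n ^ 'n" where
  "sym_grad F M = (\<chi> i j. deriv (\<lambda>t. F (M + t *\<^sub>R sym_unit i j)) 0)"

text \<open>Intended for \<open>U\<close> relatively open in the symmetric matrices.\<close>

definition C1_on_sym :: "(real ^ 'n ^ 'n) set \<Rightarrow> (real ^ 'n ^ 'n \<Rightarrow> real) \<Rightarrow> bool" where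
  "C1_on_sym U F \<longleftrightarrow> F differentiable_on U \<and> continuous_on U (sym_grad F)"

lemma sym_unit_sym: "sym_unit i j \<in> sym_matrices"
  by (simp add: sym_matrices_def sym_unit_def outer_prod_def transpose_def vec_eq_iff algebra_simps)

lemma sym_matrix_expand:
  assumes "N \<in> sym_matrices"
  shows "N = (\<Sum>i\<in>UNIV. \<Sum>j\<in>UNIV. N $ i $ j *\<^sub>R sym_unit i j)"
proof -
  have s: "N $ i $ j = N $ j $ i" for i j
    using assms by (auto simp: sym_matrices_def transpose_def vec_eq_iff)
  have d: "(\<Sum>i\<in>UNIV. \<Sum>j\<in>UNIV. c i j * (axis i 1 $ k * axis j 1 $ l)) = c k l"
    for c :: "'a \<Rightarrow> 'a \<Rightarrow> real" and k l
  proof -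
    have "(\<Sum>j\<in>UNIV. c i j * (axis i 1 $ k * axis j 1 $ l)) = (if k = i then c i l else 0)" for i
    proof -
      have "(\<Sum>j\<in>UNIV. c i j * (axis i 1 $ k * axis j 1 $ l))
          = (\<Sum>j\<in>UNIV. if l = j then c i j * axis i 1 $ k else 0)"
        by (rule sum.cong) (simp_all add: axis_def)
      then show ?thesis by (simp add: axis_def)
    qed
    then show ?thesis by simp
  qed
  have "(\<Sum>i\<in>UNIV. \<Sum>j\<in>UNIV. N $ i $ j *\<^sub>R sym_unit i j) $ k $ l = N $ k $ l" for k l
  proof -
    have "(\<Sum>i\<in>UNIV. \<Sum>j\<in>UNIV. N $ i $ j *\<^sub>R sym_unit i j) $ k $ l
      = (\<Sum>i\<in>UNIV. \<Sum>j\<in>UNIV. (N $ i $ j / 2) * (axis i 1 $ k * axis j 1 $ l)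
          + (N $ i $ j / 2) * (axis i 1 $ l * axis j 1 $ k))"
      by (simp add: sym_unit_def outer_prod_def distrib_left mult.commute)
    also have "\<dots> = N $ k $ l / 2 + N $ l $ k / 2"
      unfolding sum.distrib d ..
    finally show ?thesis using s[of k l] by simp
  qed
  then show ?thesis by (simp add: vec_eq_iff)
qed

lemma has_derivative_sym_grad:
  fixes F :: "real ^ 'n ^ 'n \<Rightarrow> real"
  assumes U: "openin (top_of_set sym_matrices) U" and M: "M \<in> U"
    and D: "(F has_derivative D) (at M within U)" and N: "N \<in> sym_matrices"
  shows "D N = (\<Sum>i\<in>UNIV. \<Sum>j\<in>UNIV. sym_grad F M $ i $ j * N $ i $ j)"
proof -
  have lin: "linear D" using D by (rule has_derivative_linear)
  have "sym_grad F M $ i $ j = D (sym_unit i j)" for i j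
  proof -
    let ?E = "sym_unit i j :: real ^ 'n ^ 'n"
    obtain W where W: "open W" "U = sym_matrices \<inter> W"
      using U by (auto simp: openin_open)
    define T where "T = (\<lambda>t. M + t *\<^sub>R ?E) -` W"
    have T: "open T" "0 \<in> T"
      unfolding T_def using W M by (auto intro!: open_vimage continuous_intros)
    have sub: "(\<lambda>t. M + t *\<^sub>R ?E) ` T \<subseteq> U"
      using W M sym_unit_sym[of i j]
      by (auto simp: T_def sym_matrices_def transpose_def vec_eq_iff)
    have "((\<lambda>t. M + t *\<^sub>R ?E) has_derivative (\<lambda>t. t *\<^sub>R ?E)) (at 0 within T)"
      by (auto intro!: derivative_eq_intros)
    moreover have "(F has_derivative D) (at (M + 0 *\<^sub>R ?E) within (\<lambda>t. M + t *\<^sub>R ?E) ` T)"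
      using has_derivative_subset[OF D sub] by simp
    ultimately have "((\<lambda>t. F (M + t *\<^sub>R ?E)) has_derivative (\<lambda>t. D (t *\<^sub>R ?E))) (at 0 within T)"
      by (rule has_derivative_in_compose)
    moreover have "D (t *\<^sub>R ?E) = D ?E * t" for t
      by (simp add: linear_scale[OF lin])
    ultimately have "((\<lambda>t. F (M + t *\<^sub>R ?E)) has_field_derivative D ?E) (at 0)"
      by (simp only: has_field_derivative_def at_within_open[OF T(2,1)])
    then show ?thesis by (simp add: sym_grad_def DERIV_imp_deriv)
  qed
  moreover have "D N = (\<Sum>i\<in>UNIV. \<Sum>j\<in>UNIV. N $ i $ j *\<^sub>R D (sym_unit i j))"
    by (subst sym_matrix_expand[OF N]) (simp only: linear_sum[OF lin] linear_scale[OF lin])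
  ultimately show ?thesis by (simp add: mult.commute)
qed


section \<open>Derivatives of a scalar function\<close>

definition partial_deriv :: "'n \<Rightarrow> (real ^ 'n \<Rightarrow> real) \<Rightarrow> real ^ 'n \<Rightarrow> real" where
  "partial_deriv i u x = deriv (\<lambda>t. u (x + t *\<^sub>R axis i 1)) 0"

definition grad :: "(real ^ 'n \<Rightarrow> real) \<Rightarrow> real ^ 'n \<Rightarrow> real ^ 'n" where
  "grad u x = (\<chi> i. partial_deriv i u x)"

definition hess :: "(real ^ 'n \<Rightarrow> real) \<Rightarrow> real ^ 'n \<Rightarrow> real ^ 'n ^ 'n" where
  "hess u x = (\<chi> i j. partial_deriv i (partial_deriv j u) x)"

definition laplacian :: "(real ^ 'n \<Rightarrow> real) \<Rightarrow> real ^ 'n \<Rightarrow> real" where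
  "laplacian u x = (\<Sum>i\<in>UNIV. partial_deriv i (partial_deriv i u) x)"

text \<open>Intended for open \<open>S\<close>.\<close>

definition C2_on :: "(real ^ 'n) set \<Rightarrow> (real ^ 'n \<Rightarrow> real) \<Rightarrow> bool" where
  "C2_on S u \<longleftrightarrow>
    u differentiable_on S \<and> grad u differentiable_on S \<and> continuous_on S (hess u)"


section \<open>The conformal Hessian \<open>A\<^sup>u\<close>\<close>

definition conf_hess :: "(real ^ 'n \<Rightarrow> real) \<Rightarrow> real ^ 'n \<Rightarrow> real ^ 'n ^ 'n" where
  "conf_hess u x = (let n = real CARD('n) in
      (- (2 / (n - 2)) * u x powr (- ((n + 2) / (n - 2)))) *\<^sub>R hess u x
    + (2 * n / (n - 2)\<^sup>2 * u x powr (- (2 * n / (n - 2)))) *\<^sub>R outer_prod (grad u x) (grad u x)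
    - (2 / (n - 2)\<^sup>2 * u x powr (- (2 * n / (n - 2))) * (norm (grad u x))\<^sup>2) *\<^sub>R mat 1)"

end

theory Submission
  imports Defs "HOL-Library.Landau_Symbols"
begin

text \<open>
  Put \<open>f = u powr (- 2 / (n - 2))\<close>.  Then \<open>A\<^sup>u = f D\<^sup>2f - |Df|\<^sup>2 / 2 I\<close>, and the functions in the
  conclusion are exactly those for which \<open>f\<close> is a positive quadratic polynomial \<open>e + k |x - p|\<^sup>2\<close>.
  Superharmonicity of \<open>u\<close> says that \<open>tr A\<^sup>u \<ge> 0\<close>.

  Inversion in the sphere of centre \<open>x\<close> and radius \<open>l\<close> turns \<open>f\<close> into its Kelvin transform
  \<open>|y - x|\<^sup>2 / l\<^sup>2 f (x + l\<^sup>2 (y - x) / |y - x|\<^sup>2)\<close>, whose conformal Hessian at \<open>y\<close> is that of \<open>f\<close> at the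
  inverted point, conjugated by a reflection (\<open>conf_mat_kelvin\<close>).  So Kelvin transforms solve the
  same equation, and they can be compared with \<open>f\<close>.  The comparison rests on a Hopf lemma
  (\<open>Hopf_boundary_point\<close>), which yields the strong maximum principle as well.  As \<open>U\<close> is convex only
  along positive definite directions, the equation cannot be linearised between two arbitrary
  solutions; but at a point of first-order contact the strict monotonicity of \<open>F\<close>
  (\<open>F_strictly_increasing\<close>) first forces the two conformal Hessians to be equal, and near this common
  value the linearisation is legitimate.

  Now move spheres.  Call a sphere dominated if \<open>f\<close> lies below its Kelvin transform outside of the
  sphere.  Around every centre all small spheres are dominated, because \<open>f\<close> grows at most
  quadratically: \<open>u\<close> is positive and superharmonic and cannot decay faster than the fundamental
  solution (\<open>quadratic_growth\<close>).  Let \<open>\<beta>\<close> be the limes superior of \<open>f y / |y|\<^sup>2\<close> at infinity.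
  Dominated spheres satisfy \<open>\<beta> \<le> f x / l\<^sup>2\<close>, and as long as this inequality is strict the radius can
  be increased further (\<open>moving_spheres_continue\<close>).  So either all spheres are dominated, which
  forces \<open>f\<close> to be constant, or every centre \<open>x\<close> has a critical dominated sphere with
  \<open>l\<^sup>2 = f x / \<beta>\<close>.

  In the second case all critical Kelvin transforms have the same leading coefficient \<open>\<beta>\<close> at
  infinity.  Seen from infinity, a superharmonic function in a punctured ball lies above a family of
  differentiable functions with a common value at the puncture, and this value is its limes
  inferior.  Two different gradients would push the limes inferior up (\<open>superharmonic_liminf_gap\<close>).
  So the gradients, which are \<open>Df x - 2 \<beta> x\<close> up to a common factor, do not depend on \<open>x\<close>
  (\<open>same_growth_gradient\<close>), and integration shows that \<open>f\<close> is a quadratic polynomial.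
\<close>

section \<open>Positive semidefinite matrices and the pairing of matrices\<close>

definition psd :: "real ^ 'n ^ 'n \<Rightarrow> bool" where
  "psd P \<longleftrightarrow> transpose P = P \<and> (\<forall>x. 0 \<le> x \<bullet> (P *v x))"

lemma inner_outer_prod: "(A :: real ^ 'n ^ 'n) \<bullet> outer_prod v w = v \<bullet> (A *v w)"
  by (simp add: inner_vec_def outer_prod_def matrix_vector_mult_def sum_distrib_left mult_ac)

lemma outer_prod_mult_vec: "outer_prod v w *v x = (w \<bullet> x) *\<^sub>R v"
  by (simp add: vec_eq_iff inner_vec_def outer_prod_def matrix_vector_mult_def sum_distrib_left mult_ac)

lemma transpose_outer_prod: "transpose (outer_prod v w) = outer_prod w v"
  by (simp add: vec_eq_iff outer_prod_def transpose_def)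

lemma trace_outer_prod: "trace (outer_prod v w) = v \<bullet> w"
  by (simp add: trace_def outer_prod_def inner_vec_def)

lemma transpose_add: "transpose (A + B) = transpose A + transpose B"
  and transpose_diff: "transpose (A - B) = transpose A - transpose B"
  and transpose_scaleR: "transpose (c *\<^sub>R A) = c *\<^sub>R transpose A"
  for A B :: "real ^ 'n ^ 'n"
  by (simp_all add: vec_eq_iff transpose_def)

lemma trace_scaleR: "trace (c *\<^sub>R A) = c * trace A" for A :: "real ^ 'n ^ 'n"
  by (simp add: trace_def sum_distrib_left)

lemma scaleR_mult_vec: "(c *\<^sub>R A) *v x = c *\<^sub>R (A *v x)" for A :: "real ^ 'n ^ 'n"
  by (simp add: scaleR_matrix_vector_assoc)

lemma symmetric_inner_swap:
  fixes H :: "real ^ 'n ^ 'n"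
  assumes "transpose H = H"
  shows "x \<bullet> (H *v y) = y \<bullet> (H *v x)"
  using assms by (metis dot_lmul_matrix inner_commute transpose_matrix_vector)

lemma symmetric_matrix_eqI:
  fixes H K :: "real ^ 'n ^ 'n"
  assumes "transpose H = H" "transpose K = K" and eq: "\<And>x. x \<bullet> (H *v x) = x \<bullet> (K *v x)"
  shows "H = K"
proof -
  have "x \<bullet> (H *v y) = x \<bullet> (K *v y)" for x y
    using eq[of "x + y"] eq[of x] eq[of y] symmetric_inner_swap[OF assms(1), of x y]
      symmetric_inner_swap[OF assms(2), of x y]
    by (simp add: inner_add_left inner_add_right matrix_vector_right_distrib)
  then have "H *v y = K *v y" for y by (metis vector_eq_rdot inner_commute)
  then show ?thesis by (simp add: matrix_eq)
qed

text \<open>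
  The quadratic polynomial \<open>t \<mapsto> (t x + y) \<bullet> P (t x + y)\<close> is nonnegative, so its
  discriminant is not positive.
\<close>

lemma psd_Cauchy_Schwarz:
  assumes "psd P"
  shows "(x \<bullet> (P *v y))\<^sup>2 \<le> (x \<bullet> (P *v x)) * (y \<bullet> (P *v y))"
proof -
  define a b c where "a = x \<bullet> (P *v x)" and "b = x \<bullet> (P *v y)" and "c = y \<bullet> (P *v y)"
  have sw: "y \<bullet> (P *v x) = b"
    using assms symmetric_inner_swap[of P x y] by (simp add: psd_def b_def)
  have q: "0 \<le> t\<^sup>2 * a + 2 * t * b + c" for t
  proof -
    have "0 \<le> (t *\<^sub>R x + y) \<bullet> (P *v (t *\<^sub>R x + y))"
      using assms by (simp add: psd_def)
    then show ?thesis
      by (simp add: inner_add_left inner_add_right matrix_vector_right_distrib a_def c_def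
          matrix_vector_mult_scaleR power2_eq_square sw algebra_simps flip: b_def)
  qed
  have ac: "a \<ge> 0" "c \<ge> 0" using assms by (auto simp: psd_def a_def c_def)
  have "b\<^sup>2 \<le> a * c"
  proof (cases "a = 0")
    case True
    have "b = 0"
    proof (rule ccontr)
      assume "b \<noteq> 0"
      then have "2 * (- (c + 1) / (2 * b)) * b = - (c + 1)" by simp
      then show False using q[of "- (c + 1) / (2 * b)"] True by simp
    qed
    then show ?thesis using True by simp
  next
    case False
    then have "a > 0" using ac by simp
    have "0 \<le> a * ((- b / a)\<^sup>2 * a + 2 * (- b / a) * b + c)"
      using q[of "- b / a"] \<open>a > 0\<close> by (simp only: zero_le_mult_iff) simp
    also have "\<dots> = a * c - b\<^sup>2"
      using \<open>a > 0\<close> by (simp add: field_simps power2_eq_square)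
    finally show ?thesis by simp
  qed
  then show ?thesis by (simp add: a_def b_def c_def)
qed

lemma inner_axis_mult_axis: "axis i 1 \<bullet> (A *v axis j 1) = A $ i $ j" for A :: "real ^ 'n ^ 'n"
  by (simp add: inner_axis' matrix_vector_mult_basis column_def)

lemma psd_zero_diagonal:
  assumes "psd P" "P $ i $ i = 0" shows "P $ i $ j = 0"
  using psd_Cauchy_Schwarz[OF assms(1), of "axis i 1" "axis j 1"] assms(2)
  by (simp add: inner_axis_mult_axis)

text \<open>
  This is the strict monotonicity of the linearised operator.  Gaussian elimination writes
  \<open>P\<close> as a sum of positive multiples of matrices \<open>v v\<^sup>T\<close>, each of which pairs
  with \<open>A\<close> to \<open>v \<bullet> A v > 0\<close>.  The induction removes one such summand at a time and
  counts the nonzero diagonal entries: in a semidefinite matrix a vanishing diagonal entry kills its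
  whole row.
\<close>

lemma pos_def_inner_psd_pos:
  fixes A P :: "real ^ 'n ^ 'n"
  assumes A: "pos_def A" and P: "psd P" "P \<noteq> 0"
  shows "A \<bullet> P > 0"
  using P
proof (induction "card {i. P $ i $ i \<noteq> 0}" arbitrary: P rule: less_induct)
  case less
  obtain i where i: "P $ i $ i \<noteq> 0"
  proof -
    have "\<exists>i. P $ i $ i \<noteq> 0"
    proof (rule ccontr)
      assume "\<nexists>i. P $ i $ i \<noteq> 0"
      then have "P $ i $ j = 0" for i j using psd_zero_diagonal[OF less.prems(1), of i j] by simp
      then show False using less.prems(2) by (simp add: vec_eq_iff)
    qed
    then show thesis using that by blast
  qed
  define v where "v = P *v axis i 1"
  \<comment> \<open>the Schur complement of the pivot \<open>P\<^sub>i\<^sub>i\<close>: it stays semidefinite by Cauchy--Schwarz\<close>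
  define P' where "P' = P - (1 / P $ i $ i) *\<^sub>R outer_prod v v"
  have vj: "v $ j = P $ j $ i" for j
    by (simp add: v_def matrix_vector_mult_basis column_def)
  have sym: "transpose P = P" using less.prems by (simp add: psd_def)
  have Pii: "P $ i $ i > 0"
    using less.prems(1) i unfolding psd_def by (metis inner_axis_mult_axis order_less_le)
  have P': "psd P'"
    unfolding psd_def
  proof (intro conjI allI)
    show "transpose P' = P'"
      by (simp add: P'_def transpose_diff transpose_scaleR transpose_outer_prod sym)
    fix x
    have "(x \<bullet> v)\<^sup>2 \<le> (x \<bullet> (P *v x)) * P $ i $ i"
      using psd_Cauchy_Schwarz[OF less.prems(1), of x "axis i 1"]
      by (simp add: v_def inner_axis_mult_axis)
    then show "0 \<le> x \<bullet> (P' *v x)"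
      using Pii by (simp add: P'_def matrix_vector_mult_diff_rdistrib scaleR_mult_vec
          outer_prod_mult_vec inner_diff_right inner_commute field_simps power2_eq_square)
  qed
  have "{j. P' $ j $ j \<noteq> 0} \<subseteq> {j. P $ j $ j \<noteq> 0}"
    using psd_zero_diagonal[OF less.prems(1)]
    by (auto simp: P'_def outer_prod_def vj)
  moreover have "P' $ i $ i = 0" using i by (simp add: P'_def outer_prod_def vj)
  ultimately have "{j. P' $ j $ j \<noteq> 0} \<subset> {j. P $ j $ j \<noteq> 0}" using i by blast
  then have lt: "card {j. P' $ j $ j \<noteq> 0} < card {j. P $ j $ j \<noteq> 0}"
    by (intro psubset_card_mono) auto
  have "A \<bullet> P' \<ge> 0"
    using less.hyps[OF lt P'] by (cases "P' = 0") auto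
  moreover have "v \<noteq> 0" using i vj[of i] by auto
  then have "v \<bullet> (A *v v) > 0" using A by (simp add: pos_def_def)
  moreover have "A \<bullet> P = A \<bullet> P' + (1 / P $ i $ i) * (v \<bullet> (A *v v))"
    by (simp add: P'_def inner_diff_right inner_outer_prod)
  ultimately show ?case using Pii by (simp add: add_nonneg_pos)
qed

lemma psd_trace_nonneg: assumes "psd P" shows "trace P \<ge> 0"
proof -
  have "0 \<le> P $ i $ i" for i
    using assms inner_axis_mult_axis[of i P i] by (simp add: psd_def flip: inner_axis_mult_axis)
  then show ?thesis by (simp add: trace_def sum_nonneg)
qed

lemma pos_def_coercive:
  fixes A :: "real ^ 'n ^ 'n"
  assumes "pos_def A"
  obtains c where "c > 0" "\<And>x. c * (norm x)\<^sup>2 \<le> x \<bullet> (A *v x)"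
proof -
  let ?S = "sphere (0 :: real ^ 'n) 1"
  have "axis undefined 1 \<in> ?S" by (simp add: norm_axis_1)
  then have ne: "?S \<noteq> {}" by blast
  have "continuous_on ?S (\<lambda>x. x \<bullet> (A *v x))"
    by (intro continuous_intros linear_continuous_on matrix_vector_mul_bounded_linear)
  then obtain x0 where x0: "x0 \<in> ?S" "\<And>x. x \<in> ?S \<Longrightarrow> x0 \<bullet> (A *v x0) \<le> x \<bullet> (A *v x)"
    using continuous_attains_inf[OF compact_sphere ne] by blast
  have "x0 \<noteq> 0" using x0(1) by auto
  then have pos: "x0 \<bullet> (A *v x0) > 0" using assms by (simp add: pos_def_def)
  have "(x0 \<bullet> (A *v x0)) * (norm x)\<^sup>2 \<le> x \<bullet> (A *v x)" for x
  proof (cases "x = 0")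
    case False
    have "x0 \<bullet> (A *v x0) \<le> ((1 / norm x) *\<^sub>R x) \<bullet> (A *v ((1 / norm x) *\<^sub>R x))"
      using False by (intro x0(2)) simp
    then show ?thesis
      using False by (simp add: matrix_vector_mult_scaleR field_simps power2_eq_square)
  qed auto
  then show thesis using that pos by blast
qed

lemma abs_quadratic_form_le: "\<bar>x \<bullet> (H *v y)\<bar> \<le> norm H * norm x * norm y"
  for H :: "real ^ 'n ^ 'n"
proof -
  have "outer_prod x y = (\<chi> i. x $ i *\<^sub>R y)" by (simp add: outer_prod_def vec_eq_iff)
  then have "norm (outer_prod x y) = norm x * norm y"
    by (simp add: norm_vec_def[where 'a="real^'n"] norm_vec_def[of x] L2_set_left_distrib)
  then show ?thesis
    using Cauchy_Schwarz_ineq2[of H "outer_prod x y"] by (simp add: inner_outer_prod)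
qed

section \<open>Second-order Peano expansions\<close>

text \<open>
  Being twice differentiable in the sense of Peano.  For the maximum principle a pointwise
  expansion is all that matters, and it passes through products, compositions and inversions by
  substitution, without any computation of iterated partial derivatives.  The filter \<open>nhds 0\<close>
  instead of \<open>at 0\<close> makes composition unproblematic when the inner increment vanishes.
\<close>

definition jet2 :: "(real ^ 'n \<Rightarrow> real) \<Rightarrow> real ^ 'n \<Rightarrow> real ^ 'n \<Rightarrow> real ^ 'n ^ 'n \<Rightarrow> bool" where
  "jet2 f x g H \<longleftrightarrow> transpose H = H \<and>
    (\<lambda>h. f (x + h) - f x - g \<bullet> h - h \<bullet> (H *v h) / 2) \<in> o[nhds 0](\<lambda>h. (norm h)\<^sup>2)"

lemma norm_power_smallo:
  assumes "m < n"
  shows "(\<lambda>h :: 'a :: real_normed_vector. norm h ^ n) \<in> o[nhds 0](\<lambda>h. norm h ^ m)"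
proof (rule landau_o.smallI)
  fix e :: real assume "e > 0"
  have "eventually (\<lambda>h :: 'a. norm h < min e 1) (nhds 0)"
    using \<open>e > 0\<close> by (auto simp: eventually_nhds_metric intro: exI[of _ "min e 1"])
  then show "eventually (\<lambda>h :: 'a. norm (norm h ^ n) \<le> e * norm (norm h ^ m)) (nhds 0)"
  proof eventually_elim
    case (elim h)
    have "norm h ^ n = norm h ^ m * norm h * norm h ^ (n - Suc m)"
      using assms by (simp add: mult.assoc flip: power_add power_Suc)
    also have "\<dots> \<le> norm h ^ m * norm h * 1"
      using elim by (intro mult_left_mono power_le_one) auto
    also have "\<dots> \<le> norm h ^ m * e" using elim by (auto intro: mult_left_mono)
    finally show ?case by (simp add: mult.commute)
  qed
qed

lemma continuous_imp_bigo_1: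
  fixes f :: "'a :: real_normed_vector \<Rightarrow> real"
  assumes "isCont f 0" shows "f \<in> O[nhds 0](\<lambda>_. 1)"
proof -
  have "eventually (\<lambda>h. norm (f h - f 0) < 1) (nhds 0)"
    using assms unfolding continuous_at_eps_delta eventually_nhds_metric dist_norm
    by (auto dest!: spec[of _ 1])
  then show ?thesis
    by (intro landau_o.bigI[of "\<bar>f 0\<bar> + 1"]) (auto elim!: eventually_mono)
qed

lemma bigo_inner: "(\<lambda>h. g \<bullet> h) \<in> O[nhds 0](\<lambda>h :: real ^ 'n. norm h)"
proof (intro landau_o.bigI[of "norm g + 1"] always_eventually allI)
  fix h show "norm (g \<bullet> h) \<le> (norm g + 1) * norm (norm h)"
    using Cauchy_Schwarz_ineq2[of g h] by (simp add: distrib_right add_increasing2)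
qed (simp add: add_nonneg_pos)

lemma bigo_quadratic: "(\<lambda>h. h \<bullet> (H *v h)) \<in> O[nhds 0](\<lambda>h :: real ^ 'n. (norm h)\<^sup>2)"
proof (intro landau_o.bigI[of "norm H + 1"] always_eventually allI)
  fix h :: "real ^ 'n"
  show "norm (h \<bullet> (H *v h)) \<le> (norm H + 1) * norm ((norm h)\<^sup>2)"
    using abs_quadratic_form_le[of h H h]
    by (simp add: power2_eq_square distrib_right mult.assoc add_increasing2)
qed (simp add: add_nonneg_pos)

text \<open>
  Differentiability of the gradient at the single point \<open>x\<close> suffices: apply the mean value theorem
  on \<open>[0,1]\<close> to \<open>f (x + t h)\<close> minus its candidate expansion.
\<close>

lemma Taylor_Peano_2:
  fixes f :: "'a :: euclidean_space \<Rightarrow> real"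
  assumes f: "eventually (\<lambda>y. (f has_derivative (\<lambda>h. G y \<bullet> h)) (at y)) (nhds x)"
    and G: "(G has_derivative B) (at x)"
  shows "(\<lambda>h. f (x + h) - f x - G x \<bullet> h - (B h \<bullet> h) / 2) \<in> o[nhds 0](\<lambda>h. (norm h)\<^sup>2)"
proof (rule landau_o.smallI)
  fix e :: real assume "e > 0"
  interpret B: bounded_linear B using G by (rule has_derivative_bounded_linear)
  obtain d1 where d1: "d1 > 0" "\<And>y. dist y x < d1 \<Longrightarrow> (f has_derivative (\<lambda>h. G y \<bullet> h)) (at y)"
    using f unfolding eventually_nhds_metric by blast
  obtain d2 where d2: "d2 > 0"
    "\<And>y. norm (y - x) < d2 \<Longrightarrow> norm (G y - G x - B (y - x)) \<le> e * norm (y - x)"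
    using G \<open>e > 0\<close> unfolding has_derivative_at_alt by blast
  have "eventually (\<lambda>h :: 'a. norm h < min d1 d2) (nhds 0)"
    using d1 d2 by (auto simp: eventually_nhds_metric intro: exI[of _ "min d1 d2"])
  then show "eventually (\<lambda>h. norm (f (x + h) - f x - G x \<bullet> h - (B h \<bullet> h) / 2)
      \<le> e * norm ((norm h)\<^sup>2)) (nhds 0)"
  proof eventually_elim
    case (elim h)
    define \<phi> where "\<phi> = (\<lambda>t. f (x + t *\<^sub>R h) - t * (G x \<bullet> h) - t\<^sup>2 * (B h \<bullet> h) / 2)"
    have le: "norm (t *\<^sub>R h) \<le> norm h" if "t \<in> {0..1}" for t
      using that by (simp add: mult_left_le_one_le)
    have "(\<phi> has_derivative (\<lambda>s. s * ((G (x + t *\<^sub>R h) - G x - B (t *\<^sub>R h)) \<bullet> h)))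
        (at t within {0..1})" if t: "t \<in> {0..1}" for t
    proof -
      have "(f has_derivative (\<lambda>k. G (x + t *\<^sub>R h) \<bullet> k)) (at (x + t *\<^sub>R h))"
        using le[OF t] elim by (intro d1) (simp add: dist_norm)
      then have "((\<lambda>t. f (x + t *\<^sub>R h)) has_derivative (\<lambda>s. G (x + t *\<^sub>R h) \<bullet> (s *\<^sub>R h)))
          (at t within {0..1})"
        by (rule has_derivative_compose[rotated]) (auto intro!: derivative_eq_intros)
      then show ?thesis
        unfolding \<phi>_def
        by (auto intro!: derivative_eq_intros simp: fun_eq_iff B.scaleR inner_diff_left algebra_simps)
    qed
    then obtain t where t: "t \<in> {0<..<1}"
      "\<phi> 1 - \<phi> 0 = (1 - 0) * ((G (x + t *\<^sub>R h) - G x - B (t *\<^sub>R h)) \<bullet> h)"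
      using mvt_simple[of 0 1 \<phi> "\<lambda>t s. s * ((G (x + t *\<^sub>R h) - G x - B (t *\<^sub>R h)) \<bullet> h)"] by auto
    have "f (x + h) - f x - G x \<bullet> h - (B h \<bullet> h) / 2 = (G (x + t *\<^sub>R h) - G x - B (t *\<^sub>R h)) \<bullet> h"
      using t(2) by (simp add: \<phi>_def)
    also have "\<bar>\<dots>\<bar> \<le> norm (G (x + t *\<^sub>R h) - G x - B (t *\<^sub>R h)) * norm h"
      by (rule Cauchy_Schwarz_ineq2)
    also have "\<dots> \<le> (e * norm (t *\<^sub>R h)) * norm h"
      using d2(2)[of "x + t *\<^sub>R h"] le[of t] t(1) elim by (intro mult_right_mono) auto
    also have "\<dots> \<le> (e * norm h) * norm h"
      using le[of t] t(1) \<open>e > 0\<close> by (intro mult_right_mono mult_left_mono) auto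
    finally show ?case by (simp add: power2_eq_square mult_ac)
  qed
qed

lemma jet2_sym: "jet2 f x g H \<Longrightarrow> transpose H = H"
  by (simp add: jet2_def)

lemma jet2_exact:
  assumes "transpose H = H" "\<And>h. f (x + h) = f x + g \<bullet> h + h \<bullet> (H *v h) / 2"
  shows "jet2 f x g H"
  using assms by (simp add: jet2_def)

lemma jet2_add:
  assumes "jet2 f x g H" "jet2 f' x g' H'"
  shows "jet2 (\<lambda>y. f y + f' y) x (g + g') (H + H')"
proof -
  have eq: "f (x + h) + f' (x + h) - (f x + f' x) - (g + g') \<bullet> h - h \<bullet> ((H + H') *v h) / 2
      = (f (x + h) - f x - g \<bullet> h - h \<bullet> (H *v h) / 2)
        + (f' (x + h) - f' x - g' \<bullet> h - h \<bullet> (H' *v h) / 2)" for h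
    by (simp add: inner_add_left inner_add_right matrix_vector_mult_add_rdistrib add_divide_distrib)
  show ?thesis
    using assms unfolding jet2_def eq by (auto simp: transpose_add intro: sum_in_smallo)
qed

lemma jet2_cmult:
  assumes "jet2 f x g H"
  shows "jet2 (\<lambda>y. c * f y) x (c *\<^sub>R g) (c *\<^sub>R H)"
proof -
  have eq: "c * f (x + h) - c * f x - (c *\<^sub>R g) \<bullet> h - h \<bullet> ((c *\<^sub>R H) *v h) / 2
      = c * (f (x + h) - f x - g \<bullet> h - h \<bullet> (H *v h) / 2)" for h
    by (simp add: scaleR_mult_vec algebra_simps)
  show ?thesis
    using assms unfolding jet2_def eq by (auto simp: transpose_scaleR)
qed

lemma jet2_diff:
  assumes "jet2 f x g H" "jet2 f' x g' H'"
  shows "jet2 (\<lambda>y. f y - f' y) x (g - g') (H - H')"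
  using jet2_add[OF assms(1) jet2_cmult[OF assms(2), of "- 1"]] by simp

lemma jet2_increment_bigo:
  assumes "jet2 f x g H"
  shows "(\<lambda>h. f (x + h) - f x - g \<bullet> h) \<in> O[nhds 0](\<lambda>h. (norm h)\<^sup>2)"
proof -
  have "(\<lambda>h. (f (x + h) - f x - g \<bullet> h - h \<bullet> (H *v h) / 2) + h \<bullet> (H *v h) / 2)
      \<in> O[nhds 0](\<lambda>h. (norm h)\<^sup>2)"
    using assms unfolding jet2_def
    by (intro sum_in_bigo(1)) (auto intro: landau_o.small_imp_big bigo_quadratic)
  then show ?thesis by simp
qed

lemma jet2_has_derivative:
  assumes "jet2 f x g H"
  shows "(f has_derivative (\<lambda>h. g \<bullet> h)) (at x)"
proof -
  have "(\<lambda>h. f (x + h) - f x - g \<bullet> h) \<in> o[nhds 0](\<lambda>h. norm h)"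
    using landau_o.big_small_trans[OF jet2_increment_bigo[OF assms] norm_power_smallo[of 1 2]]
    by simp
  then have "(\<lambda>h. f (x + h) - f x - g \<bullet> h) \<in> o[at 0](\<lambda>h. norm h)"
    by (rule landau_o.small.filter_mono[rotated]) (simp add: at_within_def)
  then have "((\<lambda>h. (f (x + h) - f x - g \<bullet> h) / norm h) \<longlongrightarrow> 0) (at 0)"
    by (rule smalloD_tendsto)
  then have "((\<lambda>h. norm ((f (x + h) - f x - g \<bullet> h) / norm h)) \<longlongrightarrow> 0) (at 0)"
    by (rule tendsto_norm_zero)
  then show ?thesis
    by (simp add: has_derivative_at bounded_linear_inner_right)
qed

lemma jet2_isCont: "jet2 f x g H \<Longrightarrow> isCont f x"
  using jet2_has_derivative has_derivative_continuous by blast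

text \<open>
  With \<open>k = f (x + h) - f x\<close>, insert the expansion of \<open>\<phi>\<close> in powers of \<open>k\<close>.  Replacing
  \<open>k\<^sup>2\<close> by \<open>(g \<bullet> h)\<^sup>2\<close> costs \<open>(k - g \<bullet> h) (k + g \<bullet> h)\<close>, which is of third order.
\<close>

lemma jet2_compose:
  assumes f: "jet2 f x g H"
    and \<phi>: "(\<lambda>k. \<phi> (f x + k) - \<phi> (f x) - d1 * k - d2 * k\<^sup>2 / 2) \<in> o[nhds 0](\<lambda>k. k\<^sup>2)"
  shows "jet2 (\<lambda>y. \<phi> (f y)) x (d1 *\<^sub>R g) (d1 *\<^sub>R H + d2 *\<^sub>R outer_prod g g)"
proof -
  define k where "k = (\<lambda>h. f (x + h) - f x)"
  define \<rho> where "\<rho> = (\<lambda>k. \<phi> (f x + k) - \<phi> (f x) - d1 * k - d2 * k\<^sup>2 / 2)"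
  have k2: "(\<lambda>h. k h - g \<bullet> h) \<in> O[nhds 0](\<lambda>h. (norm h)\<^sup>2)"
    using jet2_increment_bigo[OF f] by (simp add: k_def)
  have "(\<lambda>h. (k h - g \<bullet> h) + g \<bullet> h) \<in> O[nhds 0](\<lambda>h. norm h)"
    using landau_o.big.trans[OF k2 landau_o.small_imp_big[OF norm_power_smallo[of 1 2, simplified]]]
    by (intro sum_in_bigo(1) bigo_inner) auto
  then have k1: "k \<in> O[nhds 0](\<lambda>h. norm h)" by simp
  have k0: "filterlim k (nhds 0) (nhds 0)"
  proof -
    have "((\<lambda>h. x + h) \<longlongrightarrow> x) (nhds 0)" by (auto intro!: tendsto_eq_intros filterlim_ident)
    then have "((\<lambda>h. f (x + h)) \<longlongrightarrow> f x) (nhds 0)"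
      using isCont_tendsto_compose[OF jet2_isCont[OF f]] by blast
    then show ?thesis unfolding k_def by (auto intro!: tendsto_eq_intros)
  qed
  have "(\<lambda>h. \<rho> (k h)) \<in> o[nhds 0](\<lambda>h. (k h)\<^sup>2)"
    using landau_o.small.compose[OF \<phi> k0] by (simp add: \<rho>_def)
  also have "(\<lambda>h. (k h)\<^sup>2) \<in> O[nhds 0](\<lambda>h. (norm h)\<^sup>2)"
    using landau_o.big_power[OF k1, of 2] by simp
  finally have 1: "(\<lambda>h. \<rho> (k h)) \<in> o[nhds 0](\<lambda>h. (norm h)\<^sup>2)" .
  have "(\<lambda>h. (k h - g \<bullet> h) * (k h + g \<bullet> h)) \<in> O[nhds 0](\<lambda>h. (norm h)\<^sup>2 * norm h)"
    by (intro landau_o.big.mult k2 sum_in_bigo k1 bigo_inner)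
  also have "(\<lambda>h. (norm h)\<^sup>2 * norm h) = (\<lambda>h :: real ^ 'a. norm h ^ 3)"
    by (simp add: power2_eq_square power3_eq_cube)
  also have "(\<lambda>h :: real ^ 'a. norm h ^ 3) \<in> o[nhds 0](\<lambda>h. (norm h)\<^sup>2)"
    by (rule norm_power_smallo) simp
  finally have 2: "(\<lambda>h. (k h - g \<bullet> h) * (k h + g \<bullet> h)) \<in> o[nhds 0](\<lambda>h. (norm h)\<^sup>2)" .
  have "(\<lambda>h. \<rho> (k h) + d1 * (f (x + h) - f x - g \<bullet> h - h \<bullet> (H *v h) / 2)
      + (d2 / 2) * ((k h - g \<bullet> h) * (k h + g \<bullet> h))) \<in> o[nhds 0](\<lambda>h. (norm h)\<^sup>2)"
    using f 1 2 unfolding jet2_def by (intro sum_in_smallo) auto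
  also have "(\<lambda>h. \<rho> (k h) + d1 * (f (x + h) - f x - g \<bullet> h - h \<bullet> (H *v h) / 2)
      + (d2 / 2) * ((k h - g \<bullet> h) * (k h + g \<bullet> h)))
    = (\<lambda>h. \<phi> (f (x + h)) - \<phi> (f x) - (d1 *\<^sub>R g) \<bullet> h
      - h \<bullet> ((d1 *\<^sub>R H + d2 *\<^sub>R outer_prod g g) *v h) / 2)"
    by (rule ext) (simp add: \<rho>_def k_def matrix_vector_mult_add_rdistrib scaleR_mult_vec
        outer_prod_mult_vec inner_add_right inner_commute power2_eq_square field_simps)
  finally show ?thesis
    using jet2_sym[OF f]
    by (simp add: jet2_def transpose_add transpose_scaleR transpose_outer_prod)
qed

text \<open>
  One-sided information along a ray already controls the second-order term; this is what
  makes touching at a boundary point usable.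
\<close>

lemma jet2_one_sided_min:
  assumes f: "jet2 f x 0 H" and min: "eventually (\<lambda>t. f x \<le> f (x + t *\<^sub>R v)) (at_right 0)"
  shows "0 \<le> v \<bullet> (H *v v)"
proof (rule ccontr)
  assume neg: "\<not> 0 \<le> v \<bullet> (H *v v)"
  define q where "q = - (v \<bullet> (H *v v))"
  have q: "q > 0" using neg by (simp add: q_def)
  have "v \<noteq> 0" using neg by auto
  define e where "e = q / (4 * (norm v)\<^sup>2)"
  have e: "e > 0" using q \<open>v \<noteq> 0\<close> by (simp add: e_def)
  have "filterlim (\<lambda>t. t *\<^sub>R v) (nhds 0) (at_right 0)"
    by (auto intro!: tendsto_eq_intros)
  moreover have "eventually (\<lambda>h. norm (f (x + h) - f x - 0 \<bullet> h - h \<bullet> (H *v h) / 2)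
      \<le> e * norm ((norm h)\<^sup>2)) (nhds 0)"
    using landau_o.smallD[OF _ e] f unfolding jet2_def by blast
  ultimately have "eventually (\<lambda>t. norm (f (x + t *\<^sub>R v) - f x - 0 \<bullet> (t *\<^sub>R v)
      - (t *\<^sub>R v) \<bullet> (H *v (t *\<^sub>R v)) / 2) \<le> e * norm ((norm (t *\<^sub>R v))\<^sup>2)) (at_right 0)"
    by (rule eventually_compose_filterlim[rotated])
  moreover have "eventually (\<lambda>t :: real. t > 0) (at_right 0)" by (simp add: eventually_at_right_less)
  ultimately have "eventually (\<lambda>t :: real. False) (at_right 0)"
    using min
  proof eventually_elim
    case (elim t)
    have "f (x + t *\<^sub>R v) - f x + t\<^sup>2 * q / 2 \<le> t\<^sup>2 * q / 4"
      using elim(1) \<open>v \<noteq> 0\<close>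
      by (simp add: q_def e_def matrix_vector_mult_scaleR power_mult_distrib power2_eq_square mult_ac)
    moreover have "t\<^sup>2 * q > 0" using q elim(2) by simp
    ultimately show False using elim(3) by argo
  qed
  then show False by simp
qed

lemma has_derivative_one_sided_min:
  fixes f :: "'a :: euclidean_space \<Rightarrow> real"
  assumes f: "(f has_derivative (\<lambda>h. g \<bullet> h)) (at x)"
    and min: "eventually (\<lambda>t. f x \<le> f (x + t *\<^sub>R v)) (at_right 0)"
  shows "0 \<le> g \<bullet> v"
proof -
  have "((\<lambda>t. f (x + t *\<^sub>R v)) has_derivative (\<lambda>s. g \<bullet> (s *\<^sub>R v))) (at 0)"
    by (rule has_derivative_compose[of "\<lambda>t. x + t *\<^sub>R v" _ 0 UNIV f])
      (use f in \<open>auto intro!: derivative_eq_intros\<close>)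
  then have "((\<lambda>t. f (x + t *\<^sub>R v)) has_real_derivative (g \<bullet> v)) (at 0)"
    by (rule has_derivative_imp_has_field_derivative) simp
  then have "((\<lambda>t. (f (x + t *\<^sub>R v) - f x) / t) \<longlongrightarrow> g \<bullet> v) (at 0)"
    by (simp add: DERIV_def)
  then have "((\<lambda>t. (f (x + t *\<^sub>R v) - f x) / t) \<longlongrightarrow> g \<bullet> v) (at_right 0)"
    by (rule tendsto_mono[OF at_le[OF subset_UNIV]])
  moreover have "eventually (\<lambda>t. 0 \<le> (f (x + t *\<^sub>R v) - f x) / t) (at_right 0)"
    using min eventually_at_right_less[of 0] by eventually_elim simp
  ultimately show ?thesis by (rule tendsto_lowerbound) simp
qed

lemma jet2_local_min:
  assumes f: "jet2 f x g H" and min: "eventually (\<lambda>y. f x \<le> f y) (nhds x)"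
  shows "g = 0" "psd H"
proof -
  have ev: "eventually (\<lambda>t. f x \<le> f (x + t *\<^sub>R v)) (at_right 0)" for v
    by (rule eventually_compose_filterlim[OF min]) (auto intro!: tendsto_eq_intros)
  have "0 \<le> g \<bullet> (- g)"
    by (rule has_derivative_one_sided_min[OF jet2_has_derivative[OF f] ev])
  then have "g \<bullet> g \<le> 0" by simp
  then show "g = 0" by (metis inner_ge_zero inner_eq_zero_iff order_antisym)
  then show "psd H"
    using jet2_one_sided_min[OF _ ev] f jet2_sym[OF f] by (simp add: psd_def)
qed

lemma jet2_unique:
  assumes "jet2 f x g H" "jet2 f x g' H'"
  shows "g = g'" "H = H'"
proof -
  have *: "g = g' \<and> psd (H - H')" if "jet2 f x g H" "jet2 f x g' H'" for g g' H H'
    using jet2_local_min[OF jet2_diff[OF that]] by simp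
  show "g = g'" using *[OF assms] by simp
  show "H = H'"
  proof (rule symmetric_matrix_eqI)
    fix v show "v \<bullet> (H *v v) = v \<bullet> (H' *v v)"
      using *[OF assms] *[OF assms(2,1)]
      by (auto simp: psd_def matrix_vector_mult_diff_rdistrib inner_diff_right intro: antisym)
  qed (use assms jet2_sym in auto)
qed

section \<open>The conformal Hessian and inversions\<close>

text \<open>
  The conformal Hessian in the variable \<open>f = u powr (- 2 / (n - 2))\<close>: for a function with value
  \<open>c\<close>, gradient \<open>g\<close> and Hessian \<open>H\<close> it is \<open>c H - |g|\<^sup>2 / 2 I\<close>, with no power of \<open>f\<close> and no
  \<open>g \<otimes> g\<close> term.
\<close>

definition conf_mat :: "real \<Rightarrow> real ^ 'n \<Rightarrow> real ^ 'n ^ 'n \<Rightarrow> real ^ 'n ^ 'n" where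
  "conf_mat c g H = c *\<^sub>R H - (g \<bullet> g / 2) *\<^sub>R mat 1"

definition reflection :: "real ^ 'n \<Rightarrow> real ^ 'n ^ 'n" where
  "reflection v = mat 1 - (2 / (v \<bullet> v)) *\<^sub>R outer_prod v v"

text \<open>
  The Kelvin transform with respect to the sphere of centre \<open>x\<close> and radius \<open>l\<close>, written for
  \<open>f\<close>: the factor \<open>(l / |y - x|)\<^bsup>n-2\<^esup>\<close> in front of \<open>u\<close> becomes \<open>|y - x|\<^sup>2 / l\<^sup>2\<close>, in every
  dimension.
\<close>

definition kelvin :: "real ^ 'n \<Rightarrow> real \<Rightarrow> (real ^ 'n \<Rightarrow> real) \<Rightarrow> real ^ 'n \<Rightarrow> real" where
  "kelvin x l f y = ((y - x) \<bullet> (y - x)) / l\<^sup>2 * f (x + (l\<^sup>2 / ((y - x) \<bullet> (y - x))) *\<^sub>R (y - x))"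

text \<open>
  Gradient and Hessian of the Kelvin transform at \<open>x + v\<close>, in terms of the value \<open>c\<close>, gradient
  \<open>g\<close> and Hessian \<open>H\<close> of the function at the inverted point.
\<close>

definition kelvin_grad :: "real \<Rightarrow> real ^ 'n \<Rightarrow> real \<Rightarrow> real ^ 'n \<Rightarrow> real ^ 'n" where
  "kelvin_grad l v c g = (2 * c / l\<^sup>2) *\<^sub>R v + reflection v *v g"

definition kelvin_hess ::
  "real \<Rightarrow> real ^ 'n \<Rightarrow> real \<Rightarrow> real ^ 'n \<Rightarrow> real ^ 'n ^ 'n \<Rightarrow> real ^ 'n ^ 'n" where
  "kelvin_hess l v c g H = (2 * c / l\<^sup>2 - 2 * (g \<bullet> v) / (v \<bullet> v)) *\<^sub>R mat 1
     + (l\<^sup>2 / (v \<bullet> v)) *\<^sub>R (reflection v ** H ** reflection v)"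

lemma transpose_refl: "transpose (reflection v) = reflection v"
  by (simp add: reflection_def transpose_diff transpose_scaleR transpose_outer_prod transpose_mat)

lemma refl_mult_vec: "reflection v *v h = h - (2 * (v \<bullet> h) / (v \<bullet> v)) *\<^sub>R v"
  by (simp add: reflection_def matrix_vector_mult_diff_rdistrib scaleR_mult_vec outer_prod_mult_vec)

lemma refl_inner: "(reflection v *v g) \<bullet> h = g \<bullet> (reflection v *v h)"
  by (simp add: refl_mult_vec inner_diff_left inner_diff_right inner_commute)

lemma refl_refl: "v \<noteq> 0 \<Longrightarrow> reflection v *v (reflection v *v h) = h"
  by (simp add: refl_mult_vec inner_diff_right)

lemma refl_self: "v \<noteq> 0 \<Longrightarrow> reflection v *v v = - v"
  by (simp add: refl_mult_vec) (simp add: scaleR_2)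

lemma refl_involution: "v \<noteq> 0 \<Longrightarrow> reflection v ** reflection v = mat 1"
  by (simp add: matrix_eq refl_refl flip: matrix_vector_mul_assoc)

lemma refl_orthogonal: "v \<noteq> 0 \<Longrightarrow> orthogonal_matrix (reflection v)"
  by (simp add: orthogonal_matrix_def transpose_refl refl_involution)

lemma matrix_inv_refl: "v \<noteq> 0 \<Longrightarrow> matrix_inv (reflection v) = reflection v"
proof -
  assume v: "v \<noteq> 0"
  have "\<exists>A'. reflection v ** A' = mat 1 \<and> A' ** reflection v = mat 1"
    using refl_involution[OF v] by blast
  then have inv: "reflection v ** matrix_inv (reflection v) = mat 1"
    unfolding matrix_inv_def by (rule someI2_ex) blast
  have "matrix_inv (reflection v) = (reflection v ** reflection v) ** matrix_inv (reflection v)"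
    by (simp add: refl_involution[OF v])
  also have "\<dots> = reflection v"
    by (simp only: matrix_mul_assoc[symmetric] inv matrix_mul_rid)
  finally show ?thesis .
qed

lemma refl_conj_quadratic: "h \<bullet> ((reflection v ** H ** reflection v) *v h) = (reflection v *v h) \<bullet> (H *v (reflection v *v h))"
  by (simp add: refl_inner flip: matrix_vector_mul_assoc)

text \<open>
  Conformal invariance: all terms that involve \<open>l\<close> or \<open>|v|\<close> cancel, and what is left is conjugation
  by the reflection in the hyperplane orthogonal to \<open>v\<close>.
\<close>

lemma conf_mat_kelvin:
  fixes v g :: "real ^ 'n"
  assumes v: "v \<noteq> 0" and l: "l > 0"
  shows "conf_mat ((v \<bullet> v) / l\<^sup>2 * c) (kelvin_grad l v c g) (kelvin_hess l v c g H)
    = reflection v ** conf_mat c g H ** reflection v"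
proof -
  have gg: "(reflection v *v g) \<bullet> (reflection v *v g) = g \<bullet> g"
    using refl_inner[of v g "reflection v *v g"] refl_refl[OF v] by simp
  have vg: "v \<bullet> (reflection v *v g) = - (g \<bullet> v)"
    using refl_inner[of v g v] refl_self[OF v] by (simp add: inner_commute)
  have vv: "v \<bullet> v > 0" using v by simp
  have exp: "(a *\<^sub>R v + q) \<bullet> (a *\<^sub>R v + q) = a\<^sup>2 * (v \<bullet> v) + 2 * a * (v \<bullet> q) + q \<bullet> q" for a q
    by (simp add: inner_add_left inner_add_right inner_commute[of q v] power2_eq_square algebra_simps)
  have n: "kelvin_grad l v c g \<bullet> kelvin_grad l v c g
      = 4 * c\<^sup>2 / l ^ 4 * (v \<bullet> v) - 4 * c / l\<^sup>2 * (g \<bullet> v) + g \<bullet> g"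
    unfolding kelvin_grad_def exp gg vg using l
    by (simp add: power2_eq_square power4_eq_xxxx field_simps)
  have m: "reflection v ** conf_mat c g H ** reflection v
      = c *\<^sub>R (reflection v ** H ** reflection v) - (g \<bullet> g / 2) *\<^sub>R mat 1"
    by (simp add: conf_mat_def matrix_eq scaleR_mult_vec matrix_vector_mult_diff_rdistrib
        matrix_vector_mult_diff_distrib matrix_vector_mult_scaleR refl_refl[OF v]
        flip: matrix_vector_mul_assoc)
  have s: "(v \<bullet> v) / l\<^sup>2 * c * (2 * c / l\<^sup>2 - 2 * (g \<bullet> v) / (v \<bullet> v))
      - (4 * c\<^sup>2 / l ^ 4 * (v \<bullet> v) - 4 * c / l\<^sup>2 * (g \<bullet> v) + g \<bullet> g) / 2 = - (g \<bullet> g / 2)"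
    using vv l by (simp add: field_simps power2_eq_square power4_eq_xxxx)
  have t: "(v \<bullet> v) / l\<^sup>2 * c * (l\<^sup>2 / (v \<bullet> v)) = c" using vv l by simp
  show ?thesis
    unfolding m unfolding conf_mat_def n unfolding kelvin_hess_def scaleR_add_right scaleR_scaleR t
    using s by (simp add: algebra_simps flip: scaleR_left_distrib scaleR_left_diff_distrib)
qed

text \<open>
  Let \<open>k\<close> be the increment of the inverted point when \<open>y\<close> moves by \<open>h\<close>, and \<open>N = |v + h|\<^sup>2\<close>.
  Two exact identities replace any differentiation of the inversion:
  \<open>(N / l\<^sup>2) k = R h - (|h|\<^sup>2 / |v|\<^sup>2) v\<close>, a quadratic polynomial in \<open>h\<close>, and
  \<open>|k|\<^sup>2 = l\<^sup>4 |h|\<^sup>2 / (N |v|\<^sup>2)\<close>, which controls the remainder.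
\<close>

lemma jet2_kelvin:
  fixes f :: "real ^ 'n \<Rightarrow> real"
  assumes l: "l > 0" and yx: "y \<noteq> x"
    and f: "jet2 f (x + (l\<^sup>2 / ((y - x) \<bullet> (y - x))) *\<^sub>R (y - x)) g H"
  defines "c \<equiv> f (x + (l\<^sup>2 / ((y - x) \<bullet> (y - x))) *\<^sub>R (y - x))"
  shows "jet2 (kelvin x l f) y (kelvin_grad l (y - x) c g) (kelvin_hess l (y - x) c g H)"
proof -
  define v where "v = y - x"
  have v: "v \<noteq> 0" using yx by (simp add: v_def)
  define vv where "vv = v \<bullet> v"
  have vv: "vv > 0" using v by (simp add: vv_def)
  define z where "z = x + (l\<^sup>2 / vv) *\<^sub>R v"
  have f: "jet2 f z g H" and c: "c = f z"
    using f by (simp_all add: z_def c_def v_def vv_def)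
  define N where "N = (\<lambda>h. (v + h) \<bullet> (v + h))"
  define k where "k = (\<lambda>h. (l\<^sup>2 / N h) *\<^sub>R (v + h) - (l\<^sup>2 / vv) *\<^sub>R v)"
  define w where "w = (\<lambda>h. reflection v *v h - ((h \<bullet> h) / vv) *\<^sub>R v)"
  define \<rho> where "\<rho> = (\<lambda>k. f (z + k) - f z - g \<bullet> k - k \<bullet> (H *v k) / 2)"
  have N0: "N 0 = vv" by (simp add: N_def vv_def)
  have contN: "isCont N 0" unfolding N_def by (intro continuous_intros)
  have evN: "eventually (\<lambda>h. N h \<noteq> 0) (nhds 0)"
  proof -
    have "(N \<longlongrightarrow> N 0) (nhds 0)" using contN by (simp add: isCont_def tendsto_nhds_iff)
    then show ?thesis
      using vv N0 order_tendstoD(1)[of N "N 0" "nhds 0" 0] by (auto elim: eventually_mono)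
  qed
  have Nexp: "N h = vv + 2 * (v \<bullet> h) + h \<bullet> h" for h
    by (simp add: N_def vv_def inner_add_left inner_add_right inner_commute)
  have Nk: "(N h / l\<^sup>2) *\<^sub>R k h = w h" if "N h \<noteq> 0" for h
  proof -
    have "(N h / l\<^sup>2) *\<^sub>R k h = (v + h) - (N h / vv) *\<^sub>R v"
      using that l by (simp add: k_def scaleR_diff_right)
    also have "\<dots> = w h"
      using vv by (simp add: w_def refl_mult_vec Nexp add_divide_distrib scaleR_left_distrib
          flip: vv_def)
    finally show ?thesis .
  qed
  have kk: "(norm (k h))\<^sup>2 = l ^ 4 / (N h * vv) * (norm h)\<^sup>2" if "N h \<noteq> 0" for h
  proof -
    have "(a *\<^sub>R p - b *\<^sub>R v) \<bullet> (a *\<^sub>R p - b *\<^sub>R v) = a\<^sup>2 * (p \<bullet> p) + b\<^sup>2 * (v \<bullet> v) - 2 * a * b * (v \<bullet> p)"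
      for a b p
      by (simp add: inner_diff_left inner_diff_right inner_commute[of p v] power2_eq_square algebra_simps)
    then have "(norm (k h))\<^sup>2 = (l\<^sup>2 / N h)\<^sup>2 * N h + (l\<^sup>2 / vv)\<^sup>2 * vv
        - 2 * (l\<^sup>2 / N h) * (l\<^sup>2 / vv) * (vv + v \<bullet> h)"
      unfolding k_def power2_norm_eq_inner by (simp add: N_def vv_def inner_add_right)
    also have "\<dots> = l ^ 4 / (N h * vv) * (vv + N h - 2 * (vv + v \<bullet> h))"
      using that vv by (simp add: field_simps power2_eq_square power4_eq_xxxx)
    also have "vv + N h - 2 * (vv + v \<bullet> h) = (norm h)\<^sup>2"
      by (simp add: Nexp power2_norm_eq_inner)
    finally show ?thesis .
  qed
  have k0: "filterlim k (nhds 0) (nhds 0)"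
  proof -
    have "isCont k 0"
      unfolding k_def using contN N0 vv by (intro continuous_intros) auto
    moreover have "k 0 = 0" using N0 by (simp add: k_def)
    ultimately show ?thesis by (simp add: isCont_def tendsto_nhds_iff)
  qed
  have "(\<lambda>h. \<rho> (k h)) \<in> o[nhds 0](\<lambda>h. (norm (k h))\<^sup>2)"
    using f landau_o.small.compose[OF _ k0] unfolding jet2_def \<rho>_def by blast
  also have "(\<lambda>h. (norm (k h))\<^sup>2) \<in> \<Theta>[nhds 0](\<lambda>h. l ^ 4 / (N h * vv) * (norm h)\<^sup>2)"
    using evN by (intro bigthetaI_cong) (auto elim!: eventually_mono simp: kk)
  also have "(\<lambda>h. l ^ 4 / (N h * vv) * (norm h)\<^sup>2) \<in> O[nhds 0](\<lambda>h. 1 * (norm h)\<^sup>2)"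
    using contN N0 vv by (intro landau_o.big.mult continuous_imp_bigo_1 continuous_intros) auto
  finally have \<rho>k: "(\<lambda>h. \<rho> (k h)) \<in> o[nhds 0](\<lambda>h. (norm h)\<^sup>2)" by simp
  have "(\<lambda>h. N h / l\<^sup>2 * \<rho> (k h)) \<in> o[nhds 0](\<lambda>h. 1 * (norm h)\<^sup>2)"
    using contN l \<rho>k by (intro landau_o.big_small_mult continuous_imp_bigo_1 continuous_intros) auto
  then have 1: "(\<lambda>h. N h / l\<^sup>2 * \<rho> (k h)) \<in> o[nhds 0](\<lambda>h. (norm h)\<^sup>2)" by simp
  define R where "R = reflection v"
  have wH: "w h \<bullet> (H *v w h) = (R *v h) \<bullet> (H *v (R *v h))
      - (h \<bullet> h) * (2 / vv * ((R *v h) \<bullet> (H *v v)) - (h \<bullet> h) / vv\<^sup>2 * (v \<bullet> (H *v v)))" for h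
    using symmetric_inner_swap[OF jet2_sym[OF f], of "R *v h" v] vv
    by (simp add: w_def R_def matrix_vector_mult_diff_distrib matrix_vector_mult_scaleR
        inner_diff_left inner_diff_right power2_eq_square field_simps)
  have sq: "(\<lambda>h. h \<bullet> h) = (\<lambda>h :: real ^ 'n. (norm h)\<^sup>2)"
    by (simp add: power2_norm_eq_inner)
  have small_1: "q \<in> o[nhds 0](\<lambda>_. 1)" if "isCont q 0" "q 0 = 0" for q :: "real ^ 'n \<Rightarrow> real"
  proof -
    have "(q \<longlongrightarrow> 0) (nhds 0)" using that by (simp add: isCont_def tendsto_nhds_iff)
    then show ?thesis by (intro smalloI_tendsto) auto
  qed
  define q where "q = (\<lambda>h. 2 / vv * ((R *v h) \<bullet> (H *v v)) - (h \<bullet> h) / vv\<^sup>2 * (v \<bullet> (H *v v)))"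
  have "isCont q 0"
    unfolding q_def
    by (intro continuous_intros linear_continuous_at matrix_vector_mul_bounded_linear) (use vv in auto)
  moreover have "q 0 = 0" by (simp add: q_def)
  ultimately have q: "q \<in> o[nhds 0](\<lambda>_. 1)" by (rule small_1)
  define T2 where "T2 = (\<lambda>h. (l\<^sup>2 / N h) * ((h \<bullet> h) * q h))"
  have "isCont (\<lambda>h. l\<^sup>2 / N h) 0" using contN N0 vv by (intro continuous_intros) auto
  then have "(\<lambda>h. (l\<^sup>2 / N h) * ((norm h)\<^sup>2 * q h)) \<in> o[nhds 0](\<lambda>h. 1 * ((norm h)\<^sup>2 * 1))"
    by (intro landau_o.big_small_mult[OF continuous_imp_bigo_1] landau_o.big_small_mult[OF _ q]) auto
  then have 2: "T2 \<in> o[nhds 0](\<lambda>h. (norm h)\<^sup>2)" by (simp add: T2_def power2_norm_eq_inner)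
  define T3 where "T3 = (\<lambda>h. (l\<^sup>2 / N h - l\<^sup>2 / vv) * ((R *v h) \<bullet> (H *v (R *v h))))"
  have "(\<lambda>h. (l\<^sup>2 / N h - l\<^sup>2 / vv) * (h \<bullet> ((R ** H ** R) *v h))) \<in> o[nhds 0](\<lambda>h. 1 * (norm h)\<^sup>2)"
    using contN N0 vv
    by (intro landau_o.small_big_mult small_1 bigo_quadratic continuous_intros) auto
  then have 3: "T3 \<in> o[nhds 0](\<lambda>h. (norm h)\<^sup>2)"
    by (simp add: R_def refl_conj_quadratic T3_def)
  have rem: "kelvin x l f (y + h) - kelvin x l f y - kelvin_grad l v c g \<bullet> h
      - h \<bullet> (kelvin_hess l v c g H *v h) / 2
    = N h / l\<^sup>2 * \<rho> (k h) - 1 / 2 * T2 h + 1 / 2 * T3 h" if Nh: "N h \<noteq> 0" for h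
  proof -
    have yh: "y + h - x = v + h" by (simp add: v_def)
    have "kelvin x l f (y + h) = N h / l\<^sup>2 * f (x + (l\<^sup>2 / N h) *\<^sub>R (v + h))"
      unfolding kelvin_def yh N_def ..
    also have "x + (l\<^sup>2 / N h) *\<^sub>R (v + h) = z + k h" by (simp add: z_def k_def)
    also have "f (z + k h) = c + g \<bullet> k h + k h \<bullet> (H *v k h) / 2 + \<rho> (k h)"
      by (simp add: \<rho>_def c)
    finally have e1: "kelvin x l f (y + h) = N h / l\<^sup>2 * c + (N h / l\<^sup>2) * (g \<bullet> k h)
        + (N h / l\<^sup>2) * (k h \<bullet> (H *v k h)) / 2 + N h / l\<^sup>2 * \<rho> (k h)"
      by (simp add: distrib_left)
    have "(N h / l\<^sup>2) * (g \<bullet> k h) = g \<bullet> w h"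
      using Nk[OF Nh] by (metis inner_scaleR_right)
    also have "\<dots> = g \<bullet> (R *v h) - (h \<bullet> h) / vv * (g \<bullet> v)"
      by (simp add: w_def R_def inner_diff_right)
    finally have e2: "(N h / l\<^sup>2) * (g \<bullet> k h) = g \<bullet> (R *v h) - (h \<bullet> h) / vv * (g \<bullet> v)" .
    have e3: "(N h / l\<^sup>2) * (k h \<bullet> (H *v k h)) = (l\<^sup>2 / N h) * (w h \<bullet> (H *v w h))"
      unfolding Nk[OF Nh, symmetric] using Nh l
      by (simp add: matrix_vector_mult_scaleR field_simps power2_eq_square power4_eq_xxxx)
    have e4: "kelvin x l f y = vv / l\<^sup>2 * c"
      by (simp add: kelvin_def c z_def vv_def flip: v_def)
    have e5: "kelvin_grad l v c g \<bullet> h = (2 * c / l\<^sup>2) * (v \<bullet> h) + g \<bullet> (R *v h)"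
      by (simp add: kelvin_grad_def inner_add_left refl_inner R_def)
    have e6: "h \<bullet> (kelvin_hess l v c g H *v h)
        = (2 * c / l\<^sup>2 - 2 * (g \<bullet> v) / vv) * (h \<bullet> h) + (l\<^sup>2 / vv) * ((R *v h) \<bullet> (H *v (R *v h)))"
      by (simp add: kelvin_hess_def matrix_vector_mult_add_rdistrib scaleR_mult_vec inner_add_right
          refl_conj_quadratic R_def vv_def)
    have e7: "N h / l\<^sup>2 * c = vv / l\<^sup>2 * c + 2 * c / l\<^sup>2 * (v \<bullet> h) + c / l\<^sup>2 * (h \<bullet> h)"
      by (simp add: Nexp add_divide_distrib algebra_simps)
    show ?thesis
      unfolding e1 e2 e3 e4 e5 e6 e7 wH T2_def T3_def q_def
      by (simp add: algebra_simps add_divide_distrib diff_divide_distrib)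
  qed
  have "(\<lambda>h. N h / l\<^sup>2 * \<rho> (k h) - 1 / 2 * T2 h + 1 / 2 * T3 h) \<in> o[nhds 0](\<lambda>h. (norm h)\<^sup>2)"
    using 1 2 3 by (intro sum_in_smallo) auto
  also have "?this \<longleftrightarrow> (\<lambda>h. kelvin x l f (y + h) - kelvin x l f y - kelvin_grad l v c g \<bullet> h
      - h \<bullet> (kelvin_hess l v c g H *v h) / 2) \<in> o[nhds 0](\<lambda>h. (norm h)\<^sup>2)"
    using evN by (intro landau_o.small.in_cong) (auto elim!: eventually_mono simp: rem)
  finally have "(\<lambda>h. kelvin x l f (y + h) - kelvin x l f y - kelvin_grad l v c g \<bullet> h
      - h \<bullet> (kelvin_hess l v c g H *v h) / 2) \<in> o[nhds 0](\<lambda>h. (norm h)\<^sup>2)" .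
  moreover have "transpose (kelvin_hess l v c g H) = kelvin_hess l v c g H"
    using jet2_sym[OF f]
    by (simp add: kelvin_hess_def transpose_add transpose_scaleR transpose_mat matrix_transpose_mul
        transpose_refl matrix_mul_assoc)
  ultimately show ?thesis by (simp add: jet2_def v_def)
qed

section \<open>Expansions of twice differentiable and of elementary functions\<close>

lemma has_derivative_grad:
  fixes u :: "real ^ 'n \<Rightarrow> real"
  assumes "u differentiable (at x)"
  shows "(u has_derivative (\<lambda>h. grad u x \<bullet> h)) (at x)"
proof -
  obtain D where D: "(u has_derivative D) (at x)"
    using assms by (auto simp: differentiable_def)
  interpret D: bounded_linear D using D by (rule has_derivative_bounded_linear)
  have g: "grad u x $ i = D (axis i 1)" for i
  proof -
    have "((\<lambda>t. u (x + t *\<^sub>R axis i 1)) has_derivative (\<lambda>t. D (t *\<^sub>R axis i 1))) (at 0)"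
      by (rule has_derivative_compose[of "\<lambda>t. x + t *\<^sub>R axis i 1" _ 0 UNIV u])
        (use D in \<open>auto intro!: derivative_eq_intros\<close>)
    then have "((\<lambda>t. u (x + t *\<^sub>R axis i 1)) has_real_derivative D (axis i 1)) (at 0)"
      by (rule has_derivative_imp_has_field_derivative) (simp add: D.scaleR)
    then show ?thesis by (simp add: grad_def partial_deriv_def DERIV_imp_deriv)
  qed
  have "D h = grad u x \<bullet> h" for h
  proof -
    have "D h = D (\<Sum>i\<in>UNIV. h $ i *\<^sub>R axis i 1)"
      using basis_expansion[of h] by (simp add: scalar_mult_eq_scaleR)
    also have "\<dots> = grad u x \<bullet> h"
      by (simp add: D.sum D.scaleR inner_vec_def g mult.commute)
    finally show ?thesis .
  qed
  then show ?thesis using D by (metis (no_types) ext)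
qed

lemma jet2_of_C2:
  fixes u :: "real ^ 'n \<Rightarrow> real"
  assumes u: "u differentiable_on UNIV" and du: "grad u differentiable_on UNIV"
    and sym: "transpose (hess u x) = hess u x"
  shows "jet2 u x (grad u x) (hess u x)"
proof -
  obtain B where B: "(grad u has_derivative B) (at x)"
    using du by (auto simp: differentiable_on_def differentiable_def)
  have "B h $ j = (\<Sum>i\<in>UNIV. hess u x $ i $ j * h $ i)" for h j
  proof -
    have pd: "(partial_deriv j u has_derivative (\<lambda>h. B h $ j)) (at x)"
      using bounded_linear.has_derivative[OF bounded_linear_vec_nth[of j] B] by (simp add: grad_def)
    have "(partial_deriv j u has_derivative (\<lambda>h. grad (partial_deriv j u) x \<bullet> h)) (at x)"
      using pd by (intro has_derivative_grad) (auto simp: differentiable_def)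
    then have "(\<lambda>h. B h $ j) = (\<lambda>h. grad (partial_deriv j u) x \<bullet> h)"
      using has_derivative_unique[OF pd] by blast
    then have "B h $ j = grad (partial_deriv j u) x \<bullet> h" by metis
    then show ?thesis by (simp add: inner_vec_def grad_def hess_def)
  qed
  then have "B h = hess u x *v h" for h
    using sym by (simp add: vec_eq_iff matrix_vector_mult_def transpose_def)
  moreover have "(\<lambda>h. u (x + h) - u x - grad u x \<bullet> h - (B h \<bullet> h) / 2) \<in> o[nhds 0](\<lambda>h. (norm h)\<^sup>2)"
    using u by (intro Taylor_Peano_2[OF _ B] always_eventually allI has_derivative_grad)
      (auto simp: differentiable_on_def)
  ultimately show ?thesis using sym by (simp add: jet2_def inner_commute)
qed

lemma real_Taylor_Peano_2:
  fixes \<phi> :: "real \<Rightarrow> real"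
  assumes 1: "eventually (\<lambda>y. (\<phi> has_real_derivative \<phi>' y) (at y)) (nhds c)"
    and 2: "(\<phi>' has_real_derivative d2) (at c)"
  shows "(\<lambda>k. \<phi> (c + k) - \<phi> c - \<phi>' c * k - d2 * k\<^sup>2 / 2) \<in> o[nhds 0](\<lambda>k. k\<^sup>2)"
  using Taylor_Peano_2[of \<phi> \<phi>' c "\<lambda>h. d2 * h"] 1 2
  by (simp add: has_field_derivative_def mult.assoc flip: power2_eq_square)

lemma jet2_powr:
  assumes f: "jet2 f x g H" and pos: "f x > 0"
  shows "jet2 (\<lambda>y. f y powr p) x ((p * f x powr (p - 1)) *\<^sub>R g)
    ((p * f x powr (p - 1)) *\<^sub>R H + (p * (p - 1) * f x powr (p - 2)) *\<^sub>R outer_prod g g)"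
proof (rule jet2_compose[OF f], rule real_Taylor_Peano_2)
  have "eventually (\<lambda>y. y > 0) (nhds (f x))"
    using pos eventually_nhds_in_open[of "{0<..}" "f x"] by simp
  then show "eventually (\<lambda>y. ((\<lambda>y. y powr p) has_real_derivative p * y powr (p - 1)) (at y)) (nhds (f x))"
    by eventually_elim (auto intro!: derivative_eq_intros)
  show "((\<lambda>y. p * y powr (p - 1)) has_real_derivative p * (p - 1) * f x powr (p - 2)) (at (f x))"
    using pos by (auto intro!: derivative_eq_intros)
qed

lemma jet2_ln:
  assumes f: "jet2 f x g H" and pos: "f x > 0"
  shows "jet2 (\<lambda>y. ln (f y)) x ((1 / f x) *\<^sub>R g) ((1 / f x) *\<^sub>R H + (- 1 / (f x)\<^sup>2) *\<^sub>R outer_prod g g)"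
proof (rule jet2_compose[OF f], rule real_Taylor_Peano_2)
  have "eventually (\<lambda>y. y > 0) (nhds (f x))"
    using pos eventually_nhds_in_open[of "{0<..}" "f x"] by simp
  then show "eventually (\<lambda>y. (ln has_real_derivative 1 / y) (at y)) (nhds (f x))"
    by eventually_elim (auto intro!: derivative_eq_intros simp: field_simps)
  show "((\<lambda>y. 1 / y) has_real_derivative - 1 / (f x)\<^sup>2) (at (f x))"
    using pos by (auto intro!: derivative_eq_intros simp: power2_eq_square)
qed

lemma jet2_exp:
  assumes f: "jet2 f x g H"
  shows "jet2 (\<lambda>y. exp (f y)) x (exp (f x) *\<^sub>R g) (exp (f x) *\<^sub>R H + exp (f x) *\<^sub>R outer_prod g g)"
  by (rule jet2_compose[OF f], rule real_Taylor_Peano_2) (auto intro!: derivative_eq_intros)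

lemma jet2_const: "jet2 (\<lambda>_. c) x 0 0"
  by (rule jet2_exact) (simp_all add: transpose_def vec_eq_iff)

lemma jet2_inner: "jet2 (\<lambda>y. a \<bullet> y) x a 0"
  by (rule jet2_exact) (simp_all add: transpose_def vec_eq_iff inner_add_right)

lemma jet2_dist_square: "jet2 (\<lambda>y. (y - z) \<bullet> (y - z)) x (2 *\<^sub>R (x - z)) (2 *\<^sub>R mat 1)"
  by (rule jet2_exact) (simp_all add: transpose_scaleR transpose_mat scaleR_mult_vec
      inner_add_left inner_add_right inner_diff_left inner_diff_right inner_commute)

lemma jet2_inner_square: "jet2 (\<lambda>y. (e \<bullet> y)\<^sup>2) x ((2 * (e \<bullet> x)) *\<^sub>R e) (2 *\<^sub>R outer_prod e e)"
  by (rule jet2_exact) (simp_all add: transpose_scaleR transpose_outer_prod scaleR_mult_vec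
      outer_prod_mult_vec inner_add_right power2_eq_square inner_commute algebra_simps)

section \<open>The conformal Hessian and superharmonicity in the new variable\<close>

lemma trace_mat_1: "trace (mat 1 :: real ^ 'n ^ 'n) = real CARD('n)"
  by (simp add: trace_def mat_def)

lemma trace_conf_mat:
  fixes g :: "real ^ 'n"
  shows "trace (conf_mat c g H) = c * trace H - real CARD('n) / 2 * (g \<bullet> g)"
  by (simp add: conf_mat_def trace_sub trace_scaleR trace_mat_1)

text \<open>
  The exponent \<open>p\<close> is the one for which the Hessian of \<open>u powr p\<close> absorbs the term with
  \<open>grad u \<otimes> grad u\<close>.
\<close>

lemma conf_hess_eq_conf_mat:
  fixes u :: "real ^ 'n \<Rightarrow> real"
  assumes n: "CARD('n) \<ge> 3" and pos: "u x > 0"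
  defines "p \<equiv> - (2 / (real CARD('n) - 2))"
  shows "conf_hess u x = conf_mat (u x powr p) ((p * u x powr (p - 1)) *\<^sub>R grad u x)
    ((p * u x powr (p - 1)) *\<^sub>R hess u x + (p * (p - 1) * u x powr (p - 2)) *\<^sub>R outer_prod (grad u x) (grad u x))"
proof -
  define a where "a = real CARD('n) - 2"
  have a: "a > 0" "real CARD('n) = a + 2" using n by (auto simp: a_def)
  have p: "p = - (2 / a)" by (simp add: p_def a_def)
  define X where "X = u x powr (p - 1)"
  define Y where "Y = u x powr (- (2 * (a + 2) / a))"
  have e1: "u x powr p * (p * X) = - (2 / a) * u x powr (- ((a + 2 + 2) / a))"
  proof -
    have "p + (p - 1) = - ((a + 2 + 2) / a)" using a by (simp add: p field_simps)
    then show ?thesis using powr_add[of "u x" p "p - 1"] by (simp add: p X_def)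
  qed
  have e2: "u x powr p * (p * (p - 1) * u x powr (p - 2)) = 2 * (a + 2) / a\<^sup>2 * Y"
  proof -
    have "p + (p - 2) = - (2 * (a + 2) / a)" using a by (simp add: p field_simps)
    then have "u x powr p * u x powr (p - 2) = Y" by (simp add: Y_def flip: powr_add)
    moreover have "p * (p - 1) = 2 * (a + 2) / a\<^sup>2" using a by (simp add: p field_simps power2_eq_square)
    ultimately show ?thesis by (metis mult.assoc mult.commute)
  qed
  have e3: "p * X * (p * X * q) / 2 = 2 / a\<^sup>2 * Y * q" for q
  proof -
    have "(p - 1) + (p - 1) = - (2 * (a + 2) / a)" using a by (simp add: p field_simps)
    then have "X * X = Y" by (simp add: X_def Y_def flip: powr_add)
    moreover have "p * p / 2 = 2 / a\<^sup>2" by (simp add: p power2_eq_square)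
    moreover have "p * X * (p * X * q) / 2 = (p * p / 2) * (X * X) * q" by simp
    ultimately show ?thesis by metis
  qed
  show ?thesis
    unfolding conf_mat_def conf_hess_def Let_def scaleR_add_right scaleR_scaleR
      inner_scaleR_left inner_scaleR_right X_def[symmetric] e1 e2 e3 power2_norm_eq_inner a(2)
    by (simp add: Y_def)
qed

text \<open>
  In the trace the two gradient terms cancel, so the sign of \<open>tr A\<^sup>u\<close> is opposite to that of
  \<open>\<Delta>u\<close>.  Since the trace is invariant under conjugation, superharmonicity passes to Kelvin
  transforms.
\<close>

lemma trace_conf_hess_nonneg:
  fixes u :: "real ^ 'n \<Rightarrow> real"
  assumes n: "CARD('n) \<ge> 3" and pos: "u x > 0" and lap: "laplacian u x \<le> 0"
  shows "trace (conf_hess u x) \<ge> 0"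
proof -
  define c where "c = 2 / (real CARD('n) - 2) * u x powr (- ((real CARD('n) + 2) / (real CARD('n) - 2)))"
  have "trace (conf_hess u x) = - c * laplacian u x"
    by (simp add: conf_hess_def Let_def trace_sub trace_add trace_scaleR trace_mat_1 trace_outer_prod
        power2_norm_eq_inner laplacian_def hess_def c_def)
      (simp add: trace_def)
  moreover have "c \<ge> 0" using n by (simp add: c_def)
  ultimately show ?thesis using mult_nonneg_nonpos[OF _ lap] by simp
qed

text \<open>
  The Laplacian of the power is the trace times \<open>- (n - 2) / 2 f powr (- (n + 2) / 2)\<close>.
\<close>

lemma superharmonic_powr:
  fixes f :: "real ^ 'n \<Rightarrow> real"
  assumes f: "jet2 f x g H" and pos: "f x > 0" and n: "CARD('n) \<ge> 3"
    and tr: "trace (conf_mat (f x) g H) \<ge> 0"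
  shows "\<exists>g' H'. jet2 (\<lambda>y. f y powr (- ((real CARD('n) - 2) / 2))) x g' H' \<and> trace H' \<le> 0"
proof -
  define q where "q = - ((real CARD('n) - 2) / 2)"
  have q: "q < 0" using n by (simp add: q_def)
  have "f x powr (q - 1) = f x powr (q - 2) * f x"
    using pos powr_add[of "f x" "q - 2" 1] by simp
  then have "trace ((q * f x powr (q - 1)) *\<^sub>R H + (q * (q - 1) * f x powr (q - 2)) *\<^sub>R outer_prod g g)
      = q * f x powr (q - 2) * trace (conf_mat (f x) g H)"
    by (simp add: trace_add trace_scaleR trace_outer_prod trace_conf_mat)
      (simp add: q_def field_simps)
  also have "\<dots> \<le> 0" using q tr by (intro mult_nonpos_nonneg) auto
  finally show ?thesis using jet2_powr[OF f pos, of q] unfolding q_def by blast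
qed

section \<open>Positive superharmonic functions near an isolated singularity\<close>

text \<open>
  A point is removable for comparison from below: the subharmonic barrier
  \<open>\<epsilon> ln (|z|\<^sup>2 / r\<^sup>2)\<close> tends to \<open>- \<infinity>\<close> at the origin, vanishes on the outer sphere and has positive
  Laplacian because the dimension is at least three.  Let \<open>\<epsilon>\<close> tend to 0.
\<close>

lemma superharmonic_punctured_ball_comparison:
  fixes w \<psi> :: "real ^ 'n \<Rightarrow> real"
  assumes n: "CARD('n) \<ge> 3" and r: "r > 0"
    and w_cont: "\<And>z. 0 < norm z \<Longrightarrow> norm z \<le> r \<Longrightarrow> isCont w z"
    and w_pos: "\<And>z. 0 < norm z \<Longrightarrow> norm z \<le> r \<Longrightarrow> w z > 0"
    and w_super: "\<And>z. 0 < norm z \<Longrightarrow> norm z < r \<Longrightarrow> \<exists>g H. jet2 w z g H \<and> trace H \<le> 0"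
    and \<psi>_cont: "continuous_on (cball 0 r) \<psi>"
    and \<psi>_sub: "\<And>z. 0 < norm z \<Longrightarrow> norm z < r \<Longrightarrow> \<exists>g H. jet2 \<psi> z g H \<and> trace H \<ge> 0"
    and bd: "\<And>z. norm z = r \<Longrightarrow> \<psi> z \<le> w z"
    and z0: "0 < norm z0" "norm z0 \<le> r"
  shows "\<psi> z0 \<le> w z0"
proof -
  obtain K where K: "K > 0" "\<And>z. norm z \<le> r \<Longrightarrow> \<psi> z \<le> K"
  proof -
    have "bounded (\<psi> ` cball 0 r)"
      using compact_continuous_image[OF \<psi>_cont compact_cball] compact_imp_bounded by blast
    then obtain K where "K > 0" "\<forall>y \<in> \<psi> ` cball 0 r. norm y \<le> K"
      using bounded_pos by blast
    then show thesis by (intro that[of K]) force+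
  qed
  have eps: "\<psi> z0 + \<epsilon> * (ln (z0 \<bullet> z0) - ln (r\<^sup>2)) \<le> w z0" if \<epsilon>: "\<epsilon> > 0" for \<epsilon>
  proof (rule ccontr)
    assume neg: "\<not> ?thesis"
    define D where "D = (\<lambda>z. w z - \<psi> z - \<epsilon> * (ln (z \<bullet> z) - ln (r\<^sup>2)))"
    \<comment> \<open>on the inner sphere of this radius the barrier is below \<open>- K\<close>\<close>
    define s where "s = min (norm z0) (r * exp (- K / (2 * \<epsilon>)))"
    have s: "s > 0" "s \<le> norm z0" "s < r" "s \<le> r * exp (- K / (2 * \<epsilon>))"
      using z0 r K \<epsilon> by (auto simp: s_def min_less_iff_disj)
    have inner: "D z > 0" if "norm z = s" for z
    proof -
      have "ln (z \<bullet> z) = 2 * ln s" using s that by (simp add: dot_square_norm ln_realpow)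
      also have "\<dots> \<le> 2 * ln (r * exp (- K / (2 * \<epsilon>)))" using s by simp
      also have "\<dots> = ln (r\<^sup>2) - K / \<epsilon>" using r \<epsilon> by (simp add: ln_mult ln_realpow)
      finally have "\<epsilon> * (ln (z \<bullet> z) - ln (r\<^sup>2)) \<le> - K" using \<epsilon> by (simp add: field_simps)
      moreover have "w z > 0" "\<psi> z \<le> K" using that s K(2)[of z] w_pos[of z] by auto
      ultimately show ?thesis by (simp add: D_def)
    qed
    have outer: "D z \<ge> 0" if "norm z = r" for z
      using bd[OF that] that r by (simp add: D_def dot_square_norm)
    define A where "A = cball 0 r - ball (0 :: real ^ 'n) s"
    have A: "compact A" "z0 \<in> A"
      using z0 s by (auto simp: A_def intro!: compact_diff)
    have "continuous_on A D"
    proof -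
      have "continuous_on A w"
      proof (intro continuous_at_imp_continuous_on ballI)
        fix z assume "z \<in> A"
        then have "0 < norm z" "norm z \<le> r" using s by (auto simp: A_def)
        then show "isCont w z" by (rule w_cont)
      qed
      moreover have "continuous_on A \<psi>"
        by (rule continuous_on_subset[OF \<psi>_cont]) (auto simp: A_def)
      ultimately show ?thesis
        unfolding D_def using s by (intro continuous_intros) (auto simp: A_def)
    qed
    then obtain z1 where z1: "z1 \<in> A" "\<And>z. z \<in> A \<Longrightarrow> D z1 \<le> D z"
      using continuous_attains_inf[OF A(1)] A(2) by blast
    have "D z1 < 0" using z1(2)[OF A(2)] neg by (simp add: D_def)
    then have nz: "s < norm z1" "norm z1 < r"
      using inner[of z1] outer[of z1] z1(1) by (force simp: A_def less_le)+
    have "open {z :: real ^ 'n. s < norm z \<and> norm z < r}"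
      by (intro open_Collect_conj open_Collect_less continuous_intros)
    then have "eventually (\<lambda>z. z \<in> {z. s < norm z \<and> norm z < r}) (nhds z1)"
      using nz by (intro eventually_nhds_in_open) auto
    then have min: "eventually (\<lambda>z. D z1 \<le> D z) (nhds z1)"
      by eventually_elim (auto intro!: z1(2) simp: A_def)
    have z1pos: "0 < norm z1" "z1 \<bullet> z1 > 0" using nz s by auto
    obtain gw Hw g\<psi> H\<psi> where j: "jet2 w z1 gw Hw" "trace Hw \<le> 0" "jet2 \<psi> z1 g\<psi> H\<psi>" "trace H\<psi> \<ge> 0"
      using w_super[of z1] \<psi>_sub[of z1] nz z1pos by blast
    define Hl where "Hl = (1 / (z1 \<bullet> z1)) *\<^sub>R (2 *\<^sub>R mat 1)
      + (- 1 / (z1 \<bullet> z1)\<^sup>2) *\<^sub>R outer_prod (2 *\<^sub>R z1) (2 *\<^sub>R z1)"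
    have jl: "jet2 (\<lambda>z. ln (z \<bullet> z)) z1 ((1 / (z1 \<bullet> z1)) *\<^sub>R (2 *\<^sub>R z1)) Hl"
      using jet2_ln[OF jet2_dist_square[of 0 z1]] z1pos unfolding Hl_def by simp
    have "trace Hl = 2 * (real CARD('n) - 2) / (z1 \<bullet> z1)"
      using z1pos by (simp add: Hl_def trace_add trace_sub trace_scaleR trace_mat_1 trace_outer_prod
          power2_eq_square field_simps)
    then have trl: "trace Hl > 0" using n z1pos by simp
    have "jet2 D z1 (gw - g\<psi> - \<epsilon> *\<^sub>R ((1 / (z1 \<bullet> z1)) *\<^sub>R (2 *\<^sub>R z1) - 0)) (Hw - H\<psi> - \<epsilon> *\<^sub>R (Hl - 0))"
      unfolding D_def by (intro jet2_diff jet2_cmult j jl jet2_const)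
    then have "psd (Hw - H\<psi> - \<epsilon> *\<^sub>R (Hl - 0))"
      using jet2_local_min(2) min by blast
    then have "trace (Hw - H\<psi> - \<epsilon> *\<^sub>R (Hl - 0)) \<ge> 0" by (rule psd_trace_nonneg)
    moreover have "\<epsilon> * trace Hl > 0" using \<epsilon> trl by simp
    ultimately show False using j by (simp add: trace_sub trace_scaleR)
  qed
  show ?thesis
  proof (rule ccontr)
    assume neg: "\<not> ?thesis"
    define L where "L = \<bar>ln (z0 \<bullet> z0) - ln (r\<^sup>2)\<bar>"
    define \<epsilon> where "\<epsilon> = (\<psi> z0 - w z0) / (2 * (L + 1))"
    have L: "L \<ge> 0" by (simp add: L_def)
    have "\<epsilon> > 0" using neg L by (simp add: \<epsilon>_def)
    have "\<epsilon> * (L + 1) = (\<psi> z0 - w z0) / 2" using L by (simp add: \<epsilon>_def field_simps)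
    moreover have "- \<epsilon> * L \<le> \<epsilon> * (ln (z0 \<bullet> z0) - ln (r\<^sup>2))"
      using mult_left_mono[of "- L" "ln (z0 \<bullet> z0) - ln (r\<^sup>2)" \<epsilon>] \<open>\<epsilon> > 0\<close> by (simp add: L_def)
    ultimately show False
      using eps[OF \<open>\<epsilon> > 0\<close>] \<open>\<epsilon> > 0\<close> neg by (simp add: distrib_left)
  qed
qed

lemma differentiable_lower_bound:
  fixes k :: "real ^ 'n \<Rightarrow> real"
  assumes "(k has_derivative (\<lambda>h. p \<bullet> h)) (at 0)" "\<delta> > 0"
  obtains d where "d > 0" "\<And>z. norm z < d \<Longrightarrow> k 0 + p \<bullet> z - \<delta> * norm z \<le> k z"
proof -
  obtain d where d: "d > 0" "\<And>z. norm (z - 0) < d \<Longrightarrow> norm (k z - k 0 - p \<bullet> (z - 0)) \<le> \<delta> * norm (z - 0)"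
    using assms unfolding has_derivative_at_alt by blast
  show thesis
  proof (rule that[OF d(1)])
    fix z :: "real ^ 'n" assume "norm z < d"
    then show "k 0 + p \<bullet> z - \<delta> * norm z \<le> k z" using d(2)[of z] by (simp add: abs_le_iff)
  qed
qed

text \<open>
  If \<open>w\<close> stays above two functions with the same value \<open>\<alpha>\<close> at the origin but different
  gradients \<open>s + e\<close> and \<open>s - e\<close>, it stays above \<open>\<alpha> + s \<bullet> z + |e \<bullet> z|\<close> up to first order.  On the
  sphere of radius \<open>r\<close> one has \<open>|e \<bullet> z| \<ge> (e \<bullet> z)\<^sup>2 / (|e| r)\<close>, and the right-hand side there equals
  a harmonic polynomial whose value at the origin is \<open>|e| r / n > 0\<close>.  Comparison lifts this gain
  to the punctured ball.
\<close>

lemma superharmonic_liminf_gap: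
  fixes w k1 k2 :: "real ^ 'n \<Rightarrow> real"
  assumes n: "CARD('n) \<ge> 3" and r0: "r0 > 0"
    and w_pos: "\<And>z. 0 < norm z \<Longrightarrow> norm z < r0 \<Longrightarrow> w z > 0"
    and w_super: "\<And>z. 0 < norm z \<Longrightarrow> norm z < r0 \<Longrightarrow> \<exists>g H. jet2 w z g H \<and> trace H \<le> 0"
    and k1: "(k1 has_derivative (\<lambda>h. p1 \<bullet> h)) (at 0)" "k1 0 = \<alpha>"
      "\<And>z. 0 < norm z \<Longrightarrow> norm z < r0 \<Longrightarrow> k1 z \<le> w z"
    and k2: "(k2 has_derivative (\<lambda>h. p2 \<bullet> h)) (at 0)" "k2 0 = \<alpha>"
      "\<And>z. 0 < norm z \<Longrightarrow> norm z < r0 \<Longrightarrow> k2 z \<le> w z"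
    and ne: "p1 \<noteq> p2"
  shows "\<exists>\<epsilon>>0. eventually (\<lambda>z. \<alpha> + \<epsilon> \<le> w z) (at 0)"
proof -
  define s where "s = (1 / 2) *\<^sub>R (p1 + p2)"
  define e where "e = (1 / 2) *\<^sub>R (p1 - p2)"
  define N where "N = real CARD('n)"
  have N: "N > 0" using n by (simp add: N_def)
  have e: "norm e > 0" using ne by (simp add: e_def)
  have p: "p1 = s + e" "p2 = s - e"
    by (simp_all add: s_def e_def algebra_simps flip: scaleR_add_left scaleR_left_distrib)
  define \<delta> where "\<delta> = norm e / (2 * N)"
  have \<delta>: "\<delta> > 0" using e N by (simp add: \<delta>_def)
  obtain d1 where d1: "d1 > 0" "\<And>z. norm z < d1 \<Longrightarrow> \<alpha> + p1 \<bullet> z - \<delta> * norm z \<le> k1 z"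
    using differentiable_lower_bound[OF k1(1) \<delta>] k1(2) by auto
  obtain d2 where d2: "d2 > 0" "\<And>z. norm z < d2 \<Longrightarrow> \<alpha> + p2 \<bullet> z - \<delta> * norm z \<le> k2 z"
    using differentiable_lower_bound[OF k2(1) \<delta>] k2(2) by auto
  define r where "r = min r0 (min d1 d2) / 2"
  have r: "r > 0" "r < r0" "r < d1" "r < d2" using r0 d1 d2 by (auto simp: r_def)
  define \<kappa> where "\<kappa> = 1 / (norm e * r)"
  have \<kappa>: "\<kappa> > 0" using e r by (simp add: \<kappa>_def)
  \<comment> \<open>on the sphere \<open>|z| = r\<close> the terms with \<open>norm e\<close> add up to \<open>\<kappa> (e \<bullet> z)\<^sup>2\<close>;
    \<open>\<delta>\<close> absorbs the first-order errors and uses up half of the gain\<close>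
  define \<psi> where "\<psi> = (\<lambda>z. (\<alpha> - \<delta> * r + norm e * r / N) + s \<bullet> z
    + \<kappa> * ((e \<bullet> z)\<^sup>2 - ((norm e)\<^sup>2 / N) * (z \<bullet> z)))"
  have \<psi>_le: "\<psi> z \<le> w z" if "0 < norm z" "norm z \<le> r" for z
  proof (rule superharmonic_punctured_ball_comparison[OF n r(1) _ _ _ _ _ _ that])
    show "isCont w z" if "0 < norm z" "norm z \<le> r" for z
      using w_super[of z] jet2_isCont that r by force
    show "w z > 0" if "0 < norm z" "norm z \<le> r" for z using w_pos that r by force
    show "\<exists>g H. jet2 w z g H \<and> trace H \<le> 0" if "0 < norm z" "norm z < r" for z
      using w_super that r by force
    show "continuous_on (cball 0 r) \<psi>" unfolding \<psi>_def by (intro continuous_intros)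
    show "\<exists>g H. jet2 \<psi> z g H \<and> trace H \<ge> 0" for z
    proof -
      have "jet2 \<psi> z (0 + s + \<kappa> *\<^sub>R ((2 * (e \<bullet> z)) *\<^sub>R e - ((norm e)\<^sup>2 / N) *\<^sub>R (2 *\<^sub>R (z - 0))))
          (0 + 0 + \<kappa> *\<^sub>R (2 *\<^sub>R outer_prod e e - ((norm e)\<^sup>2 / N) *\<^sub>R (2 *\<^sub>R mat 1)))"
        unfolding \<psi>_def using jet2_dist_square[of 0 z]
        by (intro jet2_add jet2_cmult jet2_diff jet2_const jet2_inner jet2_inner_square) auto
      moreover have "trace (0 + 0 + \<kappa> *\<^sub>R (2 *\<^sub>R outer_prod e e
          - ((norm e)\<^sup>2 / N) *\<^sub>R (2 *\<^sub>R (mat 1 :: real ^ 'n ^ 'n)))) = 0"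
        using N by (simp add: trace_sub trace_scaleR trace_outer_prod trace_mat_1 dot_square_norm flip: N_def)
      ultimately show ?thesis by force
    qed
    show "\<psi> z \<le> w z" if z: "norm z = r" for z
    proof -
      have z0: "0 < norm z" "norm z < r0" using z r by auto
      have "\<kappa> * (e \<bullet> z)\<^sup>2 \<le> \<bar>e \<bullet> z\<bar>"
      proof -
        have "\<bar>e \<bullet> z\<bar> * \<bar>e \<bullet> z\<bar> \<le> (norm e * r) * \<bar>e \<bullet> z\<bar>"
          using Cauchy_Schwarz_ineq2[of e z] z by (intro mult_right_mono) auto
        then show ?thesis using e r by (simp add: \<kappa>_def power2_eq_square field_simps)
      qed
      moreover have "\<kappa> * (((norm e)\<^sup>2 / N) * (z \<bullet> z)) = norm e * r / N"
        using e r N z by (simp add: \<kappa>_def dot_square_norm power2_eq_square)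
      moreover have "\<psi> z = \<alpha> - \<delta> * r + s \<bullet> z + \<kappa> * (e \<bullet> z)\<^sup>2
          + (norm e * r / N - \<kappa> * (((norm e)\<^sup>2 / N) * (z \<bullet> z)))"
        unfolding \<psi>_def right_diff_distrib by simp
      ultimately have "\<psi> z \<le> \<alpha> - \<delta> * r + s \<bullet> z + \<bar>e \<bullet> z\<bar>" by linarith
      also have "\<dots> \<le> w z"
        using d1(2)[of z] d2(2)[of z] k1(3)[OF z0] k2(3)[OF z0] z r
        by (auto simp: p inner_add_left inner_diff_left abs_if)
      finally show ?thesis .
    qed
  qed
  have "\<psi> 0 = \<alpha> + \<delta> * r" using N by (simp add: \<psi>_def \<delta>_def field_simps)
  then have "\<psi> 0 > \<alpha> + \<delta> * r / 2" using \<delta> r by simp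
  moreover have "(\<psi> \<longlongrightarrow> \<psi> 0) (at 0)"
  proof -
    have "isCont \<psi> 0" unfolding \<psi>_def by (intro continuous_intros)
    then show ?thesis by (simp add: isCont_def)
  qed
  ultimately have "eventually (\<lambda>z. \<alpha> + \<delta> * r / 2 < \<psi> z) (at 0)"
    by (rule order_tendstoD(1)[rotated])
  moreover have "eventually (\<lambda>z. 0 < norm z \<and> norm z \<le> r) (at (0 :: real ^ 'n))"
    using r by (auto simp: eventually_at intro!: exI[of _ r])
  ultimately have "eventually (\<lambda>z. \<alpha> + \<delta> * r / 2 \<le> w z) (at 0)"
    by eventually_elim (use \<psi>_le in force)
  then show ?thesis using \<delta> r by (intro exI[of _ "\<delta> * r / 2"]) auto
qed

section \<open>The Hopf lemma for the fully nonlinear equation\<close>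

text \<open>
  A direction or its opposite points into the ball, except for tangential ones, which are limits
  of such directions.
\<close>

lemma jet2_touching_ball_psd:
  fixes w :: "real ^ 'n \<Rightarrow> real"
  assumes w: "jet2 w x0 0 H" and R: "R > 0" "dist x0 z = R"
    and min: "\<And>y. y \<in> cball z R \<Longrightarrow> w x0 \<le> w y"
  shows "psd H"
proof -
  have pos: "0 \<le> v \<bullet> (H *v v)" if v: "v \<bullet> (z - x0) > 0" for v
  proof (rule jet2_one_sided_min[OF w])
    have "v \<noteq> 0" using v by auto
    have "x0 + t *\<^sub>R v \<in> cball z R" if t: "0 < t" "t < (v \<bullet> (z - x0)) / (v \<bullet> v)" for t
    proof -
      have tv: "t * (v \<bullet> v) \<le> v \<bullet> (z - x0)" using t(2) \<open>v \<noteq> 0\<close> by (simp add: field_simps)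
      have "(z - (x0 + t *\<^sub>R v)) \<bullet> (z - (x0 + t *\<^sub>R v))
          = (z - x0) \<bullet> (z - x0) - t * (2 * (v \<bullet> (z - x0)) - t * (v \<bullet> v))"
        by (simp add: inner_diff_left inner_diff_right inner_add_left inner_add_right inner_commute algebra_simps)
      also have "\<dots> \<le> (z - x0) \<bullet> (z - x0)" using t tv v by simp
      finally have "(norm (z - (x0 + t *\<^sub>R v)))\<^sup>2 \<le> (norm (z - x0))\<^sup>2" by (simp add: power2_norm_eq_inner)
      then show ?thesis
        using R power2_le_imp_le[of "norm (z - (x0 + t *\<^sub>R v))" "norm (z - x0)"]
        by (simp add: dist_norm norm_minus_commute)
    qed
    moreover have "(v \<bullet> (z - x0)) / (v \<bullet> v) > 0" using v \<open>v \<noteq> 0\<close> by simp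
    ultimately show "eventually (\<lambda>t. w x0 \<le> w (x0 + t *\<^sub>R v)) (at_right 0)"
      using min unfolding eventually_at_right_field by (intro exI[of _ "(v \<bullet> (z - x0)) / (v \<bullet> v)"]) auto
  qed
  have "0 \<le> v \<bullet> (H *v v)" for v
  proof -
    consider "v \<bullet> (z - x0) > 0" | "(- v) \<bullet> (z - x0) > 0" | "v \<bullet> (z - x0) = 0" by fastforce
    then show ?thesis
    proof cases
      case 1 then show ?thesis by (rule pos)
    next
      case 2 then show ?thesis using pos[OF 2] by (simp add: linear_neg[OF matrix_vector_mul_linear])
    next
      case 3
      define q where "q = (\<lambda>s. (v + s *\<^sub>R (z - x0)) \<bullet> (H *v (v + s *\<^sub>R (z - x0))))"
      have "isCont q 0"
        unfolding q_def
        by (intro continuous_intros isCont_o2[where g = "\<lambda>x. H *v x"] linear_continuous_at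
            matrix_vector_mul_bounded_linear)
      then have lim: "(q \<longlongrightarrow> q 0) (at_right 0)"
        by (auto simp: isCont_def intro: tendsto_mono[OF at_le[OF subset_UNIV]])
      have "z \<noteq> x0" using R by auto
      then have "q s \<ge> 0" if "s > 0" for s
        unfolding q_def using that 3 by (intro pos) (simp add: inner_add_left)
      then have "eventually (\<lambda>s. 0 \<le> q s) (at_right 0)"
        using eventually_at_right_less[of 0] by (auto elim!: eventually_mono)
      then have "0 \<le> q 0" using tendsto_lowerbound[OF lim] by simp
      then show ?thesis by (simp add: q_def)
    qed
  qed
  then show ?thesis using jet2_sym[OF w] by (simp add: psd_def)
qed

lemma outer_prod_scaleR: "outer_prod (a *\<^sub>R v) (b *\<^sub>R w) = (a * b) *\<^sub>R outer_prod v w"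
  by (simp add: outer_prod_def vec_eq_iff)

lemma jet2_Hopf_barrier:
  fixes z y :: "real ^ 'n" and \<alpha> \<epsilon> b :: real
  defines "e \<equiv> \<epsilon> * exp (- \<alpha> * ((y - z) \<bullet> (y - z)))"
  shows "jet2 (\<lambda>y. \<epsilon> * (exp (- \<alpha> * ((y - z) \<bullet> (y - z))) - b)) y ((- 2 * \<alpha> * e) *\<^sub>R (y - z))
    (e *\<^sub>R ((4 * \<alpha>\<^sup>2) *\<^sub>R outer_prod (y - z) (y - z) - (2 * \<alpha>) *\<^sub>R mat 1))"
proof -
  define v where "v = y - z"
  let ?a = "- \<alpha>"
  have "jet2 (\<lambda>y. \<epsilon> * (exp (- \<alpha> * ((y - z) \<bullet> (y - z))) - b)) y
      (\<epsilon> *\<^sub>R (exp (- \<alpha> * (v \<bullet> v)) *\<^sub>R (?a *\<^sub>R 2 *\<^sub>R v) - 0))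
      (\<epsilon> *\<^sub>R (exp (- \<alpha> * (v \<bullet> v)) *\<^sub>R (?a *\<^sub>R 2 *\<^sub>R mat 1)
        + exp (- \<alpha> * (v \<bullet> v)) *\<^sub>R outer_prod (?a *\<^sub>R 2 *\<^sub>R v) (?a *\<^sub>R 2 *\<^sub>R v) - 0))"
    unfolding v_def by (intro jet2_cmult jet2_diff jet2_const jet2_exp[OF jet2_cmult[OF jet2_dist_square]])
  also have "\<epsilon> *\<^sub>R (exp (- \<alpha> * (v \<bullet> v)) *\<^sub>R (?a *\<^sub>R 2 *\<^sub>R v) - 0) = (- 2 * \<alpha> * e) *\<^sub>R v"
    by (simp add: e_def v_def[symmetric] mult_ac)
  also have "\<epsilon> *\<^sub>R (exp (- \<alpha> * (v \<bullet> v)) *\<^sub>R (?a *\<^sub>R 2 *\<^sub>R mat 1)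
        + exp (- \<alpha> * (v \<bullet> v)) *\<^sub>R outer_prod (?a *\<^sub>R 2 *\<^sub>R v) (?a *\<^sub>R 2 *\<^sub>R v) - 0)
      = e *\<^sub>R ((4 * \<alpha>\<^sup>2) *\<^sub>R outer_prod v v - (2 * \<alpha>) *\<^sub>R mat 1)"
    unfolding scaleR_scaleR outer_prod_scaleR
    by (simp add: e_def v_def[symmetric] scaleR_add_right scaleR_diff_right power2_eq_square mult_ac)
  finally show ?thesis by (simp add: v_def)
qed

text \<open>
  Here \<open>p\<close> and \<open>K\<close> are the gradient and Hessian of a barrier and \<open>Q\<close> is the semidefinite excess at
  an interior minimum.
\<close>

lemma conf_mat_diff:
  "conf_mat c' (g + p) (H + K + Q) - conf_mat c g H
    = c' *\<^sub>R K + c' *\<^sub>R Q + (c' - c) *\<^sub>R H - ((2 * (g \<bullet> p) + p \<bullet> p) / 2) *\<^sub>R mat 1"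
  by (simp add: conf_mat_def inner_add_left inner_add_right inner_commute algebra_simps add_divide_distrib)

lemma sym_matrices_iff: "M \<in> sym_matrices \<longleftrightarrow> transpose M = M"
  by (simp add: sym_matrices_def)

lemma convex_sym_ball: "convex (sym_matrices \<inter> ball (M :: real ^ 'n ^ 'n) r)"
  by (intro convex_Int convex_ball)
    (auto simp: convex_def sym_matrices_iff transpose_add transpose_scaleR)

locale elliptic_equation =
  fixes U :: "(real ^ 'n ^ 'n) set" and F :: "real ^ 'n ^ 'n \<Rightarrow> real"
  assumes U_open: "openin (top_of_set sym_matrices) U"
    and U_inv: "\<And>Q :: real ^ 'n ^ 'n. orthogonal_matrix Q \<Longrightarrow>
          (\<lambda>M. matrix_inv Q ** M ** Q) ` U = U"
    and U_convex: "\<And>M N. M \<in> sym_matrices \<Longrightarrow> pos_def N \<Longrightarrow>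
          convex (U \<inter> {M + t *\<^sub>R N | t :: real. 0 < t})"
    and F_C1: "C1_on_sym U F"
    and F_inv: "\<And>M Q. M \<in> U \<Longrightarrow> orthogonal_matrix Q \<Longrightarrow>
          F (matrix_inv Q ** M ** Q) = F M"
    and F_elliptic: "\<And>M. M \<in> U \<Longrightarrow> pos_def (sym_grad F M)"
begin

lemma U_sym: "M \<in> U \<Longrightarrow> M \<in> sym_matrices"
  using openin_imp_subset[OF U_open] by auto

lemma U_ball:
  assumes "M \<in> U"
  obtains \<delta> where "\<delta> > 0" "sym_matrices \<inter> ball M \<delta> \<subseteq> U"
  using assms U_open unfolding openin_contains_ball by (auto simp: Int_commute)

lemma F_mean_value:
  assumes seg: "closed_segment M N \<subseteq> U"
  shows "\<exists>\<xi>\<in>closed_segment M N. F N - F M = sym_grad F \<xi> \<bullet> (N - M)"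
proof -
  define \<gamma> where "\<gamma> = (\<lambda>t :: real. M + t *\<^sub>R (N - M))"
  have \<gamma>: "\<gamma> t \<in> closed_segment M N" if "t \<in> {0..1}" for t
    using that by (auto simp: \<gamma>_def in_segment algebra_simps intro!: exI[of _ t])
  have "M \<in> sym_matrices" "N \<in> sym_matrices" using seg U_sym by auto
  then have NM: "N - M \<in> sym_matrices" by (simp add: sym_matrices_iff transpose_diff)
  have "((\<lambda>t. F (\<gamma> t)) has_derivative (\<lambda>s. s * (sym_grad F (\<gamma> t) \<bullet> (N - M)))) (at t within {0..1})"
    if t: "t \<in> {0..1}" for t
  proof -
    have U: "\<gamma> t \<in> U" using \<gamma>[OF t] seg by auto
    obtain D where D: "(F has_derivative D) (at (\<gamma> t) within U)"
      using F_C1 U unfolding C1_on_sym_def differentiable_on_def differentiable_def by blast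
    have "(\<gamma> has_derivative (\<lambda>s. s *\<^sub>R (N - M))) (at t within {0..1})"
      unfolding \<gamma>_def by (auto intro!: derivative_eq_intros)
    moreover have "\<gamma> ` {0..1} \<subseteq> U" using \<gamma> seg by auto
    ultimately have "((\<lambda>t. F (\<gamma> t)) has_derivative (\<lambda>s. D (s *\<^sub>R (N - M)))) (at t within {0..1})"
      using has_derivative_in_compose[of \<gamma> _ t "{0..1}" F D] has_derivative_subset[OF D] by blast
    moreover have "D (s *\<^sub>R (N - M)) = s * (sym_grad F (\<gamma> t) \<bullet> (N - M))" for s
      using has_derivative_sym_grad[OF U_open U D NM] linear_scale[OF has_derivative_linear[OF D], of s "N - M"]
      by (simp add: inner_vec_def)
    ultimately show ?thesis by simp
  qed
  then obtain t where t: "t \<in> {0<..<1}"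
    "F (\<gamma> 1) - F (\<gamma> 0) = (1 - 0) * (sym_grad F (\<gamma> t) \<bullet> (N - M))"
    using mvt_simple[of 0 1 "\<lambda>t. F (\<gamma> t)" "\<lambda>t s. s * (sym_grad F (\<gamma> t) \<bullet> (N - M))"] by auto
  then show ?thesis using \<gamma>[of t] by (auto simp: \<gamma>_def)
qed

text \<open>
  Only sections of \<open>U\<close> along positive definite directions are known to be convex.  Therefore
  \<open>P\<close> is replaced by \<open>N = P + \<epsilon> I\<close>; the segment from \<open>A\<close> to \<open>A + N\<close> lies in \<open>U\<close> and \<open>F\<close>
  increases along it.  To keep the inequality strict as \<open>\<epsilon>\<close> tends to 0, an initial piece of length
  \<open>\<tau>\<close> is treated separately inside a ball around \<open>A\<close>.
\<close>

lemma F_strictly_increasing: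
  assumes A: "A \<in> U" and AP: "A + P \<in> U" and P: "psd P" "P \<noteq> 0"
  shows "F A < F (A + P)"
proof -
  obtain \<delta>1 where \<delta>1: "\<delta>1 > 0" "sym_matrices \<inter> ball A \<delta>1 \<subseteq> U" using U_ball[OF A] .
  obtain \<delta>2 where \<delta>2: "\<delta>2 > 0" "sym_matrices \<inter> ball (A + P) \<delta>2 \<subseteq> U" using U_ball[OF AP] .
  have Asym: "A \<in> sym_matrices" by (rule U_sym[OF A])
  have Psym: "P \<in> sym_matrices" using P by (simp add: psd_def sym_matrices_iff)
  define N where "N = (\<lambda>\<epsilon> :: real. P + \<epsilon> *\<^sub>R mat 1)"
  have Nsym: "N \<epsilon> \<in> sym_matrices" for \<epsilon>
    using Psym by (simp add: N_def sym_matrices_iff transpose_add transpose_scaleR transpose_mat)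
  have Npos: "pos_def (N \<epsilon>)" if "\<epsilon> > 0" for \<epsilon>
    using P that Nsym[of \<epsilon>]
    by (auto simp: pos_def_def psd_def N_def matrix_vector_mult_add_rdistrib scaleR_mult_vec
        inner_add_right intro!: add_nonneg_pos)
  have pos_psd: "psd M \<and> M \<noteq> 0" if "pos_def M" for M :: "real ^ 'n ^ 'n"
  proof -
    have "(axis undefined 1 :: real ^ 'n) \<noteq> 0" by simp
    then have "M \<noteq> 0" using that by (force simp: pos_def_def)
    moreover have "0 \<le> x \<bullet> (M *v x)" for x using that by (cases "x = 0") (auto simp: pos_def_def less_imp_le)
    ultimately show ?thesis using that by (simp add: pos_def_def psd_def sym_matrices_iff)
  qed
  define \<tau> where "\<tau> = min (1 / 2) (\<delta>1 / (2 * (norm P + 1)))"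
  have \<tau>: "0 < \<tau>" "\<tau> < 1" "\<tau> * norm P < \<delta>1"
  proof -
    show \<tau>0: "0 < \<tau>" and "\<tau> < 1" using \<delta>1 by (auto simp: \<tau>_def add_nonneg_pos)
    define q where "q = norm P + 1"
    have q: "q > 0" "norm P \<le> q" by (auto simp: q_def add_nonneg_pos)
    have "\<tau> * norm P \<le> (\<delta>1 / (2 * q)) * q"
      using q \<tau>0 by (intro mult_mono) (auto simp: \<tau>_def q_def)
    also have "\<dots> < \<delta>1" using \<delta>1 q(1) by simp
    finally show "\<tau> * norm P < \<delta>1" .
  qed
  have step: "A + \<tau> *\<^sub>R N \<epsilon> \<in> U \<and> A + N \<epsilon> \<in> U \<and> F (A + \<tau> *\<^sub>R N \<epsilon>) \<le> F (A + N \<epsilon>)"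
    if \<epsilon>: "\<epsilon> > 0" "\<epsilon> * norm (mat 1 :: real ^ 'n ^ 'n) < \<delta>2" for \<epsilon>
  proof -
    have "A + N \<epsilon> \<in> sym_matrices \<inter> ball (A + P) \<delta>2"
      using \<epsilon> Asym Nsym[of \<epsilon>] by (auto simp: sym_matrices_iff transpose_add dist_norm N_def)
    then have AN: "A + N \<epsilon> \<in> U" using \<delta>2 by blast
    \<comment> \<open>the base point is shifted back by \<open>N\<close> so that \<open>A\<close> itself has the parameter \<open>t = 1 > 0\<close>\<close>
    define L where "L = U \<inter> {(A - N \<epsilon>) + t *\<^sub>R N \<epsilon> | t :: real. 0 < t}"
    have "A \<in> L" unfolding L_def using A by (auto intro!: exI[of _ 1])
    moreover have "A + N \<epsilon> \<in> L" unfolding L_def using AN by (auto intro!: exI[of _ 2] simp: scaleR_2)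
    moreover have "convex L"
      unfolding L_def using Asym Nsym[of \<epsilon>] \<epsilon>
      by (intro U_convex Npos) (auto simp: sym_matrices_iff transpose_diff)
    ultimately have "closed_segment A (A + N \<epsilon>) \<subseteq> L" by (intro closed_segment_subset)
    then have LU: "closed_segment A (A + N \<epsilon>) \<subseteq> U" by (auto simp: L_def)
    have \<tau>seg: "A + \<tau> *\<^sub>R N \<epsilon> \<in> closed_segment A (A + N \<epsilon>)"
      using \<tau> by (auto simp: in_segment algebra_simps intro!: exI[of _ \<tau>])
    then have "closed_segment (A + \<tau> *\<^sub>R N \<epsilon>) (A + N \<epsilon>) \<subseteq> U"
      using LU subset_closed_segment[of "A + \<tau> *\<^sub>R N \<epsilon>" "A + N \<epsilon>" A "A + N \<epsilon>"] by auto
    from F_mean_value[OF this] obtain \<xi> where \<xi>: "\<xi> \<in> U"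
      "F (A + N \<epsilon>) - F (A + \<tau> *\<^sub>R N \<epsilon>) = sym_grad F \<xi> \<bullet> ((A + N \<epsilon>) - (A + \<tau> *\<^sub>R N \<epsilon>))"
      using \<open>closed_segment (A + \<tau> *\<^sub>R N \<epsilon>) (A + N \<epsilon>) \<subseteq> U\<close> by blast
    have "(A + N \<epsilon>) - (A + \<tau> *\<^sub>R N \<epsilon>) = (1 - \<tau>) *\<^sub>R N \<epsilon>" by (simp add: algebra_simps)
    then have "F (A + N \<epsilon>) - F (A + \<tau> *\<^sub>R N \<epsilon>) = (1 - \<tau>) * (sym_grad F \<xi> \<bullet> N \<epsilon>)" using \<xi> by simp
    moreover have "sym_grad F \<xi> \<bullet> N \<epsilon> > 0"
      using pos_def_inner_psd_pos[OF F_elliptic[OF \<xi>(1)]] pos_psd[OF Npos[OF \<epsilon>(1)]] by blast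
    ultimately have "F (A + \<tau> *\<^sub>R N \<epsilon>) \<le> F (A + N \<epsilon>)" using \<tau> by (smt (verit) mult_nonneg_nonneg)
    then show ?thesis using AN \<tau>seg LU by auto
  qed
  have F_cont: "continuous_on U F"
    using F_C1 by (simp add: C1_on_sym_def differentiable_imp_continuous_on)
  have A\<tau>P: "A + \<tau> *\<^sub>R P \<in> sym_matrices \<inter> ball A \<delta>1"
    using \<tau> Asym Psym by (auto simp: sym_matrices_iff transpose_add transpose_scaleR dist_norm)
  have "eventually (\<lambda>\<epsilon>. \<epsilon> * norm (mat 1 :: real ^ 'n ^ 'n) < \<delta>2) (at_right 0)"
  proof -
    have "((\<lambda>\<epsilon>. \<epsilon> * norm (mat 1 :: real ^ 'n ^ 'n)) \<longlongrightarrow> 0 * norm (mat 1 :: real ^ 'n ^ 'n)) (at_right 0)"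
      by (intro tendsto_intros)
    then show ?thesis using \<delta>2 by (intro order_tendstoD(2)) auto
  qed
  then have ev: "eventually (\<lambda>\<epsilon>. A + \<tau> *\<^sub>R N \<epsilon> \<in> U \<and> A + N \<epsilon> \<in> U \<and> F (A + \<tau> *\<^sub>R N \<epsilon>) \<le> F (A + N \<epsilon>)) (at_right 0)"
    using eventually_at_right_less[of 0] by eventually_elim (use step in auto)
  have lim: "(N \<longlongrightarrow> P + 0 *\<^sub>R mat 1) (at_right 0)" unfolding N_def by (intro tendsto_intros)
  have "((\<lambda>\<epsilon>. F (A + N \<epsilon>)) \<longlongrightarrow> F (A + P)) (at_right 0)"
    using lim ev AP by (intro continuous_on_tendsto_compose[OF F_cont] tendsto_add tendsto_const)
      (auto elim: eventually_mono)
  moreover have "((\<lambda>\<epsilon>. F (A + \<tau> *\<^sub>R N \<epsilon>)) \<longlongrightarrow> F (A + \<tau> *\<^sub>R P)) (at_right 0)"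
    using lim ev A\<tau>P \<delta>1
    by (intro continuous_on_tendsto_compose[OF F_cont] tendsto_add tendsto_const tendsto_scaleR)
      (auto elim: eventually_mono)
  ultimately have le: "F (A + \<tau> *\<^sub>R P) \<le> F (A + P)"
    using ev by (intro tendsto_le[of "at_right 0"]) (auto elim: eventually_mono)
  have "closed_segment A (A + \<tau> *\<^sub>R P) \<subseteq> sym_matrices \<inter> ball A \<delta>1"
    using A\<tau>P Asym \<delta>1 by (intro closed_segment_subset convex_sym_ball) auto
  then have seg: "closed_segment A (A + \<tau> *\<^sub>R P) \<subseteq> U" using \<delta>1 by blast
  from F_mean_value[OF this] obtain \<xi> where \<xi>: "\<xi> \<in> U"
    "F (A + \<tau> *\<^sub>R P) - F A = \<tau> * (sym_grad F \<xi> \<bullet> P)"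
    using seg by auto
  then have "F (A + \<tau> *\<^sub>R P) - F A > 0"
    using pos_def_inner_psd_pos[OF F_elliptic[OF \<xi>(1)] P] \<tau> by simp
  then show ?thesis using le by simp
qed

definition solves ::
  "(real ^ 'n) set \<Rightarrow> (real ^ 'n \<Rightarrow> real) \<Rightarrow> (real ^ 'n \<Rightarrow> real ^ 'n) \<Rightarrow> (real ^ 'n \<Rightarrow> real ^ 'n ^ 'n) \<Rightarrow> bool"
  where "solves S f G H \<longleftrightarrow> continuous_on S G \<and> continuous_on S H \<and>
    (\<forall>y\<in>S. f y > 0 \<and> jet2 f y (G y) (H y) \<and>
      conf_mat (f y) (G y) (H y) \<in> U \<and> F (conf_mat (f y) (G y) (H y)) = 1)"

lemma solves_continuous:
  assumes "solves S f G H"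
  shows "continuous_on S f" "continuous_on S (\<lambda>y. conf_mat (f y) (G y) (H y))"
proof -
  show f: "continuous_on S f"
    using assms by (auto simp: solves_def intro!: continuous_at_imp_continuous_on jet2_isCont)
  show "continuous_on S (\<lambda>y. conf_mat (f y) (G y) (H y))"
    using f assms unfolding conf_mat_def solves_def by (intro continuous_intros) auto
qed

lemma solves_subset: "solves S f G H \<Longrightarrow> T \<subseteq> S \<Longrightarrow> solves T f G H"
  unfolding solves_def by (auto intro: continuous_on_subset)

text \<open>
  Suppose the gradients agree at the touching point \<open>x0\<close>.  Then the difference of the Hessians is
  semidefinite there, so the strict monotonicity of \<open>F\<close> forces the two conformal Hessians to
  coincide at \<open>x0\<close>.  By continuity both stay in a small ball around this common value, which is
  convex and contained in \<open>U\<close>; only now the equation may be linearised.  From there on it is Hopf's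
  argument with the barrier \<open>h = \<epsilon> (exp (- \<alpha> |y - z|\<^sup>2) - exp (- \<alpha> R\<^sup>2))\<close> on the part \<open>D\<close> of the ball
  near \<open>x0\<close>: for large \<open>\<alpha>\<close> the second derivatives of \<open>h\<close> dominate, so \<open>g - f - h\<close> has no negative
  interior minimum, and \<open>g - f \<ge> h\<close> contradicts the vanishing gradient.
\<close>

lemma Hopf_boundary_point:
  assumes f: "solves (cball z R) f Gf Hf" and g: "solves (cball z R) g Gg Hg"
    and R: "R > 0" "dist x0 z = R"
    and less: "\<And>y. y \<in> cball z R \<Longrightarrow> y \<noteq> x0 \<Longrightarrow> f y < g y"
    and eq: "f x0 = g x0"
  shows "Gf x0 \<noteq> Gg x0"
proof
  assume Geq: "Gf x0 = Gg x0"
  let ?Af = "\<lambda>y. conf_mat (f y) (Gf y) (Hf y)"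
  let ?Ag = "\<lambda>y. conf_mat (g y) (Gg y) (Hg y)"
  have x0: "x0 \<in> cball z R" using R by (simp add: dist_commute)
  have fj: "f y > 0" "jet2 f y (Gf y) (Hf y)" "?Af y \<in> U" "F (?Af y) = 1"
    and gj: "g y > 0" "jet2 g y (Gg y) (Hg y)" "?Ag y \<in> U" "F (?Ag y) = 1" if "y \<in> cball z R" for y
    using f g that by (auto simp: solves_def)
  define w where "w = (\<lambda>y. g y - f y)"
  have w0: "w x0 = 0" by (simp add: w_def eq)
  have w_pos: "w y > 0" if "y \<in> cball z R" "y \<noteq> x0" for y using less[OF that] by (simp add: w_def)
  then have w_nonneg: "w y \<ge> 0" if "y \<in> cball z R" for y
    using that w0 by (cases "y = x0") (auto simp: less_imp_le)
  have wj: "jet2 w y (Gg y - Gf y) (Hg y - Hf y)" if "y \<in> cball z R" for y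
    unfolding w_def using fj(2)[OF that] gj(2)[OF that] by (intro jet2_diff)

  have A_eq: "?Ag x0 = ?Af x0"
  proof (rule ccontr)
    assume ne: "?Ag x0 \<noteq> ?Af x0"
    have "psd (Hg x0 - Hf x0)"
      using wj[OF x0] Geq w0 w_nonneg by (intro jet2_touching_ball_psd[OF _ R]) auto
    then have P: "psd (f x0 *\<^sub>R (Hg x0 - Hf x0))"
      using fj(1)[OF x0] by (auto simp: psd_def transpose_scaleR scaleR_mult_vec)
    have Ag: "?Ag x0 = ?Af x0 + f x0 *\<^sub>R (Hg x0 - Hf x0)"
      by (simp add: conf_mat_def eq Geq algebra_simps)
    then have "f x0 *\<^sub>R (Hg x0 - Hf x0) \<noteq> 0" using ne by simp
    then have "F (?Af x0) < F (?Ag x0)"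
      unfolding Ag using fj(3)[OF x0] gj(3)[OF x0] P by (intro F_strictly_increasing) (simp_all add: Ag)
    then show False using fj(4)[OF x0] gj(4)[OF x0] by simp
  qed

  define A0 where "A0 = ?Af x0"
  have A0: "A0 \<in> U" using fj(3)[OF x0] by (simp add: A0_def)
  obtain \<theta>0 where \<theta>0: "\<theta>0 > 0" "\<And>x. \<theta>0 * (norm x)\<^sup>2 \<le> x \<bullet> (sym_grad F A0 *v x)"
    using pos_def_coercive[OF F_elliptic[OF A0]] by blast
  define \<theta> where "\<theta> = \<theta>0 / 2"
  define \<Theta> where "\<Theta> = norm (sym_grad F A0) + \<theta>"
  have \<theta>: "\<theta> > 0" using \<theta>0 by (simp add: \<theta>_def)
  obtain \<delta> where \<delta>: "\<delta> > 0" "sym_matrices \<inter> ball A0 \<delta> \<subseteq> U"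
    "\<And>M. M \<in> sym_matrices \<inter> ball A0 \<delta> \<Longrightarrow> norm (sym_grad F M - sym_grad F A0) < \<theta>"
  proof -
    obtain \<delta>1 where \<delta>1: "\<delta>1 > 0" "sym_matrices \<inter> ball A0 \<delta>1 \<subseteq> U" using U_ball[OF A0] .
    have "continuous_on U (sym_grad F)" using F_C1 by (simp add: C1_on_sym_def)
    then obtain \<delta>2 where \<delta>2: "\<delta>2 > 0" "\<And>M. M \<in> U \<Longrightarrow> dist M A0 < \<delta>2 \<Longrightarrow> dist (sym_grad F M) (sym_grad F A0) < \<theta>"
      using A0 \<theta> unfolding continuous_on_iff by blast
    show thesis
    proof (rule that[of "min \<delta>1 \<delta>2"])
      fix M assume M: "M \<in> sym_matrices \<inter> ball A0 (min \<delta>1 \<delta>2)"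
      then have "M \<in> U" using \<delta>1(2) by auto
      then show "norm (sym_grad F M - sym_grad F A0) < \<theta>"
        using \<delta>2(2)[of M] M by (simp add: dist_norm norm_minus_commute)
    qed (use \<delta>1 \<delta>2 in auto)
  qed
  have coeff_lower: "\<theta> * (norm x)\<^sup>2 \<le> x \<bullet> (sym_grad F M *v x)"
    and coeff_upper: "norm (sym_grad F M) \<le> \<Theta>"
    if M: "M \<in> sym_matrices \<inter> ball A0 \<delta>" for M x
  proof -
    have "\<bar>x \<bullet> ((sym_grad F M - sym_grad F A0) *v x)\<bar> \<le> norm (sym_grad F M - sym_grad F A0) * norm x * norm x"
      by (rule abs_quadratic_form_le)
    also have "\<dots> \<le> \<theta> * norm x * norm x"
      using \<delta>(3)[OF M] by (intro mult_right_mono) auto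
    finally have "\<bar>x \<bullet> (sym_grad F M *v x) - x \<bullet> (sym_grad F A0 *v x)\<bar> \<le> \<theta> * (norm x)\<^sup>2"
      by (simp add: matrix_vector_mult_diff_rdistrib inner_diff_right power2_eq_square mult.assoc)
    moreover have "2 * (\<theta> * (norm x)\<^sup>2) \<le> x \<bullet> (sym_grad F A0 *v x)"
      using \<theta>0(2)[of x] by (simp add: \<theta>_def)
    ultimately show "\<theta> * (norm x)\<^sup>2 \<le> x \<bullet> (sym_grad F M *v x)" by linarith
    show "norm (sym_grad F M) \<le> \<Theta>"
      using \<delta>(3)[OF M] norm_triangle_sub[of "sym_grad F M" "sym_grad F A0"] by (simp add: \<Theta>_def)
  qed

  obtain \<rho> where \<rho>: "\<rho> > 0" "\<rho> \<le> R / 2"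
    "\<And>y. y \<in> cball z R \<Longrightarrow> dist y x0 \<le> \<rho> \<Longrightarrow> ?Af y \<in> ball A0 \<delta> \<and> ?Ag y \<in> ball A0 \<delta>"
  proof -
    obtain \<rho>1 where \<rho>1: "\<rho>1 > 0" "\<And>y. y \<in> cball z R \<Longrightarrow> dist y x0 < \<rho>1 \<Longrightarrow> dist (?Af y) (?Af x0) < \<delta>"
      using solves_continuous(2)[OF f] x0 \<delta>(1) unfolding continuous_on_iff by blast
    obtain \<rho>2 where \<rho>2: "\<rho>2 > 0" "\<And>y. y \<in> cball z R \<Longrightarrow> dist y x0 < \<rho>2 \<Longrightarrow> dist (?Ag y) (?Ag x0) < \<delta>"
      using solves_continuous(2)[OF g] x0 \<delta>(1) unfolding continuous_on_iff by blast
    show thesis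
    proof (rule that[of "min (min \<rho>1 \<rho>2) R / 2"])
      fix y assume y: "y \<in> cball z R" "dist y x0 \<le> min (min \<rho>1 \<rho>2) R / 2"
      then have "dist y x0 < \<rho>1" "dist y x0 < \<rho>2" using \<rho>1 \<rho>2 R by auto
      then show "?Af y \<in> ball A0 \<delta> \<and> ?Ag y \<in> ball A0 \<delta>"
        using \<rho>1(2)[OF y(1)] \<rho>2(2)[OF y(1)] A_eq by (simp add: A0_def dist_commute)
    qed (use \<rho>1 \<rho>2 R in auto)
  qed
  define D where "D = cball z R \<inter> cball x0 \<rho>"
  have D: "compact D" "D \<subseteq> cball z R" "x0 \<in> D"
    using x0 \<rho> by (auto simp: D_def compact_Int)
  have D_far: "norm (y - z) \<ge> R / 2" if "y \<in> D" for y
    using that \<rho> R dist_triangle[of x0 z y] by (simp add: D_def dist_norm norm_minus_commute)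
  have D_ball: "?Af y \<in> sym_matrices \<inter> ball A0 \<delta>" "?Ag y \<in> sym_matrices \<inter> ball A0 \<delta>" if "y \<in> D" for y
    using that \<rho>(3)[of y] fj(3)[of y] gj(3)[of y] U_sym by (auto simp: D_def dist_commute)
  have contD: "continuous_on D f" "continuous_on D g" "continuous_on D Gf" "continuous_on D Hf"
    using f g D(2) solves_continuous(1)[OF f] solves_continuous(1)[OF g]
    by (auto simp: solves_def intro: continuous_on_subset)
  obtain m0 where m0: "m0 > 0" "\<And>y. y \<in> D \<Longrightarrow> m0 \<le> g y"
    using continuous_attains_inf[OF D(1) _ contD(2)] D gj(1) by blast
  have "bounded (Hf ` D)" "bounded (Gf ` D)"
    using contD D(1) by (auto intro!: compact_imp_bounded compact_continuous_image)
  then obtain K1 K2 where K: "K1 > 0" "K2 > 0" "\<And>y. y \<in> D \<Longrightarrow> norm (Hf y) \<le> K1" "\<And>y. y \<in> D \<Longrightarrow> norm (Gf y) \<le> K2"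
    unfolding bounded_pos by auto
  define T where "T = \<Theta> * norm (mat 1 :: real ^ 'n ^ 'n)"
  have \<Theta>: "\<Theta> \<ge> 0" using \<theta> by (simp add: \<Theta>_def)
  then have T: "T \<ge> 0" by (simp add: T_def)
  \<comment> \<open>\<open>C\<close> bounds all lower-order terms, relative to \<open>\<epsilon> exp (- \<alpha> |y - z|\<^sup>2)\<close>, by \<open>C \<alpha>\<close>;
    \<open>\<alpha>\<close> is chosen so that the second-order term \<open>m0 \<theta> R\<^sup>2 \<alpha>\<^sup>2\<close> exceeds it\<close>
  define C where "C = 2 * m0 * T + \<Theta> * K1 + (2 * K2 + 1) * R * T"
  have C: "C \<ge> 0" using m0 T \<Theta> K R by (simp add: C_def)
  define \<alpha> where "\<alpha> = 1 + (C + 1) / (m0 * \<theta> * R\<^sup>2)"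
  have mr: "m0 * \<theta> * R\<^sup>2 > 0" using m0 \<theta> R by simp
  have \<alpha>: "\<alpha> \<ge> 1" "\<alpha> * (m0 * \<theta> * R\<^sup>2) > C"
  proof -
    show "\<alpha> \<ge> 1" using C mr by (simp add: \<alpha>_def)
    have "(1 + (C + 1) / X) * X = X + (C + 1)" if "X > 0" for X using that unfolding distrib_right[of 1 "(C + 1) / X" X] by simp
    from this[OF mr] show "\<alpha> * (m0 * \<theta> * R\<^sup>2) > C" using mr by (simp add: \<alpha>_def)
  qed
  obtain w1 where w1: "w1 > 0" "\<And>y. y \<in> D \<Longrightarrow> dist y x0 = \<rho> \<Longrightarrow> w1 \<le> w y"
  proof (cases "D \<inter> sphere x0 \<rho> = {}")
    case True
    then show thesis using that[of 1] by (force simp: dist_commute)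
  next
    case False
    have "compact (D \<inter> sphere x0 \<rho>)" using D by (intro compact_Int) auto
    moreover have "continuous_on (D \<inter> sphere x0 \<rho>) w"
      unfolding w_def using contD by (intro continuous_intros) (auto intro: continuous_on_subset)
    ultimately obtain y1 where y1: "y1 \<in> D \<inter> sphere x0 \<rho>" "\<And>y. y \<in> D \<inter> sphere x0 \<rho> \<Longrightarrow> w y1 \<le> w y"
      using continuous_attains_inf[OF _ False] by blast
    have "w y1 > 0" using y1(1) \<rho> D by (intro w_pos) auto
    then show thesis using that[of "w y1"] y1(2) by (auto simp: dist_commute)
  qed
  \<comment> \<open>\<open>\<epsilon> \<le> w1\<close> settles the inner part of the boundary of \<open>D\<close>; the other bound gives \<open>|grad h| \<le> 1\<close>\<close>
  define \<epsilon> where "\<epsilon> = min w1 (1 / (2 * \<alpha> * R))"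
  have \<epsilon>: "\<epsilon> > 0" "\<epsilon> \<le> w1" "2 * \<alpha> * R * \<epsilon> \<le> 1"
    using w1 \<alpha> R mult_left_mono[of \<epsilon> "1 / (2 * \<alpha> * R)" "2 * \<alpha> * R"] by (auto simp: \<epsilon>_def)
  define E where "E = (\<lambda>y. exp (- \<alpha> * ((y - z) \<bullet> (y - z))))"
  define b where "b = exp (- \<alpha> * R\<^sup>2)"
  define h where "h = (\<lambda>y. \<epsilon> * (E y - b))"
  have E: "0 < E y" "E y \<le> 1" "E y \<ge> b" if "y \<in> cball z R" for y
  proof -
    have "norm (y - z) \<le> R" using that by (simp add: dist_norm norm_minus_commute)
    then have "(y - z) \<bullet> (y - z) \<le> R\<^sup>2" by (simp add: dot_square_norm power_mono)
    then show "0 < E y" "E y \<le> 1" "E y \<ge> b" using \<alpha> by (auto simp: E_def b_def)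
  qed
  have b: "b > 0" by (simp add: b_def)
  have hj: "jet2 h y ((- 2 * \<alpha> * (\<epsilon> * E y)) *\<^sub>R (y - z))
      ((\<epsilon> * E y) *\<^sub>R ((4 * \<alpha>\<^sup>2) *\<^sub>R outer_prod (y - z) (y - z) - (2 * \<alpha>) *\<^sub>R mat 1))" for y
    unfolding h_def E_def by (rule jet2_Hopf_barrier)
  have h_sphere: "h y = 0" if "dist y z = R" for y
    using that by (simp add: h_def E_def b_def dist_norm dot_square_norm)
  have h_le: "h y \<le> \<epsilon> * E y" for y using \<epsilon> b by (simp add: h_def)

  have w_ge_h: "h y \<le> w y" if "y \<in> D" for y
  proof -
    have "continuous_on D (\<lambda>y. w y - h y)"
      unfolding w_def h_def E_def using contD by (intro continuous_intros) auto
    then obtain y1 where y1: "y1 \<in> D" "\<And>y. y \<in> D \<Longrightarrow> w y1 - h y1 \<le> w y - h y"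
      using continuous_attains_inf[OF D(1)] D(3) by blast
    have y1R: "y1 \<in> cball z R" using y1(1) D by auto
    have "w y1 - h y1 \<ge> 0"
    proof (rule ccontr)
      assume neg: "\<not> w y1 - h y1 \<ge> 0"
      define e where "e = \<epsilon> * E y1"
      have e: "e > 0" "e \<le> \<epsilon>"
        using E[OF y1R] \<epsilon> by (auto simp: e_def mult_left_le)
      have "dist y1 z \<noteq> R" using h_sphere[of y1] w_nonneg[OF y1R] neg by auto
      then have in1: "y1 \<in> ball z R" using y1R by (simp add: dist_commute)
      have "dist y1 x0 \<noteq> \<rho>" using w1(2)[OF y1(1)] \<epsilon> h_le[of y1] e neg by (auto simp: e_def)
      then have in2: "y1 \<in> ball x0 \<rho>" using y1(1) by (auto simp: D_def dist_commute)
      have "eventually (\<lambda>y. y \<in> ball z R \<inter> ball x0 \<rho>) (nhds y1)"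
        using in1 in2 by (intro eventually_nhds_in_open) auto
      then have "eventually (\<lambda>y. w y1 - h y1 \<le> w y - h y) (nhds y1)"
        by eventually_elim (rule y1(2), auto simp: D_def)
      note min = jet2_local_min[OF jet2_diff[OF wj[OF y1R] hj] this]
      define p where "p = (- 2 * \<alpha> * e) *\<^sub>R (y1 - z)"
      define K where "K = e *\<^sub>R ((4 * \<alpha>\<^sup>2) *\<^sub>R outer_prod (y1 - z) (y1 - z) - (2 * \<alpha>) *\<^sub>R mat 1)"
      define Q where "Q = Hg y1 - Hf y1 - K"
      have Gg: "Gg y1 = Gf y1 + p"
        using min(1) by (simp add: p_def e_def algebra_simps)
      have Q: "psd Q" using min(2) by (simp add: Q_def K_def e_def)
      have Hg: "Hg y1 = Hf y1 + K + Q" by (simp add: Q_def)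
      have seg: "closed_segment (?Af y1) (?Ag y1) \<subseteq> sym_matrices \<inter> ball A0 \<delta>"
        using D_ball[OF y1(1)] by (intro closed_segment_subset convex_sym_ball)
      then obtain M where M: "M \<in> sym_matrices \<inter> ball A0 \<delta>"
        "F (?Ag y1) - F (?Af y1) = sym_grad F M \<bullet> (?Ag y1 - ?Af y1)"
        using F_mean_value[of "?Af y1" "?Ag y1"] \<delta>(2) by blast
      define a where "a = sym_grad F M"
      have a: "norm a \<le> \<Theta>" "pos_def a" "\<And>x. \<theta> * (norm x)\<^sup>2 \<le> x \<bullet> (a *v x)"
        using coeff_upper[OF M(1)] coeff_lower[OF M(1)] F_elliptic M(1) \<delta>(2) by (auto simp: a_def)
      have a_le: "\<bar>a \<bullet> X\<bar> \<le> \<Theta> * norm X" for X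
        using Cauchy_Schwarz_ineq2[of a X] mult_right_mono[OF a(1), of "norm X"] by simp
      have tr_a: "\<bar>a \<bullet> mat 1\<bar> \<le> T" unfolding T_def by (rule a_le)
      have aQ: "a \<bullet> Q \<ge> 0"
        using pos_def_inner_psd_pos[OF a(2) Q] by (cases "Q = 0") auto
      have "0 = a \<bullet> (?Ag y1 - ?Af y1)"
        using M(2) fj(4)[OF y1R] gj(4)[OF y1R] by (simp add: a_def)
      also have "\<dots> = g y1 * (a \<bullet> K) + g y1 * (a \<bullet> Q) + (g y1 - f y1) * (a \<bullet> Hf y1)
          - ((2 * (Gf y1 \<bullet> p) + p \<bullet> p) / 2) * (a \<bullet> mat 1)"
        unfolding Gg Hg conf_mat_diff by (simp add: inner_add_right inner_diff_right)
      finally have zero: "0 = g y1 * (a \<bullet> K) + g y1 * (a \<bullet> Q) + (g y1 - f y1) * (a \<bullet> Hf y1)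
          - ((2 * (Gf y1 \<bullet> p) + p \<bullet> p) / 2) * (a \<bullet> mat 1)" .
      have gy: "g y1 \<ge> m0" "g y1 > 0" using m0(1) m0(2)[OF y1(1)] by auto

      have "(R / 2)\<^sup>2 \<le> (norm (y1 - z))\<^sup>2" using D_far[OF y1(1)] R by (intro power_mono) auto
      then have "\<theta> * (R\<^sup>2 / 4) \<le> (y1 - z) \<bullet> (a *v (y1 - z))"
      proof -
        assume le: "(R / 2)\<^sup>2 \<le> (norm (y1 - z))\<^sup>2"
        have "\<theta> * (R\<^sup>2 / 4) = \<theta> * (R / 2)\<^sup>2" by (simp add: power_divide)
        also have "\<dots> \<le> \<theta> * (norm (y1 - z))\<^sup>2" using le \<theta> by (intro mult_left_mono) auto
        also have "\<dots> \<le> (y1 - z) \<bullet> (a *v (y1 - z))" by (rule a(3))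
        finally show ?thesis .
      qed
      then have "4 * \<alpha>\<^sup>2 * (\<theta> * (R\<^sup>2 / 4)) - 2 * \<alpha> * T \<le> 4 * \<alpha>\<^sup>2 * ((y1 - z) \<bullet> (a *v (y1 - z))) - 2 * \<alpha> * (a \<bullet> mat 1)"
        using \<alpha> tr_a by (intro diff_mono mult_left_mono) auto
      then have aK: "e * (\<alpha>\<^sup>2 * \<theta> * R\<^sup>2 - 2 * \<alpha> * T) \<le> a \<bullet> K"
        using e(1) by (simp add: K_def inner_diff_right inner_outer_prod mult.assoc)
      have q: "\<alpha>\<^sup>2 * \<theta> * R\<^sup>2 - 2 * \<alpha> * T \<ge> 0"
      proof -
        have "\<Theta> * K1 \<ge> 0" "(2 * K2 + 1) * R * T \<ge> 0" using \<Theta> K R T by auto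
        then have "m0 * (2 * T) \<le> m0 * (\<alpha> * \<theta> * R\<^sup>2)"
          using \<alpha>(2) unfolding C_def by (simp add: mult_ac)
        then have "2 * T \<le> \<alpha> * \<theta> * R\<^sup>2" using m0(1) by simp
        then have "\<alpha> * (2 * T) \<le> \<alpha> * (\<alpha> * \<theta> * R\<^sup>2)" using \<alpha>(1) by (intro mult_left_mono) auto
        then show ?thesis by (simp add: power2_eq_square mult_ac)
      qed
      have t1: "e * (m0 * (\<alpha>\<^sup>2 * \<theta> * R\<^sup>2 - 2 * \<alpha> * T)) \<le> g y1 * (a \<bullet> K)"
      proof -
        have "m0 * (e * (\<alpha>\<^sup>2 * \<theta> * R\<^sup>2 - 2 * \<alpha> * T)) \<le> g y1 * (e * (\<alpha>\<^sup>2 * \<theta> * R\<^sup>2 - 2 * \<alpha> * T))"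
          using gy(1) q e(1) by (intro mult_right_mono) auto
        also have "\<dots> \<le> g y1 * (a \<bullet> K)" using aK gy by (intro mult_left_mono) auto
        finally show ?thesis by (simp add: mult_ac)
      qed
      have t2: "- (e * (\<Theta> * K1)) \<le> (g y1 - f y1) * (a \<bullet> Hf y1)"
      proof -
        have d: "0 \<le> g y1 - f y1" "g y1 - f y1 \<le> e"
          using w_nonneg[OF y1R] neg h_le[of y1] by (auto simp: w_def e_def)
        have "\<bar>a \<bullet> Hf y1\<bar> \<le> \<Theta> * K1"
          using a_le[of "Hf y1"] K(3)[OF y1(1)] \<Theta> by (meson mult_left_mono order_trans)
        then have "\<bar>(g y1 - f y1) * (a \<bullet> Hf y1)\<bar> \<le> e * (\<Theta> * K1)"
          unfolding abs_mult using d e by (intro mult_mono) auto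
        then show ?thesis by linarith
      qed
      have t3: "((2 * (Gf y1 \<bullet> p) + p \<bullet> p) / 2) * (a \<bullet> mat 1) \<le> e * ((2 * K2 + 1) * (\<alpha> * R) * T)"
      proof -
        have "norm (y1 - z) \<le> R" using y1R by (simp add: dist_norm norm_minus_commute)
        then have p: "norm p \<le> 2 * \<alpha> * e * R"
          using \<alpha> e by (simp add: p_def abs_mult)
        also have "\<dots> \<le> 2 * \<alpha> * R * \<epsilon>" using \<alpha> e R by (simp add: mult_ac mult_left_mono)
        finally have p1: "norm p \<le> 1" using \<epsilon>(3) by simp
        have "\<bar>Gf y1 \<bullet> p\<bar> \<le> K2 * norm p"
          using Cauchy_Schwarz_ineq2[of "Gf y1" p] mult_right_mono[OF K(4)[OF y1(1)], of "norm p"] by simp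
        moreover have "p \<bullet> p \<le> norm p" using p1 by (simp add: dot_square_norm power2_eq_square mult_left_le)
        ultimately have "\<bar>2 * (Gf y1 \<bullet> p) + p \<bullet> p\<bar> \<le> (2 * K2 + 1) * norm p"
          using inner_ge_zero[of p] unfolding distrib_right by linarith
        also have "\<dots> \<le> (2 * K2 + 1) * (2 * \<alpha> * e * R)" using p K by (intro mult_left_mono) auto
        finally have "\<bar>(2 * (Gf y1 \<bullet> p) + p \<bullet> p) / 2\<bar> \<le> (2 * K2 + 1) * (\<alpha> * e * R)" by simp
        then have "\<bar>((2 * (Gf y1 \<bullet> p) + p \<bullet> p) / 2) * (a \<bullet> mat 1)\<bar> \<le> ((2 * K2 + 1) * (\<alpha> * e * R)) * T"
          unfolding abs_mult using tr_a T by (intro mult_mono) auto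
        then have "((2 * (Gf y1 \<bullet> p) + p \<bullet> p) / 2) * (a \<bullet> mat 1) \<le> ((2 * K2 + 1) * (\<alpha> * e * R)) * T"
          by linarith
        then show ?thesis by (simp add: mult_ac)
      qed
      have "e * (m0 * (\<alpha>\<^sup>2 * \<theta> * R\<^sup>2 - 2 * \<alpha> * T) - \<Theta> * K1 - (2 * K2 + 1) * (\<alpha> * R) * T) \<le> 0"
        using zero t1 t2 t3 mult_nonneg_nonneg[of "g y1" "a \<bullet> Q"] gy(2) aQ
        unfolding right_diff_distrib[of e] by linarith
      then have "m0 * (\<alpha>\<^sup>2 * \<theta> * R\<^sup>2 - 2 * \<alpha> * T) - \<Theta> * K1 - (2 * K2 + 1) * (\<alpha> * R) * T \<le> 0"
        using e(1) by (simp add: mult_le_0_iff)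
      moreover have "m0 * (\<alpha>\<^sup>2 * \<theta> * R\<^sup>2 - 2 * \<alpha> * T) - \<Theta> * K1 - (2 * K2 + 1) * (\<alpha> * R) * T
          = \<alpha> * (\<alpha> * (m0 * \<theta> * R\<^sup>2) - C) + (\<alpha> - 1) * (\<Theta> * K1)"
        by (simp add: C_def power2_eq_square algebra_simps)
      moreover have "\<alpha> * (\<alpha> * (m0 * \<theta> * R\<^sup>2) - C) > 0" using \<alpha> by simp
      moreover have "(\<alpha> - 1) * (\<Theta> * K1) \<ge> 0" using \<alpha> \<Theta> K by simp
      ultimately show False by linarith
    qed
    then show ?thesis using y1(2)[OF that] by linarith
  qed

  have "0 \<le> (Gg x0 - Gf x0 - (- 2 * \<alpha> * (\<epsilon> * E x0)) *\<^sub>R (x0 - z)) \<bullet> (z - x0)"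
  proof (rule has_derivative_one_sided_min)
    show "((\<lambda>y. w y - h y) has_derivative (\<lambda>k. (Gg x0 - Gf x0 - (- 2 * \<alpha> * (\<epsilon> * E x0)) *\<^sub>R (x0 - z)) \<bullet> k)) (at x0)"
      by (rule jet2_has_derivative[OF jet2_diff[OF wj[OF x0] hj]])
    have "x0 + t *\<^sub>R (z - x0) \<in> D" if t: "0 < t" "t < \<rho> / R" for t
    proof -
      have "t < 1" using t \<rho> R by (smt (verit) divide_le_eq_1 field_sum_of_halves)
      have "dist z (x0 + t *\<^sub>R (z - x0)) = (1 - t) * R"
      proof -
        have "z - (x0 + t *\<^sub>R (z - x0)) = (1 - t) *\<^sub>R (z - x0)" by (simp add: algebra_simps)
        then show ?thesis using R \<open>t < 1\<close> by (simp add: dist_norm norm_minus_commute)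
      qed
      moreover have "dist x0 (x0 + t *\<^sub>R (z - x0)) = t * R"
        using t R by (simp add: dist_norm norm_minus_commute)
      moreover have "(1 - t) * R \<le> R" using t \<open>t < 1\<close> R by (simp add: mult_left_le_one_le)
      moreover have "t * R \<le> \<rho>" using t R by (simp add: field_simps)
      ultimately show ?thesis by (simp add: D_def)
    qed
    then show "eventually (\<lambda>t. w x0 - h x0 \<le> w (x0 + t *\<^sub>R (z - x0)) - h (x0 + t *\<^sub>R (z - x0))) (at_right 0)"
      unfolding eventually_at_right_field using w_ge_h w0 h_sphere[OF R(2)] \<rho> R
      by (intro exI[of _ "\<rho> / R"]) auto
  qed
  also have "\<dots> = - 2 * \<alpha> * (\<epsilon> * E x0) * R\<^sup>2"
  proof -
    have zz: "(z - x0) \<bullet> (z - x0) = R\<^sup>2"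
      using R by (simp add: dist_norm dot_square_norm norm_minus_commute)
    have "(0 - c *\<^sub>R (x0 - z)) \<bullet> (z - x0) = c * ((z - x0) \<bullet> (z - x0))" for c
      by (simp add: inner_diff_left inner_diff_right algebra_simps)
    then show ?thesis by (simp only: Geq diff_self zz)
  qed
  also have "\<dots> < 0" using \<alpha> \<epsilon> E[OF x0] R by simp
  finally show False by simp
qed

end

section \<open>Growth at infinity\<close>

definition inversion :: "real ^ 'n \<Rightarrow> real \<Rightarrow> real ^ 'n \<Rightarrow> real ^ 'n" where
  "inversion x l y = x + (l\<^sup>2 / ((y - x) \<bullet> (y - x))) *\<^sub>R (y - x)"

lemma kelvin_inversion: "kelvin x l f y = ((y - x) \<bullet> (y - x)) / l\<^sup>2 * f (inversion x l y)"
  by (simp add: kelvin_def inversion_def)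

lemma norm_inversion: "norm (inversion x l y - x) = l\<^sup>2 / norm (y - x)"
  by (simp add: inversion_def dot_square_norm power2_eq_square)

lemma inversion_sphere: "norm (y - x) = l \<Longrightarrow> l > 0 \<Longrightarrow> inversion x l y = y"
  by (simp add: inversion_def dot_square_norm)

lemma inversion_neq: "y \<noteq> x \<Longrightarrow> l > 0 \<Longrightarrow> inversion x l y \<noteq> x"
  by (simp add: inversion_def)

lemma inversion_0_1: "inversion 0 1 y = (1 / (y \<bullet> y)) *\<^sub>R y"
  by (simp add: inversion_def)

lemma inversion_0_1_twice: "y \<noteq> 0 \<Longrightarrow> inversion 0 1 (inversion 0 1 y) = y"
  by (simp add: inversion_0_1)

lemma norm_inversion_0_1: "norm (inversion 0 1 y) = 1 / norm y"
  using norm_inversion[of 0 1 y] by simp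

lemma tendsto_inversion_at_infinity: "(inversion x l \<longlongrightarrow> x) at_infinity"
proof (rule tendstoI)
  fix e :: real assume e: "e > 0"
  have "dist (inversion x l y) x < e" if "norm y \<ge> norm x + l\<^sup>2 / e + 1" for y
  proof -
    have "norm (y - x) > l\<^sup>2 / e" using that norm_triangle_ineq2[of y x] by simp
    moreover have "l\<^sup>2 / e \<ge> 0" using e by simp
    ultimately have "norm (y - x) > l\<^sup>2 / e" "norm (y - x) > 0" by linarith+
    then have "l\<^sup>2 / norm (y - x) < e" using e by (simp add: field_simps)
    then show ?thesis by (simp add: dist_norm norm_inversion)
  qed
  then show "eventually (\<lambda>y. dist (inversion x l y) x < e) at_infinity"
    unfolding eventually_at_infinity by blast
qed

lemma eventually_norm_shift_le:
  fixes x y :: "'a :: real_normed_vector"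
  assumes c: "c > 1"
  shows "eventually (\<lambda>z :: 'a. norm (z - x) \<le> c * norm (z - y)) at_infinity"
proof -
  have "norm (z - x) \<le> c * norm (z - y)" if z: "norm z \<ge> norm y + norm (y - x) / (c - 1)" for z
  proof -
    have "norm (y - x) / (c - 1) \<le> norm (z - y)" using z norm_triangle_ineq2[of z y] by simp
    then have "norm (y - x) \<le> (c - 1) * norm (z - y)" using c by (simp add: field_simps)
    moreover have "norm (z - x) \<le> norm (z - y) + norm (y - x)"
      using norm_triangle_ineq[of "z - y" "y - x"] by simp
    ultimately show ?thesis by (simp add: algebra_simps)
  qed
  then show ?thesis unfolding eventually_at_infinity by blast
qed

lemma powr_neg_le_iff:
  fixes a b q :: real
  assumes "a > 0" "b > 0" "q < 0"
  shows "a powr q \<le> b powr q \<longleftrightarrow> b \<le> a"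
  using assms powr_less_mono2_neg[of q a b] powr_less_mono2_neg[of q b a]
  by (cases a b rule: linorder_cases) auto

lemma pointwise_le_near_at_infinity:
  fixes f :: "real ^ 'n \<Rightarrow> real"
  assumes b: "0 < b" "b < c"
    and f: "eventually (\<lambda>y. f y \<le> b * (norm (y - x))\<^sup>2) at_infinity"
  shows "eventually (\<lambda>y. f y \<le> c * (norm (y - x'))\<^sup>2) at_infinity"
proof -
  have s: "sqrt (c / b) > 1" using b by simp
  from eventually_norm_shift_le[OF s, of x x'] f show ?thesis
  proof eventually_elim
    case (elim y)
    have "(norm (y - x))\<^sup>2 \<le> (sqrt (c / b) * norm (y - x'))\<^sup>2"
      using elim(1) by (intro power_mono) auto
    also have "\<dots> = c / b * (norm (y - x'))\<^sup>2" using b by (simp add: power_mult_distrib)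
    finally have "b * (norm (y - x))\<^sup>2 \<le> b * (c / b * (norm (y - x'))\<^sup>2)"
      using b by (intro mult_left_mono) auto
    then show ?case using elim(2) b by simp
  qed
qed

text \<open>
  The hypothesis on the trace is superharmonicity of \<open>u\<close> in terms of \<open>f\<close>.
\<close>

locale entire_solution = elliptic_equation U F
  for U :: "(real ^ 'n ^ 'n) set" and F :: "real ^ 'n ^ 'n \<Rightarrow> real" +
  fixes f :: "real ^ 'n \<Rightarrow> real" and G :: "real ^ 'n \<Rightarrow> real ^ 'n" and H :: "real ^ 'n \<Rightarrow> real ^ 'n ^ 'n"
  assumes dim: "CARD('n) \<ge> 3"
    and sol: "solves UNIV f G H"
    and trace_nonneg: "\<And>x. trace (conf_mat (f x) (G x) (H x)) \<ge> 0"
begin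

abbreviation "KG x l y \<equiv> kelvin_grad l (y - x) (f (inversion x l y)) (G (inversion x l y))"
abbreviation "KH x l y \<equiv> kelvin_hess l (y - x) (f (inversion x l y)) (G (inversion x l y)) (H (inversion x l y))"

lemma f_pos: "f x > 0" and f_jet: "jet2 f x (G x) (H x)"
  and G_cont: "continuous_on UNIV G" and H_cont: "continuous_on UNIV H"
  using sol by (auto simp: solves_def)

lemma f_deriv: "(f has_derivative (\<lambda>h. G x \<bullet> h)) (at x)"
  by (rule jet2_has_derivative[OF f_jet])

lemma f_cont: "continuous_on S f"
  by (intro continuous_at_imp_continuous_on ballI jet2_isCont[OF f_jet])

lemma inversion_cont: "continuous_on (- {x}) (inversion x l)"
  unfolding inversion_def by (intro continuous_intros) auto

lemma kelvin_cont: "continuous_on (- {x}) (kelvin x l f)"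
  unfolding kelvin_inversion divide_inverse
  by (intro continuous_intros continuous_on_compose2[OF f_cont inversion_cont]) auto

lemma kelvin_jet: "l > 0 \<Longrightarrow> y \<noteq> x \<Longrightarrow> jet2 (kelvin x l f) y (KG x l y) (KH x l y)"
  using jet2_kelvin[OF _ _ f_jet] by (simp add: inversion_def)

lemma kelvin_conf_mat:
  assumes "l > 0" "y \<noteq> x"
  shows "conf_mat (kelvin x l f y) (KG x l y) (KH x l y) = reflection (y - x) **
    conf_mat (f (inversion x l y)) (G (inversion x l y)) (H (inversion x l y)) ** reflection (y - x)"
  using conf_mat_kelvin[of "y - x" l] assms by (simp add: kelvin_inversion)

lemma kelvin_pos: "l > 0 \<Longrightarrow> y \<noteq> x \<Longrightarrow> kelvin x l f y > 0"
  using f_pos by (simp add: kelvin_inversion)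

lemma kelvin_trace:
  assumes "l > 0" "y \<noteq> x"
  shows "trace (conf_mat (kelvin x l f y) (KG x l y) (KH x l y)) \<ge> 0"
proof -
  have "trace (reflection (y - x) ** A ** reflection (y - x)) = trace A" for A
    using assms trace_mul_sym[of "reflection (y - x) ** A" "reflection (y - x)"]
    by (simp add: matrix_mul_assoc refl_involution)
  then show ?thesis using trace_nonneg by (simp add: kelvin_conf_mat[OF assms])
qed

lemma kelvin_solves:
  assumes l: "l > 0"
  shows "solves (- {x}) (kelvin x l f) (KG x l) (KH x l)"
  unfolding solves_def
proof (intro conjI ballI)
  have c: "continuous_on (- {x}) (\<lambda>y. f (inversion x l y))"
    "continuous_on (- {x}) (\<lambda>y. G (inversion x l y))" "continuous_on (- {x}) (\<lambda>y. H (inversion x l y))"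
    using continuous_on_compose2[OF f_cont[of UNIV] inversion_cont]
      continuous_on_compose2[OF G_cont inversion_cont] continuous_on_compose2[OF H_cont inversion_cont]
    by auto
  have r: "continuous_on (- {x}) (\<lambda>y. reflection (y - x))"
    unfolding reflection_def outer_prod_def by (intro continuous_intros) auto
  have mv: "continuous_on S (\<lambda>y. A y *v b y)" if "continuous_on S A" "continuous_on S b"
    for S :: "(real ^ 'n) set" and A :: "_ \<Rightarrow> real ^ 'n ^ 'n" and b :: "_ \<Rightarrow> real ^ 'n"
    unfolding matrix_vector_mult_def using that by (intro continuous_intros)
  have mm: "continuous_on S (\<lambda>y. A y ** B y)" if "continuous_on S A" "continuous_on S B"
    for S :: "(real ^ 'n) set" and A B :: "_ \<Rightarrow> real ^ 'n ^ 'n"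
    unfolding matrix_matrix_mult_def using that by (intro continuous_intros)
  show "continuous_on (- {x}) (KG x l)"
    unfolding kelvin_grad_def divide_inverse by (intro continuous_intros mv c r)
  show "continuous_on (- {x}) (KH x l)"
    unfolding kelvin_hess_def by (intro continuous_intros mm c r) (use l in auto)
  fix y assume "y \<in> - {x}"
  then have y: "y \<noteq> x" by simp
  show "kelvin x l f y > 0" by (rule kelvin_pos[OF l y])
  show "jet2 (kelvin x l f) y (KG x l y) (KH x l y)" by (rule kelvin_jet[OF l y])
  define R where "R = reflection (y - x)"
  have R: "orthogonal_matrix R" "matrix_inv R = R"
    using y by (auto simp: R_def refl_orthogonal matrix_inv_refl)
  define A where "A = conf_mat (f (inversion x l y)) (G (inversion x l y)) (H (inversion x l y))"
  have A: "A \<in> U" "F A = 1" using sol by (auto simp: solves_def A_def)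
  have "R ** A ** R \<in> U" using U_inv[OF R(1)] A(1) by (auto simp: R(2))
  moreover have "F (R ** A ** R) = 1" using F_inv[OF A(1) R(1)] A(2) by (simp add: R(2))
  ultimately show "conf_mat (kelvin x l f y) (KG x l y) (KH x l y) \<in> U"
    "F (conf_mat (kelvin x l f y) (KG x l y) (KH x l y)) = 1"
    by (simp_all add: kelvin_conf_mat[OF l y] R_def A_def)
qed

text \<open>
  The exponent that turns \<open>f\<close> back into the superharmonic function \<open>u = f powr sup_exp\<close>.
\<close>

definition sup_exp :: real where "sup_exp = - ((real CARD('n) - 2) / 2)"

lemma sup_exp_neg: "sup_exp < 0"
  using dim by (simp add: sup_exp_def)

lemma kelvin_superharmonic:
  assumes "z \<noteq> 0"
  shows "\<exists>g H. jet2 (\<lambda>z. kelvin 0 1 f z powr sup_exp) z g H \<and> trace H \<le> 0"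
  unfolding sup_exp_def
  by (rule superharmonic_powr[OF kelvin_jet kelvin_pos dim kelvin_trace]) (use assms in auto)

lemma kelvin_0_1: "kelvin 0 1 f z = (z \<bullet> z) * f (inversion 0 1 z)"
  by (simp add: kelvin_inversion)

lemma kelvin_0_1_inversion: "y \<noteq> 0 \<Longrightarrow> kelvin 0 1 f (inversion 0 1 y) = f y / (norm y)\<^sup>2"
  by (simp add: kelvin_0_1 inversion_0_1_twice dot_square_norm norm_inversion_0_1 power_divide)

text \<open>
  The Kelvin transform of \<open>u\<close> with respect to the unit sphere is positive and superharmonic in the
  punctured unit ball, hence bounded below by its minimum on the sphere.  For \<open>f\<close>, a negative power
  of \<open>u\<close>, this is an upper bound.
\<close>

lemma quadratic_growth:
  obtains C where "C > 0" "\<And>y. norm y \<ge> 1 \<Longrightarrow> f y \<le> C * (norm y)\<^sup>2"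
proof -
  define w where "w = (\<lambda>z. kelvin 0 1 f z powr sup_exp)"
  have w_pos: "w z > 0" if "z \<noteq> 0" for z using kelvin_pos[of 1 z 0] that by (simp add: w_def)
  have w_cont: "isCont w z" if "z \<noteq> 0" for z
    using kelvin_superharmonic[OF that] jet2_isCont unfolding w_def by blast
  have "axis undefined 1 \<in> sphere (0 :: real ^ 'n) 1" by (simp add: norm_axis_1)
  then have "sphere (0 :: real ^ 'n) 1 \<noteq> {}" by blast
  moreover have "continuous_on (sphere 0 1) w"
    by (intro continuous_at_imp_continuous_on ballI w_cont) auto
  ultimately obtain z1 where z1: "z1 \<in> sphere 0 1" "\<And>z. z \<in> sphere 0 1 \<Longrightarrow> w z1 \<le> w z"
    using continuous_attains_inf[OF compact_sphere] by blast
  have c: "w z1 > 0" using z1(1) by (intro w_pos) auto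
  have ge: "w z1 \<le> w z" if "0 < norm z" "norm z \<le> 1" for z
  proof (rule superharmonic_punctured_ball_comparison[OF dim zero_less_one _ _ _ _ _ _ that, of w "\<lambda>_. w z1"])
    show "\<exists>g H. jet2 w z g H \<and> trace H \<le> 0" if "0 < norm z" for z
      using kelvin_superharmonic that unfolding w_def by auto
    show "\<exists>g H. jet2 (\<lambda>_. w z1) z g H \<and> trace H \<ge> 0" for z
      using jet2_const[of "w z1" z] by (intro exI[of _ 0]) (simp add: trace_def)
  qed (use w_cont w_pos z1 in auto)
  show thesis
  proof (rule that)
    show "w z1 powr (1 / sup_exp) > 0" using c by simp
    fix y :: "real ^ 'n" assume y: "norm y \<ge> 1"
    then have y0: "y \<noteq> 0" by auto
    define z where "z = inversion 0 1 y"
    have z: "0 < norm z" "norm z \<le> 1" using y y0 by (auto simp: z_def norm_inversion_0_1)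
    have k: "kelvin 0 1 f z > 0" using z by (intro kelvin_pos) auto
    have "(w z1 powr (1 / sup_exp)) powr sup_exp = w z1" using c sup_exp_neg by (simp add: powr_powr)
    then have "(w z1 powr (1 / sup_exp)) powr sup_exp \<le> kelvin 0 1 f z powr sup_exp"
      using ge[OF z] unfolding w_def by metis
    then have "kelvin 0 1 f z \<le> w z1 powr (1 / sup_exp)"
      using powr_neg_le_iff[of "w z1 powr (1 / sup_exp)" "kelvin 0 1 f z" sup_exp] c k sup_exp_neg by simp
    then show "f y \<le> w z1 powr (1 / sup_exp) * (norm y)\<^sup>2"
      using y0 by (simp add: z_def kelvin_0_1_inversion field_simps)
  qed
qed

lemma quadratic_growth_from:
  assumes r: "r > 0"
  obtains C where "C > 0" "\<And>y. norm (y - x) \<ge> r \<Longrightarrow> f y \<le> C * (norm (y - x))\<^sup>2"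
proof -
  obtain C where C: "C > 0" "\<And>y. norm y \<ge> 1 \<Longrightarrow> f y \<le> C * (norm y)\<^sup>2" using quadratic_growth by blast
  have "cball (0 :: real ^ 'n) 1 \<noteq> {}" by simp
  then obtain y0 where y0: "\<And>y. norm y \<le> 1 \<Longrightarrow> f y \<le> f y0"
    using continuous_attains_sup[OF compact_cball _ f_cont] by (metis mem_cball_0)
  show thesis
  proof (rule that)
    show "C * (1 + norm x / r)\<^sup>2 + f y0 / r\<^sup>2 > 0" using C r f_pos[of y0] by (intro add_nonneg_pos) auto
    fix y assume y: "norm (y - x) \<ge> r"
    have t1: "C * (norm y)\<^sup>2 \<le> C * (1 + norm x / r)\<^sup>2 * (norm (y - x))\<^sup>2"
    proof -
      have "norm x \<le> norm x / r * norm (y - x)"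
        using y r mult_left_mono[of 1 "norm (y - x) / r" "norm x"] by simp
      then have "norm y \<le> (1 + norm x / r) * norm (y - x)"
        using norm_triangle_sub[of y x] by (simp add: distrib_right)
      then have "(norm y)\<^sup>2 \<le> ((1 + norm x / r) * norm (y - x))\<^sup>2" by (intro power_mono) auto
      then show ?thesis using C by (simp add: power_mult_distrib mult.assoc)
    qed
    have "1 \<le> (norm (y - x) / r)\<^sup>2" using y r by (simp add: one_le_power)
    then have t2: "f y0 \<le> f y0 / r\<^sup>2 * (norm (y - x))\<^sup>2"
      using mult_left_mono[of 1 "(norm (y - x) / r)\<^sup>2" "f y0"] f_pos[of y0] by (simp add: power_divide)
    have "f y \<le> C * (norm y)\<^sup>2 + f y0"
    proof (cases "norm y \<ge> 1")
      case True
      then show ?thesis using C(2)[of y] f_pos[of y0] by simp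
    next
      case False
      then have "f y \<le> f y0" by (intro y0) simp
      moreover have "C * (norm y)\<^sup>2 \<ge> 0" using C by simp
      ultimately show ?thesis by linarith
    qed
    then show "f y \<le> (C * (1 + norm x / r)\<^sup>2 + f y0 / r\<^sup>2) * (norm (y - x))\<^sup>2"
      using t1 t2 by (simp only: distrib_right)
  qed
qed

definition growth_rates :: "real set" where
  "growth_rates = {b. eventually (\<lambda>y. f y \<le> b * (norm y)\<^sup>2) at_infinity}"

text \<open>
  The limes superior of \<open>f y / |y|\<^sup>2\<close> at infinity.
\<close>

definition \<beta> :: real where "\<beta> = Inf growth_rates"

lemma growth_rates_nonneg:
  assumes "b \<in> growth_rates" shows "b \<ge> 0"
proof (rule ccontr)
  assume b: "\<not> b \<ge> 0"
  have "eventually (\<lambda>y :: real ^ 'n. False) at_infinity"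
    using assms unfolding growth_rates_def mem_Collect_eq
  proof eventually_elim
    case (elim y)
    have "b * (norm y)\<^sup>2 \<le> 0" using b by (simp add: mult_nonpos_nonneg)
    then show ?case using elim f_pos[of y] by linarith
  qed
  then show False by (simp add: trivial_limit_at_infinity)
qed

lemma growth_rates_bdd: "bdd_below growth_rates"
  using growth_rates_nonneg by (intro bdd_belowI)

lemma growth_rates_nonempty: "growth_rates \<noteq> {}"
proof -
  obtain C where "C > 0" "\<And>y. norm y \<ge> 1 \<Longrightarrow> f y \<le> C * (norm y)\<^sup>2" using quadratic_growth by blast
  then have "C \<in> growth_rates" by (auto simp: growth_rates_def eventually_at_infinity)
  then show ?thesis by blast
qed

lemma \<beta>_nonneg: "\<beta> \<ge> 0"
  unfolding \<beta>_def using growth_rates_nonempty growth_rates_nonneg by (rule cInf_greatest)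

lemma \<beta>_le: "b \<in> growth_rates \<Longrightarrow> \<beta> \<le> b"
  unfolding \<beta>_def by (rule cInf_lower[OF _ growth_rates_bdd])

lemma \<beta>_upper:
  assumes b: "b > \<beta>"
  shows "eventually (\<lambda>y. f y \<le> b * (norm (y - x))\<^sup>2) at_infinity"
proof -
  define b' where "b' = (\<beta> + b) / 2"
  have b': "0 < b'" "b' < b" "\<beta> < b'" using b \<beta>_nonneg by (auto simp: b'_def)
  obtain b0 where b0: "b0 \<in> growth_rates" "b0 < b'"
    using b'(3) growth_rates_nonempty unfolding \<beta>_def by (meson cInf_lessD)
  have "eventually (\<lambda>y. f y \<le> b' * (norm (y - 0))\<^sup>2) at_infinity"
    using b0(1) unfolding growth_rates_def mem_Collect_eq
  proof eventually_elim
    case (elim y)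
    have "b0 * (norm y)\<^sup>2 \<le> b' * (norm y)\<^sup>2" using b0(2) by (intro mult_right_mono) auto
    then show ?case using elim by simp
  qed
  then show ?thesis by (rule pointwise_le_near_at_infinity[OF b'(1,2)])
qed

text \<open>
  The Kelvin transform of \<open>u\<close> lies below \<open>u\<close> outside the sphere; the inequality is reversed for
  \<open>f\<close>.
\<close>

definition dominated :: "real ^ 'n \<Rightarrow> real \<Rightarrow> bool" where
  "dominated x l \<longleftrightarrow> (\<forall>y. norm (y - x) \<ge> l \<longrightarrow> f y \<le> kelvin x l f y)"

lemma tendsto_f_inversion: "((\<lambda>y. f (inversion x l y)) \<longlongrightarrow> f x) at_infinity"
  using isCont_tendsto_compose[OF jet2_isCont[OF f_jet] tendsto_inversion_at_infinity] .

lemma \<beta>_le_dominated: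
  assumes l: "l > 0" and d: "dominated x l"
  shows "\<beta> \<le> f x / l\<^sup>2"
proof (rule dense_ge)
  fix b assume b: "f x / l\<^sup>2 < b"
  define b' where "b' = (f x / l\<^sup>2 + b) / 2"
  have pos: "f x / l\<^sup>2 > 0" using f_pos[of x] l by simp
  have "0 < (c + b) / 2 \<and> (c + b) / 2 < b \<and> c < (c + b) / 2" if "0 < c" "c < b" for c
    using that by auto
  from this[OF pos b] have b': "0 < b'" "b' < b" "f x / l\<^sup>2 < b'" by (auto simp: b'_def)
  have "((\<lambda>y. f (inversion x l y) / l\<^sup>2) \<longlongrightarrow> f x / l\<^sup>2) at_infinity"
    using l by (intro tendsto_intros tendsto_f_inversion) auto
  then have "eventually (\<lambda>y. f (inversion x l y) / l\<^sup>2 < b') at_infinity"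
    using b'(3) by (rule order_tendstoD(2))
  moreover have "eventually (\<lambda>y. norm (y - x) \<ge> l) at_infinity"
  proof -
    have "norm (y - x) \<ge> l" if "norm y \<ge> l + norm x" for y
      using that norm_triangle_ineq2[of y x] by simp
    then show ?thesis unfolding eventually_at_infinity by blast
  qed
  ultimately have "eventually (\<lambda>y. f y \<le> b' * (norm (y - x))\<^sup>2) at_infinity"
  proof eventually_elim
    case (elim y)
    have "f y \<le> kelvin x l f y" using d elim(2) by (auto simp: dominated_def)
    also have "\<dots> = f (inversion x l y) / l\<^sup>2 * (norm (y - x))\<^sup>2"
      by (simp add: kelvin_inversion dot_square_norm)
    also have "\<dots> \<le> b' * (norm (y - x))\<^sup>2" using elim(1) by (intro mult_right_mono) auto
    finally show ?case .
  qed
  then have "eventually (\<lambda>y. f y \<le> b * (norm (y - 0))\<^sup>2) at_infinity"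
    by (rule pointwise_le_near_at_infinity[OF b'(1,2)])
  then show "\<beta> \<le> b" by (intro \<beta>_le) (simp add: growth_rates_def)
qed

section \<open>The method of moving spheres\<close>

text \<open>
  Up to the factor \<open>- |y - x|\<^sup>2\<close>, the derivative of \<open>f y / |y - x|\<close> in the radial direction from \<open>x\<close>.
  It governs the comparison with Kelvin transforms near their sphere.
\<close>

definition radial :: "real ^ 'n \<Rightarrow> real ^ 'n \<Rightarrow> real" where
  "radial x y = f y - (y - x) \<bullet> G y"

lemma radial_cont: "continuous_on S (radial x)"
  unfolding radial_def using G_cont by (intro continuous_intros f_cont) (auto intro: continuous_on_subset)

text \<open>
  The Kelvin transform at \<open>y\<close> is \<open>(|y - x| / |y' - x|) f y'\<close>, where \<open>y'\<close> is the inverted point, which lies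
  on the ray from \<open>x\<close> to \<open>y\<close>.  So the claim is that \<open>f / |\<cdot> - x|\<close> does not increase from \<open>y'\<close> to \<open>y\<close>.
\<close>

lemma kelvin_ge_if_radial:
  assumes l: "l > 0" and y: "norm (y - x) \<ge> l"
    and rad: "\<And>z. l\<^sup>2 / norm (y - x) \<le> norm (z - x) \<Longrightarrow> norm (z - x) \<le> norm (y - x) \<Longrightarrow> radial x z \<ge> 0"
  shows "f y \<le> kelvin x l f y"
proof -
  define v where "v = y - x"
  have v: "norm v > 0" "norm v \<ge> l" using l y by (auto simp: v_def)
  define s where "s = l\<^sup>2 / (norm v)\<^sup>2"
  have s: "0 < s" "s \<le> 1" using v l by (auto simp: s_def power_mono)
  define \<phi> where "\<phi> = (\<lambda>r. f (x + r *\<^sub>R v) / r)"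
  have "\<phi> 1 \<le> \<phi> s"
  proof (rule DERIV_nonpos_imp_nonincreasing[OF s(2)])
    fix r assume r: "s \<le> r" "r \<le> 1"
    have r0: "r > 0" using r s by simp
    have "(f has_derivative (\<lambda>h. G (x + r *\<^sub>R v) \<bullet> h)) (at (x + r *\<^sub>R v))" by (rule f_deriv)
    then have "((\<lambda>r. f (x + r *\<^sub>R v)) has_derivative (\<lambda>t. G (x + r *\<^sub>R v) \<bullet> (t *\<^sub>R v))) (at r)"
      by (rule has_derivative_compose[rotated]) (auto intro!: derivative_eq_intros)
    then have "((\<lambda>r. f (x + r *\<^sub>R v)) has_real_derivative (G (x + r *\<^sub>R v) \<bullet> v)) (at r)"
      by (rule has_derivative_imp_has_field_derivative) simp
    then have "(\<phi> has_real_derivative ((G (x + r *\<^sub>R v) \<bullet> v) * r - f (x + r *\<^sub>R v)) / (r * r)) (at r)"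
      unfolding \<phi>_def using r0 by (auto intro!: derivative_eq_intros)
    moreover have "radial x (x + r *\<^sub>R v) \<ge> 0"
    proof (rule rad)
      have "l\<^sup>2 / norm v = s * norm v" using v by (simp add: s_def power2_eq_square)
      also have "\<dots> \<le> r * norm v" using r by (intro mult_right_mono) auto
      finally show "l\<^sup>2 / norm (y - x) \<le> norm (x + r *\<^sub>R v - x)" using r0 by (simp flip: v_def)
      show "norm (x + r *\<^sub>R v - x) \<le> norm (y - x)"
        using r r0 by (simp add: mult_left_le_one_le flip: v_def)
    qed
    then have "(G (x + r *\<^sub>R v) \<bullet> v) * r - f (x + r *\<^sub>R v) \<le> 0"
      by (simp add: radial_def inner_commute mult.commute)
    then have "((G (x + r *\<^sub>R v) \<bullet> v) * r - f (x + r *\<^sub>R v)) / (r * r) \<le> 0"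
      using r0 by (intro divide_nonpos_pos) auto
    ultimately show "\<exists>d. (\<phi> has_real_derivative d) (at r) \<and> d \<le> 0" by blast
  qed
  moreover have "\<phi> 1 = f y" by (simp add: \<phi>_def v_def)
  moreover have "\<phi> s = kelvin x l f y"
    using v l by (simp add: \<phi>_def s_def kelvin_def dot_square_norm flip: v_def)
  ultimately show ?thesis by simp
qed

text \<open>
  Near \<open>x\<close> the radial monotonicity holds because \<open>f x > 0\<close>.  Away from \<open>x\<close> the Kelvin transform
  is at least \<open>|y - x|\<^sup>2 min f / l\<^sup>2\<close>, which beats the quadratic growth of \<open>f\<close> once \<open>l\<close> is small.
\<close>

lemma moving_spheres_start: "\<exists>\<mu>>0. \<forall>l. 0 < l \<and> l < \<mu> \<longrightarrow> dominated x l"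
proof -
  have "isCont (radial x) x" using radial_cont[of UNIV x] by (simp add: continuous_on_eq_continuous_at)
  moreover have "radial x x > 0" by (simp add: radial_def f_pos)
  ultimately have "eventually (\<lambda>z. radial x z > 0) (at x)"
    unfolding isCont_def by (rule order_tendstoD(1))
  then obtain d where d: "d > 0" "\<And>z. z \<noteq> x \<Longrightarrow> dist z x < d \<Longrightarrow> radial x z > 0"
    unfolding eventually_at by blast
  define r where "r = d / 2"
  have r: "r > 0" and rad: "\<And>z. norm (z - x) \<le> r \<Longrightarrow> radial x z \<ge> 0"
  proof -
    show "r > 0" using d by (simp add: r_def)
    fix z assume "norm (z - x) \<le> r"
    then show "radial x z \<ge> 0"
      using d(2)[of z] \<open>radial x x > 0\<close> \<open>d > 0\<close> by (cases "z = x") (auto simp: r_def dist_norm less_imp_le)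
  qed
  obtain C where C: "C > 0" "\<And>y. norm (y - x) \<ge> r \<Longrightarrow> f y \<le> C * (norm (y - x))\<^sup>2"
    using quadratic_growth_from[OF r] by blast
  have "cball x r \<noteq> {}" using r by simp
  then obtain y0 where y0: "\<And>y. y \<in> cball x r \<Longrightarrow> f y0 \<le> f y"
    using continuous_attains_inf[OF compact_cball _ f_cont] by blast
  define \<mu> where "\<mu> = min r (sqrt (f y0 / C))"
  have "\<mu> > 0" using r C f_pos[of y0] by (simp add: \<mu>_def)
  moreover have "dominated x l" if l: "0 < l" "l < \<mu>" for l
    unfolding dominated_def
  proof (intro allI impI)
    fix y assume y: "norm (y - x) \<ge> l"
    show "f y \<le> kelvin x l f y"
    proof (cases "norm (y - x) \<le> r")
      case True
      then show ?thesis by (intro kelvin_ge_if_radial[OF l(1) y] rad) auto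
    next
      case False
      have "l\<^sup>2 \<le> (sqrt (f y0 / C))\<^sup>2" using l by (intro power_mono) (auto simp: \<mu>_def)
      then have "C \<le> f y0 / l\<^sup>2" using C l f_pos[of y0] by (simp add: field_simps)
      also have "f y0 \<le> f (inversion x l y)"
      proof (rule y0)
        have "l * l \<le> r * norm (y - x)" using l False r by (intro mult_mono) (auto simp: \<mu>_def)
        moreover have "norm (y - x) > 0" using l y by linarith
        ultimately have "norm (inversion x l y - x) \<le> r"
          unfolding norm_inversion power2_eq_square by (subst pos_divide_le_eq) auto
        then show "inversion x l y \<in> cball x r" by (simp add: dist_norm norm_minus_commute)
      qed
      then have "f y0 / l\<^sup>2 \<le> f (inversion x l y) / l\<^sup>2" by (intro divide_right_mono) auto
      finally have "C * (norm (y - x))\<^sup>2 \<le> f (inversion x l y) / l\<^sup>2 * (norm (y - x))\<^sup>2"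
        by (intro mult_right_mono) auto
      moreover have "kelvin x l f y = f (inversion x l y) / l\<^sup>2 * (norm (y - x))\<^sup>2"
        by (simp add: kelvin_inversion dot_square_norm)
      moreover have "f y \<le> C * (norm (y - x))\<^sup>2" using C(2)[of y] False by simp
      ultimately show ?thesis by linarith
    qed
  qed
  ultimately show ?thesis by blast
qed

lemma KG_sphere:
  assumes l: "l > 0" and y: "norm (y - x) = l"
  shows "KG x l y - G y = (2 * radial x y / l\<^sup>2) *\<^sub>R (y - x)"
proof -
  have "(y - x) \<bullet> (y - x) = l\<^sup>2" using y by (simp add: dot_square_norm)
  then show ?thesis
    using l by (simp add: inversion_sphere[OF y l] kelvin_grad_def refl_mult_vec radial_def
        diff_divide_distrib right_diff_distrib flip: scaleR_left_diff_distrib)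
qed

lemma kelvin_sphere: "l > 0 \<Longrightarrow> norm (y - x) = l \<Longrightarrow> kelvin x l f y = f y"
  by (simp add: kelvin_inversion inversion_sphere dot_square_norm)

lemma radial_nonneg_dominated:
  assumes l: "l > 0" and d: "dominated x l" and y: "norm (y - x) = l"
  shows "radial x y \<ge> 0"
proof -
  have yx: "y \<noteq> x" using l y by auto
  have "0 \<le> (KG x l y - G y) \<bullet> (y - x)"
  proof (rule has_derivative_one_sided_min)
    show "((\<lambda>y. kelvin x l f y - f y) has_derivative (\<lambda>h. (KG x l y - G y) \<bullet> h)) (at y)"
      by (rule jet2_has_derivative[OF jet2_diff[OF kelvin_jet[OF l yx] f_jet]])
    have "kelvin x l f y - f y \<le> kelvin x l f (y + t *\<^sub>R (y - x)) - f (y + t *\<^sub>R (y - x))" if t: "t > 0" for t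
    proof -
      have "y + t *\<^sub>R (y - x) - x = (1 + t) *\<^sub>R (y - x)" by (simp add: algebra_simps)
      then have "norm (y + t *\<^sub>R (y - x) - x) = (1 + t) * l" using t y by simp
      then have "norm (y + t *\<^sub>R (y - x) - x) \<ge> l" using t l by (simp add: distrib_right)
      then have "f (y + t *\<^sub>R (y - x)) \<le> kelvin x l f (y + t *\<^sub>R (y - x))" using d by (auto simp: dominated_def)
      then show ?thesis using kelvin_sphere[OF l y] by simp
    qed
    then show "eventually (\<lambda>t. kelvin x l f y - f y \<le> kelvin x l f (y + t *\<^sub>R (y - x)) - f (y + t *\<^sub>R (y - x))) (at_right 0)"
      using eventually_at_right_less[of 0] by (auto elim!: eventually_mono)
  qed
  also have "\<dots> = 2 * radial x y"
    using l y by (simp only: KG_sphere[OF l y] inner_scaleR_left dot_square_norm) simp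
  finally show ?thesis by simp
qed

lemma dominated_closed:
  assumes \<mu>: "\<mu> > 0" and d: "\<And>l. 0 < l \<Longrightarrow> l < \<mu> \<Longrightarrow> dominated x l"
  shows "dominated x \<mu>"
  unfolding dominated_def
proof (intro allI impI)
  fix y assume y: "norm (y - x) \<ge> \<mu>"
  have "isCont (\<lambda>l. kelvin x l f y) \<mu>"
    unfolding kelvin_def using \<mu> y
    by (intro continuous_intros isCont_o2[OF _ jet2_isCont[OF f_jet]]) auto
  then have "((\<lambda>l. kelvin x l f y) \<longlongrightarrow> kelvin x \<mu> f y) (at_left \<mu>)"
    unfolding isCont_def by (rule tendsto_mono[OF at_le[OF subset_UNIV]])
  moreover have "eventually (\<lambda>l. f y \<le> kelvin x l f y) (at_left \<mu>)"
  proof -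
    have "eventually (\<lambda>l. l \<in> {0<..<\<mu>}) (at_left \<mu>)" using \<mu> by (rule eventually_at_left_real)
    then show ?thesis
      by eventually_elim (use d y in \<open>auto simp: dominated_def\<close>)
  qed
  ultimately show "f y \<le> kelvin x \<mu> f y" by (rule tendsto_lowerbound) simp
qed

text \<open>
  When \<open>\<beta> < f x / \<mu>\<^sup>2\<close> there is no contact at infinity, uniformly in the radius \<open>l\<close> near \<open>\<mu>\<close>:
  the Kelvin transform grows like \<open>(f x / l\<^sup>2) |y|\<^sup>2\<close>.
\<close>

lemma kelvin_gt_far:
  assumes \<mu>: "\<mu> > 0" and b: "\<beta> < f x / \<mu>\<^sup>2"
  obtains R \<eta> where "R > 0" "\<eta> > 0"
    "\<And>l y. \<mu> \<le> l \<Longrightarrow> l \<le> \<mu> + \<eta> \<Longrightarrow> norm (y - x) \<ge> R \<Longrightarrow> f y < kelvin x l f y"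
proof -
  obtain b1 where b1: "\<beta> < b1" "b1 < f x / \<mu>\<^sup>2" using dense[OF b] by blast
  obtain b2 where b2: "b1 < b2" "b2 < f x / \<mu>\<^sup>2" using dense[OF b1(2)] by blast
  have b0: "b1 > 0" using b1 \<beta>_nonneg by simp
  have "b2 * \<mu>\<^sup>2 < f x" using b2(2) \<mu> by (simp add: field_simps)
  moreover have "(f \<longlongrightarrow> f x) (nhds x)"
    using jet2_isCont[OF f_jet[of x]] by (simp add: isCont_def tendsto_nhds_iff)
  ultimately have "eventually (\<lambda>z. b2 * \<mu>\<^sup>2 < f z) (nhds x)" by (rule order_tendstoD(1)[rotated])
  then obtain d where d: "d > 0" "\<And>z. dist z x < d \<Longrightarrow> b2 * \<mu>\<^sup>2 < f z"
    unfolding eventually_nhds_metric by blast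
  obtain R0 where R0: "\<And>y. norm y \<ge> R0 \<Longrightarrow> f y \<le> b1 * (norm (y - x))\<^sup>2"
    using \<beta>_upper[OF b1(1), of x] unfolding eventually_at_infinity by blast
  \<comment> \<open>radii up to \<open>s \<mu>\<close> lower the growth rate of the Kelvin transform at most from \<open>b2\<close> to \<open>b1\<close>\<close>
  define s where "s = sqrt (b2 / b1)"
  have s: "s > 1" using b2 b0 by (simp add: s_def)
  define \<eta> where "\<eta> = (s - 1) * \<mu>"
  define R where "R = max 1 (max (\<bar>R0\<bar> + norm x) ((s * \<mu>)\<^sup>2 / d + 1))"
  show thesis
  proof (rule that[of R \<eta>])
    show "R > 0" "\<eta> > 0" using s \<mu> by (auto simp: R_def \<eta>_def)
    fix l y assume l: "\<mu> \<le> l" "l \<le> \<mu> + \<eta>" and y: "norm (y - x) \<ge> R"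
    have ls: "l \<le> s * \<mu>" using l by (simp add: \<eta>_def algebra_simps)
    have l0: "l > 0" using l \<mu> by simp
    have l2: "l\<^sup>2 \<le> (s * \<mu>)\<^sup>2" using ls l0 by (intro power_mono) auto
    have ny: "norm (y - x) \<ge> 1" "norm (y - x) > (s * \<mu>)\<^sup>2 / d" "norm (y - x) \<ge> \<bar>R0\<bar> + norm x"
      using y by (auto simp: R_def)
    have "norm y \<ge> R0" using ny(3) norm_triangle_sub[of y x] norm_triangle_ineq4[of y x] by simp
    then have "f y \<le> b1 * (norm (y - x))\<^sup>2" by (rule R0)
    also have "\<dots> < f (inversion x l y) / l\<^sup>2 * (norm (y - x))\<^sup>2"
    proof (rule mult_strict_right_mono)
      have "(s * \<mu>)\<^sup>2 < d * norm (y - x)" using ny(2) d(1) by (simp add: field_simps)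
      then have "l\<^sup>2 / norm (y - x) < d" using l2 ny(1) d(1) by (simp add: divide_less_eq)
      then have "b2 * \<mu>\<^sup>2 < f (inversion x l y)" by (intro d(2)) (simp add: dist_norm norm_inversion)
      moreover have "b1 * l\<^sup>2 \<le> b2 * \<mu>\<^sup>2"
      proof -
        have "b1 * l\<^sup>2 \<le> b1 * (s * \<mu>)\<^sup>2" using l2 b0 by (intro mult_left_mono) auto
        also have "\<dots> = b2 * \<mu>\<^sup>2" using b0 b2 by (simp add: s_def power_mult_distrib)
        finally show ?thesis .
      qed
      ultimately show "b1 < f (inversion x l y) / l\<^sup>2" using l0 by (simp add: less_divide_eq)
      show "(norm (y - x))\<^sup>2 > 0" using ny(1) by (simp add: zero_less_power2) (use ny(1) in auto)
    qed
    also have "\<dots> = kelvin x l f y" by (simp add: kelvin_inversion dot_square_norm)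
    finally show "f y < kelvin x l f y" .
  qed
qed

text \<open>
  The strong maximum principle.  The exterior of the sphere is connected and there is no contact
  near infinity, so a nonempty contact set \<open>Z\<close> has a point \<open>x2\<close> on the boundary of a ball free of
  contact.  In the ball of half the radius tangent at \<open>x2\<close> the inequality is strict up to the boundary,
  except at \<open>x2\<close>, and the Hopf lemma contradicts the vanishing gradient there.
\<close>

lemma no_interior_touching:
  assumes \<mu>: "\<mu> > 0" and d: "dominated x \<mu>" and b: "\<beta> < f x / \<mu>\<^sup>2" and y: "norm (y - x) > \<mu>"
  shows "f y < kelvin x \<mu> f y"
proof (rule ccontr)
  assume "\<not> f y < kelvin x \<mu> f y"
  define E where "E = - cball x \<mu>"
  define Z where "Z = {y \<in> E. kelvin x \<mu> f y - f y = 0}"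
  have E: "y \<in> E \<longleftrightarrow> norm (y - x) > \<mu>" for y by (auto simp: E_def dist_norm norm_minus_commute)
  have Ex: "E \<subseteq> - {x}" using \<mu> by (auto simp: E)
  have ge: "f y \<le> kelvin x \<mu> f y" if "y \<in> E" for y using that d by (auto simp: E dominated_def)
  have yZ: "y \<in> Z" using \<open>\<not> f y < kelvin x \<mu> f y\<close> y ge[of y] by (auto simp: Z_def E)
  have cont: "continuous_on E (\<lambda>y. kelvin x \<mu> f y - f y)"
    using continuous_on_subset[OF kelvin_cont Ex] by (intro continuous_intros f_cont)
  have "connected E"
    unfolding E_def using dim by (intro connected_complement_bounded_convex) auto
  moreover have "closedin (top_of_set E) Z"
    unfolding Z_def by (rule continuous_closedin_preimage_constant[OF cont])
  moreover have "Z \<noteq> E"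
  proof
    assume ZE: "Z = E"
    obtain R \<eta> where R: "R > 0" "\<eta> > 0"
      "\<And>l y. \<mu> \<le> l \<Longrightarrow> l \<le> \<mu> + \<eta> \<Longrightarrow> norm (y - x) \<ge> R \<Longrightarrow> f y < kelvin x l f y"
      using kelvin_gt_far[OF \<mu> b] by blast
    define p where "p = x + (R + \<mu>) *\<^sub>R axis undefined 1"
    have "norm (p - x) = R + \<mu>" using R \<mu> by (simp add: p_def norm_axis_1)
    then have "f p < kelvin x \<mu> f p" "p \<in> E" using R(3)[of \<mu> p] R \<mu> by (auto simp: E)
    then have "p \<in> Z" using ZE by simp
    then show False using \<open>f p < kelvin x \<mu> f p\<close> by (simp add: Z_def)
  qed
  ultimately have "\<not> openin (top_of_set E) Z"
    using yZ unfolding connected_clopen by blast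
  then obtain x1 where x1: "x1 \<in> Z" "\<And>e. e > 0 \<Longrightarrow> \<not> ball x1 e \<inter> E \<subseteq> Z"
    unfolding openin_contains_ball by (auto simp: Z_def)
  define d where "d = norm (x1 - x) - \<mu>"
  have d: "d > 0" using x1(1) by (simp add: d_def Z_def E)
  have "\<not> ball x1 (d / 4) \<inter> E \<subseteq> Z" using x1(2)[of "d / 4"] d by simp
  then obtain p where p: "p \<in> ball x1 (d / 4)" "p \<in> E" "p \<notin> Z" by blast
  define r where "r = dist p x1"
  have r: "r < d / 4" using p(1) by (simp add: r_def dist_commute)
  have cb: "cball p r \<subseteq> E"
  proof
    fix w assume "w \<in> cball p r"
    then have "dist x1 w < d / 2"
      using dist_triangle[of x1 w p] r by (simp add: r_def dist_commute)
    then have "norm (x1 - w) < d / 2" by (simp add: dist_norm)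
    moreover have "norm (x1 - x) \<le> norm (w - x) + norm (x1 - w)"
      using norm_triangle_sub[of "x1 - x" "w - x"] by simp
    moreover have "norm (x1 - x) = \<mu> + d" by (simp add: d_def)
    ultimately show "w \<in> E" unfolding E using d by linarith
  qed
  define K where "K = {y \<in> cball p r. kelvin x \<mu> f y - f y = 0}"
  have "closed K"
    unfolding K_def by (intro continuous_closed_preimage_constant continuous_on_subset[OF cont cb]) simp
  then have "compact (cball p r \<inter> K)" by (intro compact_Int_closed compact_cball)
  moreover have "cball p r \<inter> K = K" by (auto simp: K_def)
  ultimately have K: "compact K" by simp
  have "x1 \<in> K" using x1(1) by (simp add: K_def Z_def r_def)
  then obtain x2 where x2: "x2 \<in> K" "\<And>w. w \<in> K \<Longrightarrow> dist p x2 \<le> dist p w"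
    using distance_attains_inf[of K p] compact_imp_closed[OF K] by blast
  define R where "R = dist p x2 / 2"
  have x2E: "x2 \<in> E" "x2 \<in> Z" using x2(1) cb by (auto simp: K_def Z_def)
  have R: "R > 0" using x2E(2) p(3) by (auto simp: R_def)
  have Rr: "2 * R \<le> r" using x2(1) by (simp add: R_def K_def)
  define z where "z = (1 / 2) *\<^sub>R (p + x2)"
  have zx: "dist x2 z = R"
  proof -
    have "x2 - z = (1 / 2) *\<^sub>R (x2 - p)" by (simp add: z_def algebra_simps flip: scaleR_left_distrib)
    then show ?thesis by (simp add: dist_norm R_def norm_minus_commute)
  qed
  have cz: "norm (w - p) < 2 * R" if w: "w \<in> cball z R" "w \<noteq> x2" for w
  proof -
    define a where "a = w - z"
    define c where "c = x2 - z"
    have ac: "a \<bullet> a \<le> R\<^sup>2" "c \<bullet> c = R\<^sup>2" "a \<noteq> c"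
      using w zx by (auto simp: a_def c_def dot_square_norm dist_norm norm_minus_commute power_mono)
    have "w - p = a + c"
      by (simp add: a_def c_def z_def algebra_simps flip: scaleR_left_distrib)
    then have "(norm (w - p))\<^sup>2 = 2 * (a \<bullet> a) + 2 * (c \<bullet> c) - (a - c) \<bullet> (a - c)"
      by (simp add: power2_norm_eq_inner inner_add_left inner_add_right inner_diff_left inner_diff_right inner_commute)
    also have "\<dots> < (2 * R)\<^sup>2"
    proof -
      have "(2 * R)\<^sup>2 = 4 * R\<^sup>2" by simp
      moreover have "(a - c) \<bullet> (a - c) > 0" using ac(3) by simp
      ultimately show ?thesis using ac(1,2) by linarith
    qed
    finally show ?thesis using R by (intro power2_less_imp_less[of _ "2 * R"]) auto
  qed
  have czE: "cball z R \<subseteq> E"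
  proof
    fix w assume w: "w \<in> cball z R"
    show "w \<in> E"
    proof (cases "w = x2")
      case False
      then have "w \<in> cball p r" using cz[OF w] Rr by (simp add: dist_norm norm_minus_commute)
      then show ?thesis using cb by blast
    qed (use x2E in simp)
  qed
  have strict: "f w < kelvin x \<mu> f w" if w: "w \<in> cball z R" "w \<noteq> x2" for w
  proof -
    have "w \<notin> K" using x2(2)[of w] cz[OF w] by (auto simp: R_def dist_norm norm_minus_commute)
    moreover have "w \<in> cball p r" using cz[OF w] Rr by (simp add: dist_norm norm_minus_commute)
    ultimately have "kelvin x \<mu> f w \<noteq> f w" by (simp add: K_def)
    then show ?thesis using ge[of w] czE w by fastforce
  qed
  have "f x2 = kelvin x \<mu> f x2" using x2E by (simp add: Z_def)
  then have "G x2 \<noteq> KG x \<mu> x2"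
    using czE Ex strict
    by (intro Hopf_boundary_point[OF solves_subset[OF sol] solves_subset[OF kelvin_solves[OF \<mu>, of x]] R zx]) auto
  moreover have "KG x \<mu> x2 - G x2 = 0"
  proof (rule jet2_local_min(1))
    show "jet2 (\<lambda>y. kelvin x \<mu> f y - f y) x2 (KG x \<mu> x2 - G x2) (KH x \<mu> x2 - H x2)"
      using x2E Ex by (intro jet2_diff kelvin_jet f_jet \<mu>) auto
    have "eventually (\<lambda>y. y \<in> E) (nhds x2)" using x2E by (intro eventually_nhds_in_open) (auto simp: E_def)
    then show "eventually (\<lambda>y. kelvin x \<mu> f x2 - f x2 \<le> kelvin x \<mu> f y - f y) (nhds x2)"
      by eventually_elim (use ge x2E in \<open>auto simp: Z_def\<close>)
  qed
  ultimately show False by simp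
qed

text \<open>
  On the sphere both functions agree, and their gradients differ by a multiple of \<open>radial x y\<close>.
  The Hopf lemma applies in the ball of radius \<open>\<mu>\<close> that touches the sphere from outside at \<open>y\<close>.
\<close>

lemma radial_pos_on_sphere:
  assumes \<mu>: "\<mu> > 0" and d: "dominated x \<mu>" and b: "\<beta> < f x / \<mu>\<^sup>2" and y: "norm (y - x) = \<mu>"
  shows "radial x y > 0"
proof (rule ccontr)
  assume "\<not> radial x y > 0"
  then have r0: "radial x y = 0" using radial_nonneg_dominated[OF \<mu> d y] by simp
  define z where "z = y + (y - x)"
  have out: "norm (w - x) > \<mu>" if w: "w \<in> cball z \<mu>" "w \<noteq> y" for w
  proof -
    have "norm (w - z) \<le> \<mu>" using w by (simp add: dist_norm norm_minus_commute)
    then have "(norm (w - z))\<^sup>2 \<le> \<mu>\<^sup>2" by (intro power_mono) auto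
    moreover have "(norm (w - z))\<^sup>2 + (norm (w - x))\<^sup>2 = 2 * ((w - y) \<bullet> (w - y)) + 2 * \<mu>\<^sup>2"
    proof -
      define a where "a = w - y"
      define c where "c = y - x"
      have "w - z = a - c" "w - x = a + c" by (simp_all add: z_def a_def c_def)
      then have "(norm (w - z))\<^sup>2 + (norm (w - x))\<^sup>2 = 2 * (a \<bullet> a) + 2 * (norm c)\<^sup>2"
        by (simp add: power2_norm_eq_inner inner_add_left inner_add_right inner_diff_left inner_diff_right inner_commute)
      then show ?thesis using y by (simp add: a_def c_def)
    qed
    moreover have "(w - y) \<bullet> (w - y) > 0" using w by simp
    ultimately have "\<mu>\<^sup>2 < (norm (w - x))\<^sup>2" by linarith
    then show ?thesis using power2_less_imp_less by fastforce
  qed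
  have sub: "cball z \<mu> \<subseteq> - {x}"
  proof
    fix w assume "w \<in> cball z \<mu>"
    then show "w \<in> - {x}" using out[of w] y \<mu> by (cases "w = y") auto
  qed
  have "dist y z = \<mu>" using y by (simp add: z_def dist_norm norm_minus_commute)
  then have "G y \<noteq> KG x \<mu> y"
    using no_interior_touching[OF \<mu> d b] out kelvin_sphere[OF \<mu> y]
    by (intro Hopf_boundary_point[OF solves_subset[OF sol] solves_subset[OF kelvin_solves[OF \<mu>, of x] sub] \<mu>])
      auto
  then show False using KG_sphere[OF \<mu> y] r0 by simp
qed

lemma radial_pos_near_sphere:
  assumes \<mu>: "\<mu> > 0" and d: "dominated x \<mu>" and b: "\<beta> < f x / \<mu>\<^sup>2"
  obtains \<delta> where "\<delta> > 0" "\<delta> < \<mu>"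
    "\<And>y. \<mu> - \<delta> < norm (y - x) \<Longrightarrow> norm (y - x) < \<mu> + \<delta> \<Longrightarrow> radial x y > 0"
proof -
  have "open {y. radial x y > 0}"
    using radial_cont by (intro open_Collect_less) auto
  moreover have "sphere x \<mu> \<subseteq> {y. radial x y > 0}"
    using radial_pos_on_sphere[OF \<mu> d b] by (auto simp: dist_norm norm_minus_commute)
  ultimately obtain e where e: "e > 0" "(\<Union>y\<in>sphere x \<mu>. ball y e) \<subseteq> {y. radial x y > 0}"
    using compact_subset_open_imp_ball_epsilon_subset[OF compact_sphere] by blast
  show thesis
  proof (rule that[of "min e (\<mu> / 2)"])
    fix y assume y: "\<mu> - min e (\<mu> / 2) < norm (y - x)" "norm (y - x) < \<mu> + min e (\<mu> / 2)"
    define v where "v = y - x"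
    have v: "norm v > 0" "\<bar>norm v - \<mu>\<bar> < e" using y \<mu> by (auto simp: v_def abs_less_iff min_def split: if_splits)
    define s where "s = x + (\<mu> / norm v) *\<^sub>R v"
    have "s \<in> sphere x \<mu>" using v \<mu> by (simp add: s_def dist_norm)
    moreover have "y \<in> ball s e"
    proof -
      have "y - s = (1 - \<mu> / norm v) *\<^sub>R v" by (simp add: s_def v_def algebra_simps)
      then have "norm (y - s) = \<bar>1 - \<mu> / norm v\<bar> * norm v" by simp
      also have "\<dots> = \<bar>(1 - \<mu> / norm v) * norm v\<bar>" by (simp add: abs_mult)
      also have "(1 - \<mu> / norm v) * norm v = norm v - \<mu>" using v by (simp add: left_diff_distrib)
      finally show ?thesis using v by (simp add: dist_norm norm_minus_commute)
    qed
    ultimately show "radial x y > 0" using e by blast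
  qed (use e \<mu> in auto)
qed

text \<open>
  Contact is excluded for slightly larger radii in three regions: near the sphere by radial
  monotonicity, near infinity by the growth rates, and on the compact region between by continuity.
\<close>

lemma moving_spheres_continue:
  assumes \<mu>: "\<mu> > 0" and dom: "\<And>l. 0 < l \<Longrightarrow> l < \<mu> \<Longrightarrow> dominated x l" and b: "\<beta> < f x / \<mu>\<^sup>2"
  shows "\<exists>\<mu>'>\<mu>. \<forall>l. 0 < l \<and> l < \<mu>' \<longrightarrow> dominated x l"
proof -
  have d: "dominated x \<mu>" by (rule dominated_closed[OF \<mu> dom])
  obtain \<delta> where \<delta>: "\<delta> > 0" "\<delta> < \<mu>"
    "\<And>y. \<mu> - \<delta> < norm (y - x) \<Longrightarrow> norm (y - x) < \<mu> + \<delta> \<Longrightarrow> radial x y > 0"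
    using radial_pos_near_sphere[OF \<mu> d b] by blast
  obtain R \<eta> where R: "R > 0" "\<eta> > 0"
    "\<And>l y. \<mu> \<le> l \<Longrightarrow> l \<le> \<mu> + \<eta> \<Longrightarrow> norm (y - x) \<ge> R \<Longrightarrow> f y < kelvin x l f y"
    using kelvin_gt_far[OF \<mu> b] by blast
  define K where "K = cball x R - ball x (\<mu> + \<delta> / 2)"
  have K: "compact K" by (simp add: K_def compact_diff)
  have Kx: "y \<noteq> x" "norm (y - x) > \<mu>" if "y \<in> K" for y
    using that \<mu> \<delta> by (auto simp: K_def dist_norm norm_minus_commute)
  obtain \<zeta> where \<zeta>: "\<zeta> > 0" "\<And>l y. \<mu> \<le> l \<Longrightarrow> l < \<mu> + \<zeta> \<Longrightarrow> y \<in> K \<Longrightarrow> f y \<le> kelvin x l f y"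
  proof (cases "K = {}")
    case True
    then show thesis using that[of 1] by simp
  next
    case False
    define \<Phi> where "\<Phi> = (\<lambda>p. kelvin x (fst p) f (snd p) - f (snd p))"
    define D where "D = {\<mu>..\<mu> + 1} \<times> K"
    have "compact D" unfolding D_def using K by (intro compact_Times) auto
    have cont: "continuous_on D \<Phi>"
      unfolding \<Phi>_def kelvin_def D_def using \<mu> Kx
      by (intro continuous_intros continuous_on_compose2[OF f_cont[of UNIV]]) auto
    then have "uniformly_continuous_on D \<Phi>" using \<open>compact D\<close> by (rule compact_uniformly_continuous)
    have "continuous_on K (\<lambda>y. \<Phi> (\<mu>, y))"
      by (rule continuous_on_compose2[OF cont]) (auto simp: D_def intro!: continuous_intros)
    then obtain y0 where y0: "y0 \<in> K" "\<And>y. y \<in> K \<Longrightarrow> \<Phi> (\<mu>, y0) \<le> \<Phi> (\<mu>, y)"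
      using continuous_attains_inf[OF K False] by blast
    have m: "\<Phi> (\<mu>, y0) > 0"
      using no_interior_touching[OF \<mu> d b Kx(2)[OF y0(1)]] by (simp add: \<Phi>_def)
    then obtain \<zeta> where \<zeta>: "\<zeta> > 0"
      "\<And>p p'. p \<in> D \<Longrightarrow> p' \<in> D \<Longrightarrow> dist p' p < \<zeta> \<Longrightarrow> dist (\<Phi> p') (\<Phi> p) < \<Phi> (\<mu>, y0)"
      using \<open>uniformly_continuous_on D \<Phi>\<close> unfolding uniformly_continuous_on_def by metis
    show thesis
    proof (rule that[of "min \<zeta> 1"])
      fix l y assume l: "\<mu> \<le> l" "l < \<mu> + min \<zeta> 1" and y: "y \<in> K"
      have "dist (\<Phi> (l, y)) (\<Phi> (\<mu>, y)) < \<Phi> (\<mu>, y0)"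
        using l y by (intro \<zeta>(2)) (auto simp: D_def dist_Pair_Pair dist_real_def)
      then have "\<Phi> (l, y) > 0" using y0(2)[OF y] by (simp add: dist_real_def)
      then show "f y \<le> kelvin x l f y" by (simp add: \<Phi>_def)
    qed (use \<zeta> in auto)
  qed
  define \<mu>' where "\<mu>' = \<mu> + min \<eta> (min \<zeta> (\<delta> / 2))"
  have "\<mu>' > \<mu>" using R \<zeta> \<delta> by (simp add: \<mu>'_def)
  moreover have "dominated x l" if l: "0 < l" "l < \<mu>'" for l
  proof (cases "l < \<mu>")
    case True
    then show ?thesis using dom l by simp
  next
    case False
    then have l2: "\<mu> \<le> l" "l < \<mu> + \<eta>" "l < \<mu> + \<zeta>" "l < \<mu> + \<delta> / 2" using l by (auto simp: \<mu>'_def)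
    show ?thesis
      unfolding dominated_def
    proof (intro allI impI)
      fix y assume y: "norm (y - x) \<ge> l"
      consider "norm (y - x) \<ge> R" | "norm (y - x) < \<mu> + \<delta> / 2" | "y \<in> K"
        by (force simp: K_def dist_norm norm_minus_commute)
      then show "f y \<le> kelvin x l f y"
      proof cases
        case 1
        then show ?thesis using R(3)[of l y] l2 by simp
      next
        case 3
        then show ?thesis using \<zeta>(2) l2 by simp
      next
        case 2
        show ?thesis
        proof (rule kelvin_ge_if_radial[OF l(1) y])
          fix z assume z: "l\<^sup>2 / norm (y - x) \<le> norm (z - x)" "norm (z - x) \<le> norm (y - x)"
          have "(\<mu> - \<delta>) * norm (y - x) \<le> (\<mu> - \<delta>) * (\<mu> + \<delta>)" using 2 \<delta> by (intro mult_left_mono) auto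
          also have "\<dots> < \<mu>\<^sup>2" using \<delta> by (simp add: algebra_simps power2_eq_square)
          also have "\<dots> \<le> l\<^sup>2" using l2 \<mu> by (intro power_mono) auto
          finally have "(\<mu> - \<delta>) * norm (y - x) < l\<^sup>2" .
          moreover have "norm (y - x) > 0" using y l by linarith
          ultimately have "\<mu> - \<delta> < l\<^sup>2 / norm (y - x)" by (subst pos_less_divide_eq) auto
          then show "radial x z \<ge> 0" using \<delta>(3)[of z] z 2 \<delta>(1) by simp
        qed
      qed
    qed
  qed
  ultimately show ?thesis by blast
qed

text \<open>
  The supremum of the radii up to which all spheres are dominated can only be finite if the
  comparison becomes sharp at infinity.
\<close>

lemma moving_spheres_alternative:
  "(\<forall>l>0. dominated x l) \<or> (\<exists>l>0. dominated x l \<and> \<beta> = f x / l\<^sup>2)"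
proof (cases "\<exists>l>0. \<not> dominated x l")
  case True
  then obtain l0 where l0: "l0 > 0" "\<not> dominated x l0" by blast
  define T where "T = {\<mu>. \<mu> > 0 \<and> (\<forall>l. 0 < l \<and> l < \<mu> \<longrightarrow> dominated x l)}"
  have ne: "T \<noteq> {}" using moving_spheres_start[of x] by (auto simp: T_def)
  have "\<mu> \<le> l0" if "\<mu> \<in> T" for \<mu> using that l0 by (force simp: T_def)
  then have bdd: "bdd_above T" by (rule bdd_aboveI)
  define s where "s = Sup T"
  have s0: "s > 0" using ne cSup_upper[OF _ bdd] by (force simp: T_def s_def)
  have dom: "dominated x l" if l: "0 < l" "l < s" for l
    using less_cSupD[OF ne l(2)[unfolded s_def]] l(1) by (auto simp: T_def)
  have d: "dominated x s" by (rule dominated_closed[OF s0 dom])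
  have "\<not> \<beta> < f x / s\<^sup>2"
  proof
    assume "\<beta> < f x / s\<^sup>2"
    then obtain \<mu>' where "\<mu>' > s" "\<forall>l. 0 < l \<and> l < \<mu>' \<longrightarrow> dominated x l"
      using moving_spheres_continue[OF s0 dom] by blast
    then have "\<mu>' \<in> T" using s0 by (simp add: T_def)
    then show False using cSup_upper[OF _ bdd] \<open>\<mu>' > s\<close> by (force simp: s_def)
  qed
  then have "\<beta> = f x / s\<^sup>2" using \<beta>_le_dominated[OF s0 d] by simp
  then show ?thesis using s0 d by blast
qed blast

text \<open>
  Take the centre \<open>y - s G y\<close> and let \<open>s\<close> tend to infinity: the radial inequality at \<open>y\<close> reads
  \<open>s |G y|\<^sup>2 \<le> f y\<close>.
\<close>

lemma gradient_zero_if_all_dominated: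
  assumes all: "\<And>x l. l > 0 \<Longrightarrow> dominated x l"
  shows "G y = 0"
proof (rule ccontr)
  assume ne: "G y \<noteq> 0"
  have le: "s * (G y \<bullet> G y) \<le> f y" if s: "s > 0" for s
  proof -
    have "radial (y - s *\<^sub>R G y) y \<ge> 0"
      using s ne by (intro radial_nonneg_dominated[OF _ all]) auto
    then show ?thesis by (simp add: radial_def)
  qed
  have pos: "G y \<bullet> G y > 0" using ne by simp
  have "(f y + 1) / (G y \<bullet> G y) > 0" using pos f_pos[of y] by (simp add: add_pos_pos)
  from le[OF this] show False using pos by simp
qed

section \<open>Comparison of critical spheres at infinity\<close>

text \<open>
  Pull everything back to the origin by inversion in the unit sphere.  The transform of \<open>f\<close> then
  lies below the transforms \<open>g x l\<close> of the two Kelvin transforms; these are differentiable at the origin,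
  with common value \<open>\<beta>\<close> and gradients \<open>G x - 2 \<beta> x\<close>.  If the gradients were different, passing to
  the superharmonic power would give a lower bound above \<open>\<beta> powr sup_exp\<close> near the origin, that is, a
  growth rate of \<open>f\<close> smaller than \<open>\<beta>\<close>.
\<close>

lemma same_growth_gradient:
  assumes l1: "l1 > 0" "dominated x1 l1" "\<beta> = f x1 / l1\<^sup>2"
    and l2: "l2 > 0" "dominated x2 l2" "\<beta> = f x2 / l2\<^sup>2"
  shows "G x1 - (2 * \<beta>) *\<^sub>R x1 = G x2 - (2 * \<beta>) *\<^sub>R x2"
proof (rule ccontr)
  assume ne: "G x1 - (2 * \<beta>) *\<^sub>R x1 \<noteq> G x2 - (2 * \<beta>) *\<^sub>R x2"
  have \<beta>: "\<beta> > 0" using l1 f_pos[of x1] by simp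
  \<comment> \<open>with \<open>y = z / |z|\<^sup>2\<close> one has \<open>|y - x|\<^sup>2 = D x z / |z|\<^sup>2\<close>\<close>
  define D where "D = (\<lambda>(x :: real ^ 'n) z. 1 - 2 * (x \<bullet> z) + (z \<bullet> z) * (x \<bullet> x))"
  define g where "g = (\<lambda>x (l :: real) z. D x z / l\<^sup>2 * f (x + (l\<^sup>2 / D x z) *\<^sub>R (z - (z \<bullet> z) *\<^sub>R x)))"
  define k where "k = (\<lambda>x l z. g x l z powr sup_exp)"
  have k_deriv: "(k x l has_derivative (\<lambda>h. ((sup_exp * \<beta> powr (sup_exp - 1)) *\<^sub>R (G x - (2 * \<beta>) *\<^sub>R x)) \<bullet> h)) (at 0)"
    and k0: "k x l 0 = \<beta> powr sup_exp" if l: "l > 0" "\<beta> = f x / l\<^sup>2" for x l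
  proof -
    have fx: "f x = \<beta> * l\<^sup>2" using l by simp
    have D0: "D x 0 = 1" by (simp add: D_def)
    have g0: "g x l 0 = \<beta>" using l by (simp add: g_def D_def)
    then show "k x l 0 = \<beta> powr sup_exp" by (simp add: k_def)
    have dD: "(D x has_derivative (\<lambda>h. - 2 * (x \<bullet> h))) (at 0)"
      unfolding D_def by (auto intro!: derivative_eq_intros)
    have in0: "((\<lambda>z. x + (l\<^sup>2 / D x z) *\<^sub>R (z - (z \<bullet> z) *\<^sub>R x)) has_derivative (\<lambda>h. l\<^sup>2 *\<^sub>R h)) (at 0)"
      by (rule derivative_eq_intros dD refl | simp add: D0)+
    have "((\<lambda>z. f (x + (l\<^sup>2 / D x z) *\<^sub>R (z - (z \<bullet> z) *\<^sub>R x))) has_derivative (\<lambda>h. G x \<bullet> (l\<^sup>2 *\<^sub>R h))) (at 0)"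
      by (rule has_derivative_compose[OF in0]) (use f_deriv[of x] in simp)
    from has_derivative_mult_right[OF has_derivative_mult[OF dD this], of "1 / l\<^sup>2"]
    have "((\<lambda>z. (1 / l\<^sup>2) * (D x z * f (x + (l\<^sup>2 / D x z) *\<^sub>R (z - (z \<bullet> z) *\<^sub>R x))))
        has_derivative (\<lambda>h. (1 / l\<^sup>2) * (1 * (G x \<bullet> (l\<^sup>2 *\<^sub>R h)) + - 2 * (x \<bullet> h) * f x))) (at 0)"
      by (simp add: D0)
    moreover have "(\<lambda>z. (1 / l\<^sup>2) * (D x z * f (x + (l\<^sup>2 / D x z) *\<^sub>R (z - (z \<bullet> z) *\<^sub>R x)))) = g x l"
      by (simp add: g_def fun_eq_iff)
    moreover have "(1 / l\<^sup>2) * (1 * (G x \<bullet> (l\<^sup>2 *\<^sub>R h)) + - 2 * (x \<bullet> h) * f x) = (G x - (2 * \<beta>) *\<^sub>R x) \<bullet> h" for h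
      using l(1) by (simp add: fx inner_diff_left field_simps)
    ultimately have dg: "(g x l has_derivative (\<lambda>h. (G x - (2 * \<beta>) *\<^sub>R x) \<bullet> h)) (at 0)" by simp
    have "((\<lambda>t. t powr sup_exp) has_real_derivative sup_exp * \<beta> powr (sup_exp - 1)) (at (g x l 0))"
      unfolding g0 using \<beta> by (auto intro!: derivative_eq_intros)
    then have "((\<lambda>t. t powr sup_exp) has_derivative (\<lambda>t. (sup_exp * \<beta> powr (sup_exp - 1)) * t)) (at (g x l 0))"
      by (simp add: has_field_derivative_def)
    from has_derivative_compose[OF dg this]
    show "(k x l has_derivative (\<lambda>h. ((sup_exp * \<beta> powr (sup_exp - 1)) *\<^sub>R (G x - (2 * \<beta>) *\<^sub>R x)) \<bullet> h)) (at 0)"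
      by (simp add: k_def)
  qed
  have k_le: "k x l z \<le> kelvin 0 1 f z powr sup_exp"
    if l: "l > 0" "dominated x l" and z: "0 < norm z" "norm z < 1 / (norm x + l)" for x l z
  proof -
    have z0: "z \<noteq> 0" using z by auto
    then have zz: "z \<bullet> z > 0" by simp
    define y where "y = inversion 0 1 z"
    have "norm x + l > 0" using l by (simp add: add_nonneg_pos)
    then have "norm y > norm x + l" using z by (simp add: y_def norm_inversion_0_1 field_simps)
    then have yx: "norm (y - x) \<ge> l" using norm_triangle_ineq2[of y x] by simp
    then have "y \<noteq> x" using l by auto
    have fy: "f y \<le> kelvin x l f y" using l yx by (simp add: dominated_def)
    have yz: "y - x = (1 / (z \<bullet> z)) *\<^sub>R (z - (z \<bullet> z) *\<^sub>R x)"
      using zz by (simp add: y_def inversion_0_1 scaleR_diff_right)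
    have Dz: "(y - x) \<bullet> (y - x) = D x z / (z \<bullet> z)"
      unfolding yz using zz
      by (simp add: D_def inner_diff_left inner_diff_right inner_commute field_simps)
    have Dpos: "D x z > 0"
    proof -
      have "D x z / (z \<bullet> z) > 0" using \<open>y \<noteq> x\<close> by (simp flip: Dz)
      then show ?thesis using zz by (simp add: zero_less_divide_iff)
    qed
    have "(z \<bullet> z) * kelvin x l f y = g x l z"
    proof -
      have "inversion x l y = x + (l\<^sup>2 / D x z) *\<^sub>R (z - (z \<bullet> z) *\<^sub>R x)"
        unfolding inversion_def Dz unfolding yz using zz by simp
      then show ?thesis using zz by (simp add: kelvin_inversion Dz g_def)
    qed
    moreover have "kelvin 0 1 f z = (z \<bullet> z) * f y" by (simp add: kelvin_0_1 y_def)
    ultimately have "kelvin 0 1 f z \<le> g x l z" using fy zz by (metis mult_left_mono less_imp_le)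
    moreover have "kelvin 0 1 f z > 0" using z0 by (intro kelvin_pos) auto
    ultimately show ?thesis using sup_exp_neg by (simp add: k_def powr_neg_le_iff)
  qed
  define r0 where "r0 = min (1 / (norm x1 + l1)) (1 / (norm x2 + l2))"
  have r0: "r0 > 0" using l1 l2 by (simp add: r0_def add_nonneg_pos)
  have "\<exists>\<epsilon>>0. eventually (\<lambda>z. \<beta> powr sup_exp + \<epsilon> \<le> kelvin 0 1 f z powr sup_exp) (at 0)"
  proof (rule superharmonic_liminf_gap[OF dim r0])
    show "kelvin 0 1 f z powr sup_exp > 0" if "0 < norm z" for z
      using kelvin_pos[of 1 z 0] that by simp
    show "\<exists>g H. jet2 (\<lambda>z. kelvin 0 1 f z powr sup_exp) z g H \<and> trace H \<le> 0" if "0 < norm z" for z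
      using that by (intro kelvin_superharmonic) auto
    show "(k x1 l1 has_derivative (\<lambda>h. ((sup_exp * \<beta> powr (sup_exp - 1)) *\<^sub>R (G x1 - (2 * \<beta>) *\<^sub>R x1)) \<bullet> h)) (at 0)"
      "k x1 l1 0 = \<beta> powr sup_exp"
      by (rule k_deriv[OF l1(1,3)], rule k0[OF l1(1,3)])
    show "(k x2 l2 has_derivative (\<lambda>h. ((sup_exp * \<beta> powr (sup_exp - 1)) *\<^sub>R (G x2 - (2 * \<beta>) *\<^sub>R x2)) \<bullet> h)) (at 0)"
      "k x2 l2 0 = \<beta> powr sup_exp"
      by (rule k_deriv[OF l2(1,3)], rule k0[OF l2(1,3)])
    show "k x1 l1 z \<le> kelvin 0 1 f z powr sup_exp" if "0 < norm z" "norm z < r0" for z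
      using k_le[OF l1(1,2)] that by (simp add: r0_def)
    show "k x2 l2 z \<le> kelvin 0 1 f z powr sup_exp" if "0 < norm z" "norm z < r0" for z
      using k_le[OF l2(1,2)] that by (simp add: r0_def)
    show "(sup_exp * \<beta> powr (sup_exp - 1)) *\<^sub>R (G x1 - (2 * \<beta>) *\<^sub>R x1) \<noteq> (sup_exp * \<beta> powr (sup_exp - 1)) *\<^sub>R (G x2 - (2 * \<beta>) *\<^sub>R x2)"
      using ne sup_exp_neg \<beta> by simp
  qed
  then obtain \<epsilon> where \<epsilon>: "\<epsilon> > 0" "eventually (\<lambda>z. \<beta> powr sup_exp + \<epsilon> \<le> kelvin 0 1 f z powr sup_exp) (at 0)" by blast
  define b where "b = (\<beta> powr sup_exp + \<epsilon>) powr (1 / sup_exp)"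
  have sum_pos: "\<beta> powr sup_exp + \<epsilon> > 0" using \<epsilon>(1) by (simp add: add_nonneg_pos)
  have bq: "b powr sup_exp = \<beta> powr sup_exp + \<epsilon>" using sum_pos sup_exp_neg by (simp add: b_def powr_powr)
  have b: "b > 0" using sum_pos by (simp add: b_def)
  have "b < \<beta>" using powr_neg_le_iff[OF b \<beta> sup_exp_neg] bq \<epsilon>(1) by (simp add: not_le[symmetric])
  obtain d where d: "d > 0" "\<And>z. z \<noteq> 0 \<Longrightarrow> dist z 0 < d \<Longrightarrow> \<beta> powr sup_exp + \<epsilon> \<le> kelvin 0 1 f z powr sup_exp"
    using \<epsilon>(2) unfolding eventually_at by blast
  have "f y \<le> b * (norm y)\<^sup>2" if y: "norm y \<ge> 1 / d + 1" for y
  proof -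
    have "norm y > 1 / d" "1 / d > 0" using y d by auto
    then have "norm y > 0" by linarith
    then have y0: "y \<noteq> 0" and "1 / norm y < d" using d \<open>norm y > 1 / d\<close> by (auto simp: field_simps)
    define z where "z = inversion 0 1 y"
    have z: "z \<noteq> 0" "dist z 0 < d"
      using y0 \<open>1 / norm y < d\<close> by (auto simp: z_def norm_inversion_0_1 inversion_neq)
    have "b powr sup_exp \<le> kelvin 0 1 f z powr sup_exp" using d(2)[OF z] by (simp add: bq)
    then have "kelvin 0 1 f z \<le> b" using powr_neg_le_iff[OF b kelvin_pos sup_exp_neg] z by simp
    then show ?thesis using y0 by (simp add: z_def kelvin_0_1_inversion field_simps)
  qed
  then have "b \<in> growth_rates" unfolding growth_rates_def eventually_at_infinity by blast
  then show False using \<beta>_le[of b] \<open>b < \<beta>\<close> by simp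
qed

text \<open>
  If \<open>\<beta> = 0\<close> every sphere is dominated and \<open>f\<close> is constant.  Otherwise each centre \<open>x\<close> has a critical
  radius, and since the gradients at infinity agree, \<open>f - \<beta> |x|\<^sup>2\<close> has constant gradient.
\<close>

theorem classification: "\<exists>p e. e > 0 \<and> (\<forall>x. f x = e + \<beta> * (norm (x - p))\<^sup>2)"
proof (cases "\<beta> = 0")
  case True
  have "dominated x l" if "l > 0" for x l
  proof -
    have "\<not> (\<exists>l>0. dominated x l \<and> \<beta> = f x / l\<^sup>2)" using True f_pos[of x] by (auto simp: less_le)
    then show ?thesis using moving_spheres_alternative[of x] that by blast
  qed
  then have "G y = 0" for y by (rule gradient_zero_if_all_dominated)
  then have "(f has_derivative (\<lambda>h. 0)) (at x within UNIV)" for x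
    using f_deriv[of x] by simp
  then obtain c where "\<And>x. f x = c" using has_derivative_zero_constant[of UNIV f] by auto
  then show ?thesis using True f_pos[of 0] by (intro exI[of _ "0 :: real ^ 'n"] exI[of _ c]) simp
next
  case False
  then have \<beta>: "\<beta> > 0" using \<beta>_nonneg by simp
  have crit: "\<exists>l>0. dominated x l \<and> \<beta> = f x / l\<^sup>2" for x
  proof (rule ccontr)
    assume "\<not> ?thesis"
    then have all: "dominated x l" if "l > 0" for l using moving_spheres_alternative[of x] that by blast
    \<comment> \<open>twice the critical value of \<open>l\<^sup>2\<close>\<close>
    define l where "l = sqrt (2 * f x / \<beta>)"
    have l: "l > 0" "l\<^sup>2 = 2 * f x / \<beta>" using \<beta> f_pos[of x] by (auto simp: l_def)
    have "\<beta> \<le> \<beta> / 2"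
      using \<beta>_le_dominated[OF l(1) all[OF l(1)]] f_pos[of x] \<beta> by (simp add: l(2))
    then show False using \<beta> by simp
  qed
  define V where "V = G 0"
  have G: "G x = (2 * \<beta>) *\<^sub>R x + V" for x
  proof -
    obtain l1 l0 where "l1 > 0" "dominated x l1" "\<beta> = f x / l1\<^sup>2" "l0 > 0" "dominated 0 l0" "\<beta> = f 0 / l0\<^sup>2"
      using crit[of x] crit[of 0] by blast
    then show ?thesis using same_growth_gradient[of l1 x l0 0] by (simp add: V_def algebra_simps)
  qed
  have "((\<lambda>x. f x - \<beta> * (x \<bullet> x) - V \<bullet> x) has_derivative (\<lambda>h. 0)) (at x within UNIV)" for x
  proof -
    have "((\<lambda>x. f x - \<beta> * (x \<bullet> x) - V \<bullet> x) has_derivative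
        (\<lambda>h. G x \<bullet> h - \<beta> * (x \<bullet> h + h \<bullet> x) - V \<bullet> h)) (at x)"
      by (auto intro!: derivative_eq_intros f_deriv)
    then show ?thesis by (simp add: G inner_add_left inner_commute algebra_simps)
  qed
  then obtain c where c: "\<And>x. f x - \<beta> * (x \<bullet> x) - V \<bullet> x = c"
    using has_derivative_zero_constant[of UNIV "\<lambda>x. f x - \<beta> * (x \<bullet> x) - V \<bullet> x"] by auto
  define p where "p = (- 1 / (2 * \<beta>)) *\<^sub>R V"
  have Vp: "V = (- 2 * \<beta>) *\<^sub>R p" using \<beta> by (simp add: p_def)
  have form: "f x = (c - \<beta> * (p \<bullet> p)) + \<beta> * (norm (x - p))\<^sup>2" for x
    using c[of x] by (simp add: Vp power2_norm_eq_inner inner_diff_left inner_diff_right inner_commute algebra_simps)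
  have "c - \<beta> * (p \<bullet> p) > 0" using form[of p] f_pos[of p] by simp
  then show ?thesis using form by blast
qed

end

section \<open>The Liouville theorem\<close>

theorem theorem1:
  fixes U :: "(real ^ 'n ^ 'n) set"
    and F :: "real ^ 'n ^ 'n \<Rightarrow> real"
    and u :: "real ^ 'n \<Rightarrow> real"
  assumes n_ge_3: "CARD('n) \<ge> 3"
    and U_open: "openin (top_of_set sym_matrices) U"
    and U_inv: "\<And>Q :: real ^ 'n ^ 'n. orthogonal_matrix Q \<Longrightarrow>
          (\<lambda>M. matrix_inv Q ** M ** Q) ` U = U"
    and U_convex: "\<And>M N. M \<in> sym_matrices \<Longrightarrow> pos_def N \<Longrightarrow>
          convex (U \<inter> {M + t *\<^sub>R N | t :: real. 0 < t})"
    and F_C1: "C1_on_sym U F"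
    and F_inv: "\<And>M Q. M \<in> U \<Longrightarrow> orthogonal_matrix Q \<Longrightarrow>
          F (matrix_inv Q ** M ** Q) = F M"
    and F_elliptic: "\<And>M. M \<in> U \<Longrightarrow> pos_def (sym_grad F M)"
    and u_C2: "C2_on UNIV u"
    and u_pos: "\<And>x. u x > 0"
    and u_U: "\<And>x. conf_hess u x \<in> U"
    and u_eq: "\<And>x. F (conf_hess u x) = 1"
    and u_superharmonic: "\<And>x. laplacian u x \<le> 0"
  shows "\<exists>(p :: real ^ 'n) (a :: real) (b :: real). a > 0 \<and> b \<ge> 0 \<and>
    (2 * b\<^sup>2 / a\<^sup>2) *\<^sub>R mat 1 \<in> U \<and> F ((2 * b\<^sup>2 / a\<^sup>2) *\<^sub>R mat 1) = 1 \<and>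
    (\<forall>x. u x = (a / (1 + b\<^sup>2 * (norm (x - p))\<^sup>2)) powr ((real CARD('n) - 2) / 2))"
proof -
  interpret elliptic_equation U F
    by unfold_locales (fact U_open U_inv U_convex F_C1 F_inv F_elliptic)+
  define m where "m = - (2 / (real CARD('n) - 2))"
  define f where "f = (\<lambda>x. u x powr m)"
  define G where "G = (\<lambda>x. (m * u x powr (m - 1)) *\<^sub>R grad u x)"
  define H where "H = (\<lambda>x. (m * u x powr (m - 1)) *\<^sub>R hess u x
    + (m * (m - 1) * u x powr (m - 2)) *\<^sub>R outer_prod (grad u x) (grad u x))"
  have A: "conf_hess u x = conf_mat (f x) (G x) (H x)" for x
    unfolding f_def G_def H_def m_def by (rule conf_hess_eq_conf_mat[OF n_ge_3 u_pos])
  have sym: "transpose (hess u x) = hess u x" for x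
  proof -
    define c where "c = u x powr m * (m * u x powr (m - 1))"
    have "m \<noteq> 0" using n_ge_3 by (simp add: m_def)
    then have c: "c \<noteq> 0" using u_pos[of x] by (simp add: c_def)
    define B where "B = conf_hess u x
      - (u x powr m * (m * (m - 1) * u x powr (m - 2))) *\<^sub>R outer_prod (grad u x) (grad u x)
      + (G x \<bullet> G x / 2) *\<^sub>R mat 1"
    have "transpose (conf_hess u x) = conf_hess u x"
      using U_sym[OF u_U] by (simp add: sym_matrices_iff)
    then have "transpose B = B"
      by (simp add: B_def transpose_add transpose_diff transpose_scaleR transpose_outer_prod transpose_mat)
    moreover have "B = c *\<^sub>R hess u x"
      unfolding B_def A conf_mat_def by (simp add: f_def H_def c_def scaleR_add_right)
    ultimately show ?thesis using c by (simp add: transpose_scaleR)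
  qed
  have u_jet: "jet2 u x (grad u x) (hess u x)" for x
    using u_C2 sym by (intro jet2_of_C2) (auto simp: C2_on_def)
  have u_cont: "continuous_on UNIV u" "continuous_on UNIV (grad u)" "continuous_on UNIV (hess u)"
    using u_C2 by (auto simp: C2_on_def differentiable_imp_continuous_on)
  have u0: "u x \<noteq> 0" for x using u_pos[of x] by simp
  have sol: "solves UNIV f G H"
    unfolding solves_def
  proof (intro conjI ballI)
    show "continuous_on UNIV G" unfolding G_def by (intro continuous_intros u_cont) (simp add: u0)
    show "continuous_on UNIV H" unfolding H_def outer_prod_def
      by (intro continuous_intros u_cont) (simp_all add: u0)
    fix x
    show "f x > 0" using u_pos[of x] by (simp add: f_def)
    show "jet2 f x (G x) (H x)" unfolding f_def G_def H_def by (rule jet2_powr[OF u_jet u_pos])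
    show "conf_mat (f x) (G x) (H x) \<in> U" "F (conf_mat (f x) (G x) (H x)) = 1"
      using u_U[of x] u_eq[of x] by (simp_all add: A)
  qed
  interpret entire_solution U F f G H
  proof
    show "CARD('n) \<ge> 3" by (rule n_ge_3)
    show "solves UNIV f G H" by (rule sol)
    show "trace (conf_mat (f x) (G x) (H x)) \<ge> 0" for x
      using trace_conf_hess_nonneg[OF n_ge_3 u_pos u_superharmonic, of x] by (simp add: A)
  qed
  obtain p e k where e: "e > 0" and k: "k \<ge> 0" and f_eq: "\<And>x. f x = e + k * (norm (x - p))\<^sup>2"
    using classification \<beta>_nonneg by blast
  have f_eq': "f = (\<lambda>x. e + k * ((x - p) \<bullet> (x - p)))"
    using f_eq by (simp add: fun_eq_iff power2_norm_eq_inner)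
  have "jet2 f p (0 + k *\<^sub>R (2 *\<^sub>R (p - p))) (0 + k *\<^sub>R (2 *\<^sub>R mat 1))"
    unfolding f_eq' by (intro jet2_add jet2_const jet2_cmult jet2_dist_square)
  then have "G p = 0" "H p = k *\<^sub>R (2 *\<^sub>R mat 1)"
    using jet2_unique[OF f_jet[of p]] by auto
  then have Ap: "conf_hess u p = (2 * k * e) *\<^sub>R mat 1"
    by (simp add: A conf_mat_def f_eq mult_ac)
  \<comment> \<open>\<open>a\<close> and \<open>b\<close> are read off from \<open>1 / f = (1 / e) / (1 + (k / e) |x - p|\<^sup>2)\<close>; the matrix in the
    conclusion is the conformal Hessian at \<open>p\<close>, where the gradient vanishes\<close>
  define a where "a = 1 / e"
  define b where "b = sqrt (k / e)"
  have b2: "b\<^sup>2 = k / e" using e k by (simp add: b_def)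
  have ab: "2 * b\<^sup>2 / a\<^sup>2 = 2 * k * e"
    unfolding a_def b2 using e by (simp add: power2_eq_square)
  have "u x = (a / (1 + b\<^sup>2 * (norm (x - p))\<^sup>2)) powr ((real CARD('n) - 2) / 2)" for x
  proof -
    have "a / (1 + b\<^sup>2 * (norm (x - p))\<^sup>2) = 1 / f x"
      using e by (simp add: a_def b2 f_eq field_simps)
    also have "\<dots> = u x powr (- m)" using u_pos[of x] by (simp add: f_def powr_minus_divide)
    finally have E: "a / (1 + b\<^sup>2 * (norm (x - p))\<^sup>2) = u x powr (- m)" .
    have e1: "- m * ((real CARD('n) - 2) / 2) = 1" using n_ge_3 by (simp add: m_def)
    show ?thesis unfolding E powr_powr e1 using u_pos[of x] by simp
  qed
  moreover have "a > 0" "b \<ge> 0" using e k by (simp_all add: a_def b_def)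
  ultimately show ?thesis
    using u_U[of p] u_eq[of p] unfolding Ap by (intro exI[of _ p] exI[of _ a] exI[of _ b]) (simp add: ab)
qed

end
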